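(* Let $X$ be a monotone symplectic manifold and $w\in\mathbb C$. Assume that the cyclic open-closed map $\mathcal{OC}^-:HC^-_*(Fuk(X)_w)\to QH^*(X)[[u]]$ exists and is a morphism of TE-structures (i.e. it is $\mathbb C[[u]]$-linear and intertwines the connections $\nabla_{\frac d{du}}$). Then $$\mathcal{OC}^-(HC^-_*(Fuk(X)_w))\subset QH^*(X)[[u]]_w .$$
   Context: **E-structures.** An E-structure is a free finitely generated $\mathbb Z/2$-graded $\mathbb C[[u]]$-module $\mathcal E$ ($u$ even) with an even connection $\nabla=\nabla_{\frac d{du}}:\mathcal E\to u^{-2}\mathcal E$. A morphism is a $\mathbb C[[u]]$-linear map commuting with the connections. **Quantum E-structure.** $X$ has real dimension $2n$ and $c_1(TX)=\tau[\omega]$ with $\tau>0$. $QH^*(X)=H^*(X;\mathbb C)$ with the quantum product $\star$ over $\mathbb C$ (Novikov parameter $1$, no bulk deformation). $QH^*(X)[[u]]$ carries $\nabla_{\frac d{du}}=\frac d{du}+\frac\mu u+\frac{c_1\star}{u^2}$, where $\mu=\frac{p-n}2$ on $QH^p(X)$. Let $QH^*(X)_w$ be the generalised $w$-eigenspace of $c_1\star$ and $\pi:QH^*(X)[[u]]\to QH^*(X)$ evaluation at $u=0$. There is a unique decomposition $QH^*(X)[[u]]=\bigoplus_wQH^*(X)[[u]]_w$ into $\mathbb C[[u]]$-submodules with $u^2\nabla(QH^*(X)[[u]]_w)\subset QH^*(X)[[u]]_w$ and $\pi(QH^*(X)[[u]]_w)=QH^*(X)_w$ (Hukuhara--Levelt--Turrittin);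 set $QH^*(X)[[u]]_w=0$ if $w$ is not an eigenvalue of $c_1\star$. **Fukaya category.** $Fuk(X)_w$ is the $\mathbb C$-linear, $\mathbb Z/2$-graded, strictly unital monotone Fukaya category whose objects are the monotone Lagrangians with disk potential $w$, regarded as weakly curved with curvature $\mathfrak m_0=w\cdot 1$. **Connection on cyclic homology** (for a strictly unital $\mathbb C$-linear $A_\infty$-category; written for an algebra $A$, for a category use composable morphisms). Write $|\alpha|'=|\alpha|-1$, $\epsilon(\alpha)=\sum|\alpha_j|'$; $S_n[k]$ denotes decompositions of $(1,\dots,k)$ into $n$ consecutive possibly empty intervals $(i:n)$, $\epsilon_i=\epsilon(\alpha^{(i:n)})$. $HC^-_*(A)$ is the homology of reduced chains $\bigoplus_kA\otimes(A/\mathbb C\mathbf e)^{\otimes k}$, tensored with $[[u]]$, with differential $b+uB$: $b(\alpha)=\sum_{S_3[k]}(-1)^{\epsilon_3(\epsilon_2+\epsilon_1+|\alpha_0|')}\mathfrak m(\alpha^{(3:3)}\otimes\alpha_0\otimes\alpha^{(1:3)})[\alpha^{(2:3)}]+\sum_{S_3[k]}(-1)^{\epsilon_1+|\alpha_0|'}\alpha_0[\alpha^{(1:3)}|\mathfrak m(\alpha^{(2:3)})|\alpha^{(3:3)}]$, $B(\alpha)=\sum_{S_2[k]}(-1)^{\epsilon_2(|\alpha_0|'+\epsilon_1)}\mathbf e[\alpha^{(2:2)}|\alpha_0|\alpha^{(1:2)}]$. The connection is $\nabla_{\frac d{du}}=\frac d{du}+\frac\Gamma{2u}+\frac{i\{\mathfrak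 m'\}}{2u^2}$, with $\Gamma=-k$ on $\alpha_0[\alpha_1|\dots|\alpha_k]$, $\mathfrak m'=\sum_k(2-k)\mathfrak m_k$, $i\{\phi\}=b^{1,1}(\phi,\cdot)+uB^{1,1}(\phi,\cdot)$, $b^{1,1}(\phi;\alpha)=\sum_{S_5[k]}(-1)^{(\epsilon_3+\epsilon_4+\epsilon_5)(|\alpha_0|'+\epsilon_1+\epsilon_2)+|\phi|'\epsilon_3}\mathfrak m(\alpha^{(3:5)}\otimes\phi(\alpha^{(4:5)})\otimes\alpha^{(5:5)}\otimes\alpha_0\otimes\alpha^{(1:5)})[\alpha^{(2:5)}]$, $B^{1,1}(\phi;\alpha)=\sum_{S_4[k]}(-1)^{|\phi|'\epsilon_2+(\epsilon_1+|\alpha_0|')(\epsilon_2+\epsilon_3+\epsilon_4)}\mathbf e[\alpha^{(2:4)}|\phi(\alpha^{(3:4)})|\alpha^{(4:4)}|\alpha_0|\alpha^{(1:4)}]$. **Standing assumption.** The noncommutative Hodge--de Rham spectral sequence of $Fuk(X)_w$ degenerates, so that $HC^-_*(Fuk(X)_w)$ is an E-structure with $HC^-_*/uHC^-_*=HH_*(Fuk(X)_w)$ finite dimensional. *)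

theory Defs
  imports
    "HOL-Analysis.Analysis"
    "HOL-Algebra.Module"
    "HOL-Library.Poly_Mapping"
    "HOL-Library.FuncSet"
    "HOL-Computational_Algebra.Formal_Power_Series"
begin

section \<open>Modules over power series\<close>

text \<open>For a complex vector space \<open>V\<close> the module \<open>V[[u]]\<close> is the type \<open>V fps\<close>; it is a module over
  \<open>complex fps\<close>, the ring of power series in \<open>u\<close>.\<close>

definition CU :: "complex fps ring" where
  "CU = \<lparr>carrier = UNIV, monoid.mult = (*), one = 1, zero = 0, add = (+)\<rparr>"

definition fps_smult ::
  "(complex \<Rightarrow> 'v::ab_group_add \<Rightarrow> 'v) \<Rightarrow> complex fps \<Rightarrow> 'v fps \<Rightarrow> 'v fps" where
  "fps_smult sc f x = Abs_fps (\<lambda>n. \<Sum>i\<le>n. sc (fps_nth f i) (fps_nth x (n - i)))"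

definition fps_map :: "('v \<Rightarrow> 'w) \<Rightarrow> 'v fps \<Rightarrow> 'w fps" where
  "fps_map g x = Abs_fps (\<lambda>n. g (fps_nth x n))"

definition u_times :: "'v::zero fps \<Rightarrow> 'v fps" where
  "u_times x = Abs_fps (\<lambda>n. if n = 0 then 0 else fps_nth x (n - 1))"

definition d_du :: "(complex \<Rightarrow> 'v \<Rightarrow> 'v) \<Rightarrow> 'v fps \<Rightarrow> 'v fps" where
  "d_du sc x = Abs_fps (\<lambda>n. sc (of_nat (Suc n)) (fps_nth x (Suc n)))"

definition internal_direct_sum :: "'i set \<Rightarrow> ('i \<Rightarrow> 'v::ab_group_add set) \<Rightarrow> bool" where
  "internal_direct_sum I V \<longleftrightarrow>
     (\<forall>x. \<exists>!c. (\<forall>i\<in>I. c i \<in> V i) \<and> (\<forall>i. i \<notin> I \<longrightarrow> c i = 0) \<and> x = (\<Sum>i\<in>I. c i))"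


section \<open>E-structures\<close>

text \<open>A connection with values in \<open>u\<^sup>-\<^sup>2 E\<close> on a free (hence \<open>u\<close>-torsion free) module \<open>E\<close> is recorded
  by \<open>u\<^sup>2\<nabla>\<close>, an endomorphism of \<open>E\<close> itself. Commuting with \<open>\<nabla>\<close> and commuting with \<open>u\<^sup>2\<nabla>\<close> are the
  same for a map that is linear over power series in \<open>u\<close>. The ring fields \<open>mult\<close> and \<open>one\<close> that a
  module record inherits from HOL-Algebra play no role.\<close>

record 'e e_module = "(complex fps, 'e) module" +
  even_part :: "'e set"
  odd_part :: "'e set"
  u2nabla :: "'e \<Rightarrow> 'e"

definition fg_free :: "('e, 'z) e_module_scheme \<Rightarrow> bool" where
  "fg_free E \<longleftrightarrow>
     (\<exists>S. finite S \<and> S \<subseteq> carrier E \<and>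
        (\<forall>x\<in>carrier E. \<exists>!c. c \<in> S \<rightarrow>\<^sub>E (UNIV :: complex fps set) \<and>
            x = finsum E (\<lambda>s. c s \<odot>\<^bsub>E\<^esub> s) S))"

definition E_structure :: "('e, 'z) e_module_scheme \<Rightarrow> bool" where
  "E_structure E \<longleftrightarrow>
     module CU E \<and> fg_free E \<and>
     submodule (even_part E) CU E \<and> submodule (odd_part E) CU E \<and>
     (\<forall>x\<in>carrier E. \<exists>!p. p \<in> even_part E \<times> odd_part E \<and> x = fst p \<oplus>\<^bsub>E\<^esub> snd p) \<and>
     u2nabla E \<in> carrier E \<rightarrow> carrier E \<and>
     u2nabla E ` even_part E \<subseteq> even_part E \<and> u2nabla E ` odd_part E \<subseteq> odd_part E \<and>
     (\<forall>x\<in>carrier E. \<forall>y\<in>carrier E. u2nabla E (x \<oplus>\<^bsub>E\<^esub> y) = u2nabla E x \<oplus>\<^bsub>E\<^esub> u2nabla E y) \<and>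
     (\<forall>f. \<forall>x\<in>carrier E. u2nabla E (f \<odot>\<^bsub>E\<^esub> x) =
        (fps_X ^ 2 * fps_deriv f) \<odot>\<^bsub>E\<^esub> x \<oplus>\<^bsub>E\<^esub> f \<odot>\<^bsub>E\<^esub> u2nabla E x)"

definition TE_morphism ::
  "('e, 'y) e_module_scheme \<Rightarrow> ('f, 'z) e_module_scheme \<Rightarrow> ('e \<Rightarrow> 'f) \<Rightarrow> bool" where
  "TE_morphism E F \<Phi> \<longleftrightarrow>
     \<Phi> \<in> carrier E \<rightarrow> carrier F \<and>
     (\<forall>x\<in>carrier E. \<forall>y\<in>carrier E. \<Phi> (x \<oplus>\<^bsub>E\<^esub> y) = \<Phi> x \<oplus>\<^bsub>F\<^esub> \<Phi> y) \<and>
     (\<forall>f. \<forall>x\<in>carrier E. \<Phi> (f \<odot>\<^bsub>E\<^esub> x) = f \<odot>\<^bsub>F\<^esub> \<Phi> x) \<and>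
     (\<forall>x\<in>carrier E. \<Phi> (u2nabla E x) = u2nabla F (\<Phi> x))"


section \<open>Weakly curved strictly unital A-infinity categories\<close>

text \<open>\<open>Mor X Y p v\<close> is the homogeneous morphism \<open>v\<close> from \<open>X\<close> to \<open>Y\<close> of parity \<open>p\<close> (0 even, 1 odd).
  All morphism spaces are subspaces of one ambient vector space.\<close>

datatype ('o, 'm) mor = Mor (src: 'o) (tgt: 'o) (par: nat) (vec: 'm)

text \<open>\<open>mu C X [\<alpha>\<^sub>1, \<dots>, \<alpha>\<^sub>k]\<close> is \<open>\<mm>\<^sub>k(\<alpha>\<^sub>1 \<otimes> \<dots> \<otimes> \<alpha>\<^sub>k)\<close> for \<open>\<alpha>\<^sub>1\<close> starting at the object \<open>X\<close> and \<open>\<alpha>\<^sub>i\<^sub>+\<^sub>1\<close>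
  starting where \<open>\<alpha>\<^sub>i\<close> ends; \<open>mu C X []\<close> is the curvature \<open>\<mm>\<^sub>0\<close> of \<open>X\<close>.\<close>

record ('o, 'm) ainf_cat =
  obj :: "'o set"
  mor_space :: "'o \<Rightarrow> 'o \<Rightarrow> nat \<Rightarrow> 'm set"
  scl :: "complex \<Rightarrow> 'm \<Rightarrow> 'm"
  mu :: "'o \<Rightarrow> ('o, 'm) mor list \<Rightarrow> 'm"
  unt :: "'o \<Rightarrow> 'm"

text \<open>Only the parity of the shifted degree \<open>|\<alpha>|' = |\<alpha>| - 1\<close> matters, so it is taken to be
  \<open>|\<alpha>| + 1\<close>.\<close>

definition sd :: "('o, 'm) mor \<Rightarrow> nat" where
  "sd \<alpha> = par \<alpha> + 1"

definition eps :: "('o, 'm) mor list \<Rightarrow> nat" where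
  "eps \<alpha>s = sum_list (map sd \<alpha>s)"

fun endpt :: "'o \<Rightarrow> ('o, 'm) mor list \<Rightarrow> 'o" where
  "endpt X [] = X"
| "endpt X (\<alpha> # \<alpha>s) = endpt (tgt \<alpha>) \<alpha>s"

definition is_mor :: "('o, 'm) ainf_cat \<Rightarrow> ('o, 'm) mor \<Rightarrow> bool" where
  "is_mor C \<alpha> \<longleftrightarrow> src \<alpha> \<in> obj C \<and> tgt \<alpha> \<in> obj C \<and> par \<alpha> < 2 \<and> vec \<alpha> \<in> mor_space C (src \<alpha>) (tgt \<alpha>) (par \<alpha>)"

fun is_path :: "('o, 'm) ainf_cat \<Rightarrow> 'o \<Rightarrow> ('o, 'm) mor list \<Rightarrow> 'o \<Rightarrow> bool" where
  "is_path C X [] Y \<longleftrightarrow> X \<in> obj C \<and> X = Y"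
| "is_path C X (\<alpha> # \<alpha>s) Y \<longleftrightarrow> is_mor C \<alpha> \<and> src \<alpha> = X \<and> is_path C (tgt \<alpha>) \<alpha>s Y"

text \<open>The morphism obtained by applying to a composable sequence a Hochschild cochain \<open>\<phi>\<close> whose
  shifted degree \<open>|\<phi>|'\<close> has the parity of \<open>d\<close>, that is, \<open>|\<phi>(\<gamma>)|' = |\<phi>|' + \<epsilon>(\<gamma>)\<close>. The operations
  \<open>\<mm>\<close> have \<open>d = 1\<close>.\<close>

definition app_cochain ::
  "nat \<Rightarrow> ('o \<Rightarrow> ('o, 'm) mor list \<Rightarrow> 'm) \<Rightarrow> 'o \<Rightarrow> ('o, 'm) mor list \<Rightarrow> ('o, 'm) mor" where
  "app_cochain d \<phi> X \<gamma> = Mor X (endpt X \<gamma>) ((d + 1 + eps \<gamma>) mod 2) (\<phi> X \<gamma>)"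

abbreviation app_mu :: "('o, 'm) ainf_cat \<Rightarrow> 'o \<Rightarrow> ('o, 'm) mor list \<Rightarrow> ('o, 'm) mor" where
  "app_mu C \<equiv> app_cochain 1 (mu C)"

definition unit_mor :: "('o, 'm) ainf_cat \<Rightarrow> 'o \<Rightarrow> ('o, 'm) mor" where
  "unit_mor C X = Mor X X 0 (unt C X)"

text \<open>\<open>S\<^sub>n \<alpha>s\<close>: decompositions of \<open>\<alpha>s\<close> into \<open>n\<close> consecutive, possibly empty, pieces.\<close>

definition S2 :: "'a list \<Rightarrow> ('a list \<times> 'a list) set" where
  "S2 \<alpha>s = {(a1, a2). a1 @ a2 = \<alpha>s}"

definition S3 :: "'a list \<Rightarrow> ('a list \<times> 'a list \<times> 'a list) set" where
  "S3 \<alpha>s = {(a1, a2, a3). a1 @ a2 @ a3 = \<alpha>s}"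

definition S4 :: "'a list \<Rightarrow> ('a list \<times> 'a list \<times> 'a list \<times> 'a list) set" where
  "S4 \<alpha>s = {(a1, a2, a3, a4). a1 @ a2 @ a3 @ a4 = \<alpha>s}"

definition S5 :: "'a list \<Rightarrow> ('a list \<times> 'a list \<times> 'a list \<times> 'a list \<times> 'a list) set" where
  "S5 \<alpha>s = {(a1, a2, a3, a4, a5). a1 @ a2 @ a3 @ a4 @ a5 = \<alpha>s}"

text \<open>A category \<open>C\<close> with curvature \<open>\<mm>\<^sub>0 = w \<cdot> \<one>\<close>.\<close>

locale weakly_curved_ainf_cat =
  fixes C :: "('o, 'm::ab_group_add) ainf_cat" and w :: complex
  assumes scl_vector_space: "vector_space (scl C)"
    and hom_subspace:
      "\<lbrakk>X \<in> obj C; Y \<in> obj C; p < 2\<rbrakk> \<Longrightarrow> module.subspace (scl C) (mor_space C X Y p)"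
    and mu_closed:
      "is_path C X \<alpha>s Y \<Longrightarrow> mu C X \<alpha>s \<in> mor_space C X Y (eps \<alpha>s mod 2)"
    and mu_add:
      "\<lbrakk>is_path C X (\<beta> @ [Mor S T p x] @ \<gamma>) Y; is_path C X (\<beta> @ [Mor S T p y] @ \<gamma>) Y\<rbrakk> \<Longrightarrow>
       mu C X (\<beta> @ [Mor S T p (x + y)] @ \<gamma>) =
         mu C X (\<beta> @ [Mor S T p x] @ \<gamma>) + mu C X (\<beta> @ [Mor S T p y] @ \<gamma>)"
    and mu_scale:
      "is_path C X (\<beta> @ [Mor S T p x] @ \<gamma>) Y \<Longrightarrow>
       mu C X (\<beta> @ [Mor S T p (scl C a x)] @ \<gamma>) = scl C a (mu C X (\<beta> @ [Mor S T p x] @ \<gamma>))"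
    and ainf_relation:
      "is_path C X \<alpha>s Y \<Longrightarrow>
       (\<Sum>(a1, a2, a3) \<in> S3 \<alpha>s. scl C ((-1) ^ eps a1)
          (mu C X (a1 @ [app_mu C (endpt X a1) a2] @ a3))) = 0"
    and unit_hom: "X \<in> obj C \<Longrightarrow> unt C X \<in> mor_space C X X 0"
    and mu1_unit: "X \<in> obj C \<Longrightarrow> mu C X [unit_mor C X] = 0"
    and mu2_unit_left: "is_mor C \<alpha> \<Longrightarrow> mu C (src \<alpha>) [unit_mor C (src \<alpha>), \<alpha>] = vec \<alpha>"
    and mu2_unit_right:
      "is_mor C \<alpha> \<Longrightarrow> mu C (src \<alpha>) [\<alpha>, unit_mor C (tgt \<alpha>)] = scl C ((-1) ^ par \<alpha>) (vec \<alpha>)"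
    and mu_unit_higher:
      "\<lbrakk>is_path C X (\<beta> @ [unit_mor C Z] @ \<gamma>) Y; length (\<beta> @ [unit_mor C Z] @ \<gamma>) \<ge> 3\<rbrakk> \<Longrightarrow>
       mu C X (\<beta> @ [unit_mor C Z] @ \<gamma>) = 0"
    and curvature: "X \<in> obj C \<Longrightarrow> mu C X [] = scl C w (unt C X)"


section \<open>Hochschild and negative cyclic homology\<close>

text \<open>\<open>(\<alpha>\<^sub>0, [\<alpha>\<^sub>1, \<dots>, \<alpha>\<^sub>k])\<close> stands for \<open>\<alpha>\<^sub>0[\<alpha>\<^sub>1|\<dots>|\<alpha>\<^sub>k]\<close>; the sequence is cyclically composable.
  Reduced Hochschild chains are the free vector space on these words modulo the subspace
  \<open>chain_relations\<close>, generated by multilinearity (which makes a sum of tensor products of the free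
  space) and by the words with a unit in a position other than the first.\<close>

type_synonym ('o, 'm) word = "('o, 'm) mor \<times> ('o, 'm) mor list"
type_synonym ('o, 'm) chain = "('o, 'm) word \<Rightarrow>\<^sub>0 complex"

definition cscale :: "complex \<Rightarrow> ('w \<Rightarrow>\<^sub>0 complex) \<Rightarrow> ('w \<Rightarrow>\<^sub>0 complex)" where
  "cscale c x = Poly_Mapping.map ((*) c) x"

definition extend :: "('w \<Rightarrow> ('v \<Rightarrow>\<^sub>0 complex)) \<Rightarrow> ('w \<Rightarrow>\<^sub>0 complex) \<Rightarrow> ('v \<Rightarrow>\<^sub>0 complex)" where
  "extend f x = (\<Sum>z\<in>Poly_Mapping.keys x. cscale (Poly_Mapping.lookup x z) (f z))"

definition words :: "('o, 'm) ainf_cat \<Rightarrow> ('o, 'm) word set" where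
  "words C = {(a0, as). is_mor C a0 \<and> is_path C (tgt a0) as (src a0)}"

definition word_parity :: "('o, 'm) word \<Rightarrow> nat" where
  "word_parity = (\<lambda>(a0, as). (par a0 + eps as) mod 2)"

definition chains :: "('o, 'm) ainf_cat \<Rightarrow> ('o, 'm) chain set" where
  "chains C = {x. Poly_Mapping.keys x \<subseteq> words C}"

definition word_slots :: "(('o, 'm) mor \<Rightarrow> ('o, 'm) word) set" where
  "word_slots = {f. (\<exists>as. f = (\<lambda>a. (a, as))) \<or> (\<exists>a0 \<beta> \<gamma>. f = (\<lambda>a. (a0, \<beta> @ [a] @ \<gamma>)))}"

definition tensor_relations :: "('o, 'm::ab_group_add) ainf_cat \<Rightarrow> ('o, 'm) chain set" where
  "tensor_relations C =
     {Poly_Mapping.single (f (Mor S T p (x + y))) 1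
        - Poly_Mapping.single (f (Mor S T p x)) 1 - Poly_Mapping.single (f (Mor S T p y)) 1
      | f S T p x y. f \<in> word_slots \<and> f (Mor S T p x) \<in> words C \<and> f (Mor S T p y) \<in> words C} \<union>
     {Poly_Mapping.single (f (Mor S T p (scl C a x))) 1 - Poly_Mapping.single (f (Mor S T p x)) a
      | f S T p x a. f \<in> word_slots \<and> f (Mor S T p x) \<in> words C}"

definition unit_relations :: "('o, 'm) ainf_cat \<Rightarrow> ('o, 'm) chain set" where
  "unit_relations C =
     {Poly_Mapping.single (a0, \<beta> @ [unit_mor C Z] @ \<gamma>) 1
      | a0 \<beta> Z \<gamma>. (a0, \<beta> @ [unit_mor C Z] @ \<gamma>) \<in> words C}"

definition chain_relations :: "('o, 'm::ab_group_add) ainf_cat \<Rightarrow> ('o, 'm) chain set" where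
  "chain_relations C = module.span cscale (tensor_relations C \<union> unit_relations C)"

definition hoch_b :: "('o, 'm) ainf_cat \<Rightarrow> ('o, 'm) chain \<Rightarrow> ('o, 'm) chain" where
  "hoch_b C = extend (\<lambda>(a0, as).
     (\<Sum>(a1, a2, a3) \<in> S3 as.
        Poly_Mapping.single
          (app_mu C (endpt (tgt a0) (a1 @ a2)) (a3 @ [a0] @ a1), a2)
          ((-1) ^ (eps a3 * (eps a2 + eps a1 + sd a0)))) +
     (\<Sum>(a1, a2, a3) \<in> S3 as.
        Poly_Mapping.single
          (a0, a1 @ [app_mu C (endpt (tgt a0) a1) a2] @ a3)
          ((-1) ^ (eps a1 + sd a0))))"

definition connes_B :: "('o, 'm) ainf_cat \<Rightarrow> ('o, 'm) chain \<Rightarrow> ('o, 'm) chain" where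
  "connes_B C = extend (\<lambda>(a0, as).
     (\<Sum>(a1, a2) \<in> S2 as.
        Poly_Mapping.single
          (unit_mor C (endpt (tgt a0) a1), a2 @ [a0] @ a1)
          ((-1) ^ (eps a2 * (sd a0 + eps a1)))))"

text \<open>In \<open>b11\<close> and \<open>B11\<close> the number \<open>d\<close> is the shifted degree \<open>|\<phi>|'\<close>.\<close>

definition b11 ::
  "('o, 'm) ainf_cat \<Rightarrow> nat \<Rightarrow> ('o \<Rightarrow> ('o, 'm) mor list \<Rightarrow> 'm) \<Rightarrow> ('o, 'm) chain \<Rightarrow> ('o, 'm) chain" where
  "b11 C d \<phi> = extend (\<lambda>(a0, as).
     (\<Sum>(a1, a2, a3, a4, a5) \<in> S5 as.
        Poly_Mapping.single
          (app_mu C (endpt (tgt a0) (a1 @ a2))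
             (a3 @ [app_cochain d \<phi> (endpt (tgt a0) (a1 @ a2 @ a3)) a4] @ a5 @ [a0] @ a1), a2)
          ((-1) ^ ((eps a3 + eps a4 + eps a5) * (sd a0 + eps a1 + eps a2) + d * eps a3))))"

definition B11 ::
  "('o, 'm) ainf_cat \<Rightarrow> nat \<Rightarrow> ('o \<Rightarrow> ('o, 'm) mor list \<Rightarrow> 'm) \<Rightarrow> ('o, 'm) chain \<Rightarrow> ('o, 'm) chain" where
  "B11 C d \<phi> = extend (\<lambda>(a0, as).
     (\<Sum>(a1, a2, a3, a4) \<in> S4 as.
        Poly_Mapping.single
          (unit_mor C (endpt (tgt a0) a1),
           a2 @ [app_cochain d \<phi> (endpt (tgt a0) (a1 @ a2)) a3] @ a4 @ [a0] @ a1)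
          ((-1) ^ (d * eps a2 + (eps a1 + sd a0) * (eps a2 + eps a3 + eps a4)))))"

definition Gamma_op :: "('o, 'm) chain \<Rightarrow> ('o, 'm) chain" where
  "Gamma_op = extend (\<lambda>(a0, as). Poly_Mapping.single (a0, as) (- of_nat (length as)))"

definition mu' :: "('o, 'm) ainf_cat \<Rightarrow> 'o \<Rightarrow> ('o, 'm) mor list \<Rightarrow> 'm" where
  "mu' C X \<alpha>s = scl C (2 - of_nat (length \<alpha>s)) (mu C X \<alpha>s)"

definition cyc_d :: "('o, 'm) ainf_cat \<Rightarrow> ('o, 'm) chain fps \<Rightarrow> ('o, 'm) chain fps" where
  "cyc_d C x = fps_map (hoch_b C) x + u_times (fps_map (connes_B C) x)"

definition u2nabla_chain :: "('o, 'm) ainf_cat \<Rightarrow> ('o, 'm) chain fps \<Rightarrow> ('o, 'm) chain fps" where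
  "u2nabla_chain C x =
     u_times (u_times (d_du cscale x)) +
     fps_map (cscale (1 / 2))
       (u_times (fps_map Gamma_op x) +
        (fps_map (b11 C 1 (mu' C)) x + u_times (fps_map (B11 C 1 (mu' C)) x)))"

definition chains_u :: "('o, 'm) ainf_cat \<Rightarrow> ('o, 'm) chain fps set" where
  "chains_u C = {x. \<forall>n. fps_nth x n \<in> chains C}"

definition relations_u :: "('o, 'm::ab_group_add) ainf_cat \<Rightarrow> ('o, 'm) chain fps set" where
  "relations_u C = {x. \<forall>n. fps_nth x n \<in> chain_relations C}"

text \<open>Cycles and boundaries are those of the reduced complex, pulled back to the free module on
  words; the quotient of the two is unaffected.\<close>

definition cyc_cycles :: "('o, 'm::ab_group_add) ainf_cat \<Rightarrow> ('o, 'm) chain fps set" where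
  "cyc_cycles C = {x \<in> chains_u C. cyc_d C x \<in> relations_u C}"

definition cyc_boundaries :: "('o, 'm::ab_group_add) ainf_cat \<Rightarrow> ('o, 'm) chain fps set" where
  "cyc_boundaries C = {cyc_d C y + r | y r. y \<in> chains_u C \<and> r \<in> relations_u C}"

definition cyc_class ::
  "('o, 'm::ab_group_add) ainf_cat \<Rightarrow> ('o, 'm) chain fps \<Rightarrow> ('o, 'm) chain fps set" where
  "cyc_class C x = {x + y | y. y \<in> cyc_boundaries C}"

text \<open>Negative cyclic homology, with elements the cosets of the boundaries. That \<open>u\<^sup>2\<nabla>\<close> maps classes
  of cycles to classes of cycles comes from the identity \<open>[u\<^sup>2\<nabla>, b + uB] = u(b + uB)/2\<close> on
  chains.\<close>

definition HC_minus :: "('o, 'm::ab_group_add) ainf_cat \<Rightarrow> ('o, 'm) chain fps set e_module" where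
  "HC_minus C =
     \<lparr>carrier = cyc_class C ` cyc_cycles C,
      monoid.mult = undefined,
      one = undefined,
      zero = cyc_boundaries C,
      add = (\<lambda>P Q. {x + y | x y. x \<in> P \<and> y \<in> Q}),
      smult = (\<lambda>f P. {fps_smult cscale f x + y | x y. x \<in> P \<and> y \<in> cyc_boundaries C}),
      even_part = cyc_class C `
        {x \<in> cyc_cycles C. \<forall>n. \<forall>z \<in> Poly_Mapping.keys (fps_nth x n). word_parity z = 0},
      odd_part = cyc_class C `
        {x \<in> cyc_cycles C. \<forall>n. \<forall>z \<in> Poly_Mapping.keys (fps_nth x n). word_parity z = 1},
      u2nabla = (\<lambda>P. {u2nabla_chain C x + y | x y. x \<in> P \<and> y \<in> cyc_boundaries C})\<rparr>"

definition HH_cycles :: "('o, 'm::ab_group_add) ainf_cat \<Rightarrow> ('o, 'm) chain set" where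
  "HH_cycles C = {x \<in> chains C. hoch_b C x \<in> chain_relations C}"

definition HH_boundaries :: "('o, 'm::ab_group_add) ainf_cat \<Rightarrow> ('o, 'm) chain set" where
  "HH_boundaries C = {hoch_b C y + r | y r. y \<in> chains C \<and> r \<in> chain_relations C}"

definition HH_finite_dimensional :: "('o, 'm::ab_group_add) ainf_cat \<Rightarrow> bool" where
  "HH_finite_dimensional C \<longleftrightarrow>
     (\<exists>S. finite S \<and> S \<subseteq> HH_cycles C \<and> HH_cycles C \<subseteq> module.span cscale (S \<union> HH_boundaries C))"

text \<open>The noncommutative Hodge--de Rham spectral sequence is that of the \<open>u\<close>-adic filtration \<open>F\<^sup>p\<close>.
  With \<open>Z\<^sub>r\<^sup>p = {x \<in> F\<^sup>p. dx \<in> F\<^sup>p\<^sup>+\<^sup>r}\<close> the pages are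
  \<open>E\<^sub>r\<^sup>p = Z\<^sub>r\<^sup>p / (Z\<^sub>r\<^sub>-\<^sub>1\<^sup>p\<^sup>+\<^sup>1 + d Z\<^sub>r\<^sub>-\<^sub>1\<^sup>p\<^sup>-\<^sup>r\<^sup>+\<^sup>1)\<close>, the first being \<open>HH \<cdot> u\<^sup>p\<close>, and \<open>d\<^sub>r : E\<^sub>r\<^sup>p \<rightarrow> E\<^sub>r\<^sup>p\<^sup>+\<^sup>r\<close> is
  induced by \<open>d = b + uB\<close>. Degeneration means \<open>d\<^sub>r = 0\<close> for all \<open>r \<ge> 1\<close>.\<close>

definition u_filtration :: "('o, 'm::ab_group_add) ainf_cat \<Rightarrow> nat \<Rightarrow> ('o, 'm) chain fps set" where
  "u_filtration C p = {x \<in> chains_u C. \<forall>n<p. fps_nth x n \<in> chain_relations C}"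

definition page_Z :: "('o, 'm::ab_group_add) ainf_cat \<Rightarrow> nat \<Rightarrow> nat \<Rightarrow> ('o, 'm) chain fps set" where
  "page_Z C r p = {x \<in> u_filtration C p. cyc_d C x \<in> u_filtration C (p + r)}"

definition Hodge_de_Rham_degenerates :: "('o, 'm::ab_group_add) ainf_cat \<Rightarrow> bool" where
  "Hodge_de_Rham_degenerates C \<longleftrightarrow>
     (\<forall>r\<ge>1. \<forall>p. cyc_d C ` page_Z C r p \<subseteq>
        {x + cyc_d C y | x y. x \<in> page_Z C (r - 1) (p + r + 1) \<and> y \<in> page_Z C (r - 1) (p + 1)})"


section \<open>Monotone symplectic manifolds\<close>

text \<open>A closed monotone symplectic manifold of real dimension \<open>2 * half_dim\<close> enters through its
  cohomology ring (the whole type \<open>'h\<close>), the classes \<open>[\<omega>]\<close> and \<open>c\<^sub>1\<close>, the genus 0 three-point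
  Gromov--Witten invariants indexed by \<open>'g\<close>, its second integral homology, and its monotone
  Lagrangians together with their disk potentials and Floer A-infinity operations. The manifold
  itself, and the construction of these invariants from moduli spaces, are not modelled.\<close>

record ('h, 'g, 'o, 'm) symp_data =
  half_dim :: nat
  scH :: "complex \<Rightarrow> 'h \<Rightarrow> 'h"
  coh :: "nat \<Rightarrow> 'h set"
  cup :: "'h \<Rightarrow> 'h \<Rightarrow> 'h"
  coh_unit :: 'h
  top_integral :: "'h \<Rightarrow> complex"
  omega :: 'h
  c1 :: 'h
  tau :: real
  area :: "'g \<Rightarrow> real"
  chern_number :: "'g \<Rightarrow> int"
  gw :: "'g \<Rightarrow> 'h \<Rightarrow> 'h \<Rightarrow> 'h \<Rightarrow> complex"
  qprod :: "'h \<Rightarrow> 'h \<Rightarrow> 'h"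
  lagrangians :: "'o set"
  disk_potential :: "'o \<Rightarrow> complex"
  floer_hom :: "'o \<Rightarrow> 'o \<Rightarrow> nat \<Rightarrow> 'm set"
  floer_scl :: "complex \<Rightarrow> 'm \<Rightarrow> 'm"
  floer_mu :: "'o \<Rightarrow> ('o, 'm) mor list \<Rightarrow> 'm"
  floer_unt :: "'o \<Rightarrow> 'm"

definition Fuk :: "('h, 'g, 'o, 'm) symp_data \<Rightarrow> complex \<Rightarrow> ('o, 'm) ainf_cat" where
  "Fuk X w =
     \<lparr>obj = {L \<in> lagrangians X. disk_potential X L = w},
      mor_space = floer_hom X, scl = floer_scl X, mu = floer_mu X, unt = floer_unt X\<rparr>"

locale monotone_symplectic =
  fixes X :: "('h::ab_group_add, 'g::ab_group_add, 'o, 'm::ab_group_add) symp_data"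
  assumes H_vector_space: "vector_space (scH X)"
    and H_finite_dim: "\<exists>S. finite S \<and> module.span (scH X) S = UNIV"
    and coh_subspace: "module.subspace (scH X) (coh X p)"
    and coh_top: "p > 2 * half_dim X \<Longrightarrow> coh X p = {0}"
    and coh_direct_sum: "internal_direct_sum {..2 * half_dim X} (coh X)"
    and cup_add_left: "cup X (x + y) z = cup X x z + cup X y z"
    and cup_add_right: "cup X x (y + z) = cup X x y + cup X x z"
    and cup_scale_left: "cup X (scH X a x) y = scH X a (cup X x y)"
    and cup_scale_right: "cup X x (scH X a y) = scH X a (cup X x y)"
    and cup_assoc: "cup X (cup X x y) z = cup X x (cup X y z)"
    and cup_degree: "\<lbrakk>x \<in> coh X p; y \<in> coh X q\<rbrakk> \<Longrightarrow> cup X x y \<in> coh X (p + q)"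
    and cup_commute:
      "\<lbrakk>x \<in> coh X p; y \<in> coh X q\<rbrakk> \<Longrightarrow> cup X y x = scH X ((-1) ^ (p * q)) (cup X x y)"
    and unit_degree: "coh_unit X \<in> coh X 0"
    and cup_unit: "cup X (coh_unit X) x = x"
    and integral_add: "top_integral X (x + y) = top_integral X x + top_integral X y"
    and integral_scale: "top_integral X (scH X a x) = a * top_integral X x"
    and integral_degree: "\<lbrakk>x \<in> coh X p; p \<noteq> 2 * half_dim X\<rbrakk> \<Longrightarrow> top_integral X x = 0"
    and Poincare_duality: "(\<And>y. top_integral X (cup X x y) = 0) \<Longrightarrow> x = 0"
    and omega_degree: "omega X \<in> coh X 2"
    and omega_volume:
      "\<exists>r>0. top_integral X ((cup X (omega X) ^^ half_dim X) (coh_unit X)) = complex_of_real r"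
    and tau_pos: "tau X > 0"
    and monotone: "c1 X = scH X (complex_of_real (tau X)) (omega X)"
    and area_add: "area X (\<beta> + \<gamma>) = area X \<beta> + area X \<gamma>"
    and chern_number_add: "chern_number X (\<beta> + \<gamma>) = chern_number X \<beta> + chern_number X \<gamma>"
    and monotone_number: "real_of_int (chern_number X \<beta>) = tau X * area X \<beta>"
    and gw_add1: "gw X \<beta> (x + x') y z = gw X \<beta> x y z + gw X \<beta> x' y z"
    and gw_scale1: "gw X \<beta> (scH X a x) y z = a * gw X \<beta> x y z"
    and gw_symmetric12:
      "\<lbrakk>x \<in> coh X p; y \<in> coh X q\<rbrakk> \<Longrightarrow> gw X \<beta> y x z = (-1) ^ (p * q) * gw X \<beta> x y z"
    and gw_add2: "gw X \<beta> x (y + y') z = gw X \<beta> x y z + gw X \<beta> x y' z"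
    and gw_scale2: "gw X \<beta> x (scH X a y) z = a * gw X \<beta> x y z"
    and gw_symmetric23:
      "\<lbrakk>y \<in> coh X p; z \<in> coh X q\<rbrakk> \<Longrightarrow> gw X \<beta> x z y = (-1) ^ (p * q) * gw X \<beta> x y z"
    and gw_add3: "gw X \<beta> x y (z + z') = gw X \<beta> x y z + gw X \<beta> x y z'"
    and gw_scale3: "gw X \<beta> x y (scH X a z) = a * gw X \<beta> x y z"
    and gw_degree:
      "\<lbrakk>x \<in> coh X p; y \<in> coh X q; z \<in> coh X r;
        int p + int q + int r \<noteq> 2 * int (half_dim X) + 2 * chern_number X \<beta>\<rbrakk> \<Longrightarrow>
       gw X \<beta> x y z = 0"
    and gw_zero_class: "gw X 0 x y z = top_integral X (cup X (cup X x y) z)"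
    and gw_effective: "gw X \<beta> x y z \<noteq> 0 \<Longrightarrow> \<beta> = 0 \<or> area X \<beta> > 0"
    and gw_finite: "finite {\<beta>. \<exists>x y z. gw X \<beta> x y z \<noteq> 0}"
    and gw_fundamental_class: "\<beta> \<noteq> 0 \<Longrightarrow> gw X \<beta> (coh_unit X) y z = 0"
    and qprod_gw:
      \<comment> \<open>by Poincare duality this determines the quantum product; the Novikov parameter is 1\<close>
      "top_integral X (cup X (qprod X x y) z) =
         (\<Sum>\<beta> \<in> {\<beta>. \<exists>x y z. gw X \<beta> x y z \<noteq> 0}. gw X \<beta> x y z)"
    and qprod_assoc: "qprod X (qprod X x y) z = qprod X x (qprod X y z)"
    and Fuk_ainf: "weakly_curved_ainf_cat (Fuk X w) w"

definition degree_component ::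
  "('h::ab_group_add, 'g, 'o, 'm) symp_data \<Rightarrow> nat \<Rightarrow> 'h \<Rightarrow> 'h" where
  "degree_component X p x =
     (THE c. (\<forall>i\<in>{..2 * half_dim X}. c i \<in> coh X i) \<and>
             (\<forall>i. i \<notin> {..2 * half_dim X} \<longrightarrow> c i = 0) \<and>
             x = (\<Sum>i\<in>{..2 * half_dim X}. c i)) p"

definition grading_op :: "('h::ab_group_add, 'g, 'o, 'm) symp_data \<Rightarrow> 'h \<Rightarrow> 'h" where
  "grading_op X x =
     (\<Sum>p\<le>2 * half_dim X.
        scH X ((of_nat p - of_nat (half_dim X)) / 2) (degree_component X p x))"

text \<open>\<open>QH(X)[[u]]\<close> with \<open>\<nabla> = d/du + \<mu>/u + c\<^sub>1\<star>/u\<^sup>2\<close>.\<close>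

definition QH_u :: "('h::ab_group_add, 'g, 'o, 'm) symp_data \<Rightarrow> 'h fps e_module" where
  "QH_u X =
     \<lparr>carrier = UNIV,
      monoid.mult = undefined,
      one = undefined,
      zero = 0,
      add = (+),
      smult = fps_smult (scH X),
      even_part = {x. \<forall>n p. odd p \<longrightarrow> degree_component X p (fps_nth x n) = 0},
      odd_part = {x. \<forall>n p. even p \<longrightarrow> degree_component X p (fps_nth x n) = 0},
      u2nabla = (\<lambda>x. u_times (u_times (d_du (scH X) x)) + u_times (fps_map (grading_op X) x) +
                      fps_map (qprod X (c1 X)) x)\<rparr>"

definition c1_eigenvalues :: "('h::ab_group_add, 'g, 'o, 'm) symp_data \<Rightarrow> complex set" where
  "c1_eigenvalues X = {w. \<exists>x. x \<noteq> 0 \<and> qprod X (c1 X) x = scH X w x}"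

definition QH_eigenspace :: "('h::ab_group_add, 'g, 'o, 'm) symp_data \<Rightarrow> complex \<Rightarrow> 'h set" where
  "QH_eigenspace X w = {x. \<exists>k. ((\<lambda>y. qprod X (c1 X) y - scH X w y) ^^ k) x = 0}"

text \<open>\<open>V w\<close> is \<open>QH(X)[[u]]\<^sub>w\<close>. By Hukuhara--Levelt--Turrittin exactly one family \<open>V\<close> satisfies
  this.\<close>

definition HLT_decomposition ::
  "('h::ab_group_add, 'g, 'o, 'm) symp_data \<Rightarrow> (complex \<Rightarrow> 'h fps set) \<Rightarrow> bool" where
  "HLT_decomposition X V \<longleftrightarrow>
     (\<forall>w. submodule (V w) CU (QH_u X)) \<and>
     (\<forall>w. u2nabla (QH_u X) ` V w \<subseteq> V w) \<and>
     (\<forall>w \<in> c1_eigenvalues X. (\<lambda>x. fps_nth x 0) ` V w = QH_eigenspace X w) \<and>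
     (\<forall>w. w \<notin> c1_eigenvalues X \<longrightarrow> V w = {0}) \<and>
     internal_direct_sum (c1_eigenvalues X) V"

end

theory Submission
  imports Defs
begin

text \<open>
  On \<open>HC\<^sup>-/u\<close> the endomorphism \<open>u\<^sup>2\<nabla>\<close> is \<open>i{\<mm>'}/2\<close>, that is, \<open>b\<^sup>1\<^sup>,\<^sup>1(\<mm>', \<cdot>)/2\<close>. The curvature
  \<open>\<mm>\<^sub>0 = w \<cdot> \<one>\<close> contributes \<open>w \<cdot> id\<close> to it on reduced chains, and every other term strictly
  shortens a word, so \<open>u\<^sup>2\<nabla> - w\<close> is locally nilpotent on \<open>HC\<^sup>-/u\<close>: for every class \<open>x\<close> some
  \<open>(u\<^sup>2\<nabla> - w)\<^sup>N x\<close> lies in \<open>u HC\<^sup>-\<close>. On the other side, let \<open>v \<noteq> w\<close> and project \<open>OC x\<close> to the summand of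
  \<open>v\<close>. If all these projections are divisible by \<open>u\<^sup>n\<close>, the coefficient of \<open>u\<^sup>n\<close> is a generalised
  \<open>v\<close>-eigenvector of \<open>c\<^sub>1\<star>\<close>, and applying \<open>(u\<^sup>2\<nabla> - w)\<^sup>N\<close> shows that it is killed by
  \<open>(c\<^sub>1\<star> - w)\<^sup>N\<close>; hence it is zero, and by induction on \<open>n\<close> the projections vanish.

  That an element of \<open>HC\<^sup>-\<close> whose leading coefficient is a Hochschild boundary is divisible by \<open>u\<close> in
  \<open>HC\<^sup>-\<close> uses \<open>(b + uB)\<^sup>2 = 0\<close> on reduced chains. Since a chain lies in the span of the
  relations if and only if every linear functional killing the relations kills it, this is an identity
  between complex numbers, for functions on words that are multilinear and vanish on units.
\<close>

(* The selectors that the records generate would otherwise shadow Defs.extend. *)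
hide_const (open) symp_data.extend ainf_cat.extend e_module.extend
hide_fact (open) symp_data.extend_def ainf_cat.extend_def e_module.extend_def

section \<open>Power series and linear extension\<close>

lemma fps_nth_fps_map [simp]: "fps_nth (fps_map g x) n = g (fps_nth x n)"
  by (simp add: fps_map_def)

lemma fps_nth_u_times: "fps_nth (u_times x) n = (if n = 0 then 0 else fps_nth x (n - 1))"
  by (simp add: u_times_def)

lemma fps_nth_u_times_0 [simp]: "fps_nth (u_times x) 0 = 0"
  and fps_nth_u_times_Suc [simp]: "fps_nth (u_times x) (Suc n) = fps_nth x n"
  by (simp_all add: fps_nth_u_times)

lemma fps_nth_d_du [simp]: "fps_nth (d_du sc x) n = sc (of_nat (Suc n)) (fps_nth x (Suc n))"
  by (simp add: d_du_def)

lemma u_times_add: "u_times (x + y) = u_times x + u_times (y :: 'a::monoid_add fps)"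
  by (rule fps_ext) (simp add: fps_nth_u_times)

lemma lookup_cscale [simp]: "Poly_Mapping.lookup (cscale c x) z = c * Poly_Mapping.lookup x z"
  by (simp add: cscale_def Poly_Mapping.map.rep_eq when_def)

interpretation cs: vector_space cscale
  by unfold_locales (auto intro!: poly_mapping_eqI simp: lookup_add algebra_simps)

lemma cscale_single [simp]: "cscale c (Poly_Mapping.single z a) = Poly_Mapping.single z (c * a)"
  by (rule poly_mapping_eqI) (simp add: lookup_single when_def)

lemma extend_superset:
  assumes "finite A" "Poly_Mapping.keys x \<subseteq> A"
  shows "extend f x = (\<Sum>z\<in>A. cscale (Poly_Mapping.lookup x z) (f z))"
  unfolding extend_def by (rule sum.mono_neutral_left) (use assms in \<open>auto simp: in_keys_iff\<close>)

lemma extend_add: "extend f (x + y) = extend f x + extend f y"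
proof -
  let ?A = "Poly_Mapping.keys x \<union> Poly_Mapping.keys y"
  have k: "Poly_Mapping.keys (x + y) \<subseteq> ?A" by (rule Poly_Mapping.keys_add)
  show ?thesis
    by (simp add: extend_superset[of ?A] k lookup_add cs.scale_left_distrib sum.distrib)
qed

lemma extend_cscale: "extend f (cscale c x) = cscale c (extend f x)"
proof -
  have "Poly_Mapping.keys (cscale c x) \<subseteq> Poly_Mapping.keys x"
    by (auto simp: in_keys_iff)
  then show ?thesis
    by (simp add: extend_superset[of "Poly_Mapping.keys x"] cs.scale_sum_right)
qed

lemma extend_single [simp]: "extend f (Poly_Mapping.single z c) = cscale c (f z)"
  by (simp add: extend_superset[of "{z}"] lookup_single)

lemma poly_mapping_sum_single:
  "x = (\<Sum>z\<in>Poly_Mapping.keys x. cscale (Poly_Mapping.lookup x z) (Poly_Mapping.single z (1::complex)))"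
  by (rule poly_mapping_eqI) (simp add: lookup_sum lookup_single when_def in_keys_iff)

section \<open>Linear functionals on free chains\<close>

definition functional :: "(('w \<Rightarrow>\<^sub>0 complex) \<Rightarrow> complex) \<Rightarrow> bool" where
  "functional F \<longleftrightarrow> (\<forall>x y. F (x + y) = F x + F y) \<and> (\<forall>c x. F (cscale c x) = c * F x)"

lemma functionalD:
  assumes "functional F"
  shows functional_add: "F (x + y) = F x + F y"
    and functional_cscale: "F (cscale c x) = c * F x"
    and functional_0: "F 0 = 0"
    and functional_diff: "F (x - y) = F x - F y"
    and functional_sum: "F (sum g A) = (\<Sum>i\<in>A. F (g i))"
    and functional_single: "F (Poly_Mapping.single z c) = c * F (Poly_Mapping.single z 1)"
proof -
  show a: "\<And>x y. F (x + y) = F x + F y" and s: "\<And>c x. F (cscale c x) = c * F x"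
    using assms by (auto simp: functional_def)
  show z: "F 0 = 0" using s[of 0 0] by simp
  show "F (x - y) = F x - F y" using a[of "x - y" y] by simp
  show "F (sum g A) = (\<Sum>i\<in>A. F (g i))"
    using sum_comp_morphism[of F g A] a z by (simp add: o_def)
  show "F (Poly_Mapping.single z c) = c * F (Poly_Mapping.single z 1)"
    using s[of c "Poly_Mapping.single z 1"] by simp
qed

lemma functional_comp_extend: "functional F \<Longrightarrow> functional (\<lambda>x. F (extend f x))"
  by (simp add: functional_def extend_add extend_cscale)

lemma functional_span_0:
  assumes F: "functional F" and R: "\<And>r. r \<in> R \<Longrightarrow> F r = 0" and x: "x \<in> cs.span R"
  shows "F x = 0"
  using x
proof (induction rule: cs.span_induct)
  case base
  show ?case unfolding cs.subspace_def
    by (auto simp: functional_add[OF F] functional_cscale[OF F] functional_0[OF F])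
qed (use R in auto)

text \<open>If \<open>x\<close> were outside the span, a maximal independent subset of
  \<open>R\<close> would stay independent together with \<open>x\<close>, and a functional equal to
  1 at \<open>x\<close> and to 0 on that subset would contradict the hypothesis. Membership in the
  relations thereby becomes an identity of complex numbers.\<close>

lemma in_span_if_functionals_vanish:
  assumes "\<And>F. functional F \<Longrightarrow> (\<And>r. r \<in> R \<Longrightarrow> F r = 0) \<Longrightarrow> F x = 0"
  shows "x \<in> cs.span R"
proof (rule ccontr)
  assume nx: "x \<notin> cs.span R"
  interpret p: vector_space_pair cscale "(*) :: complex \<Rightarrow> complex \<Rightarrow> complex"
    by unfold_locales (auto simp: algebra_simps)
  obtain B where B: "B \<subseteq> R" "cs.independent B" "R \<subseteq> cs.span B"
    using cs.maximal_independent_subset by blast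
  have "x \<notin> cs.span B" using nx B(1) cs.span_mono by blast
  then have "cs.independent (insert x B)" using B(2) \<open>x \<notin> cs.span B\<close>
    by (simp add: cs.independent_insert)
  from p.linear_independent_extend[OF this, of "\<lambda>b. if b = x then 1 else 0"]
  obtain g where g: "Vector_Spaces.linear cscale (*) g"
    "\<forall>b\<in>insert x B. g b = (if b = x then 1 else 0)" by blast
  have F: "functional g"
    using g(1) by (simp add: functional_def Vector_Spaces.linear_def module_hom_def module_hom_axioms_def)
  have "x \<notin> B" using \<open>x \<notin> cs.span B\<close> cs.span_base by blast
  then have "\<And>r. r \<in> B \<Longrightarrow> g r = 0" using g(2) by auto
  then have "\<And>r. r \<in> R \<Longrightarrow> g r = 0"
    using functional_span_0[OF F] B(3) by blast
  from assms[OF F this] g(2) show False by auto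
qed

section \<open>Sums over decompositions\<close>

definition sum2 :: "('a list \<Rightarrow> 'a list \<Rightarrow> 'b::comm_monoid_add) \<Rightarrow> 'a list \<Rightarrow> 'b" where
  "sum2 f xs = (\<Sum>(p, q)\<in>S2 xs. f p q)"

text \<open>Cuts are iterated instead of summing over triples at once, so that everything reduces to
  list induction on \<open>sum2\<close>. \<open>sum_S3\<close> links back to the set in the
  definition of b; \<open>sum4\<close> and \<open>sum5\<close> serve as normal forms for composites
  of two operators.\<close>

definition sum3 :: "('a list \<Rightarrow> 'a list \<Rightarrow> 'a list \<Rightarrow> 'b::comm_monoid_add) \<Rightarrow> 'a list \<Rightarrow> 'b" where
  "sum3 f xs = sum2 (\<lambda>a r. sum2 (f a) r) xs"

definition sum4 ::
  "('a list \<Rightarrow> 'a list \<Rightarrow> 'a list \<Rightarrow> 'a list \<Rightarrow> 'b::comm_monoid_add) \<Rightarrow> 'a list \<Rightarrow> 'b" where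
  "sum4 f xs = sum2 (\<lambda>a r. sum3 (f a) r) xs"

definition sum5 ::
  "('a list \<Rightarrow> 'a list \<Rightarrow> 'a list \<Rightarrow> 'a list \<Rightarrow> 'a list \<Rightarrow> 'b::comm_monoid_add) \<Rightarrow> 'a list \<Rightarrow> 'b" where
  "sum5 f xs = sum3 (\<lambda>a b r. sum3 (f a b) r) xs"

lemma S2_Nil: "S2 [] = {([], [])}"
  and S2_Cons: "S2 (a # xs) = insert ([], a # xs) ((\<lambda>(p, q). (a # p, q)) ` S2 xs)"
  by (auto simp: S2_def Cons_eq_append_conv append_eq_Cons_conv image_iff)

lemma finite_S2 [simp]: "finite (S2 xs)"
  by (induction xs) (simp_all add: S2_Nil S2_Cons)

lemma S3_Sigma: "S3 xs = (\<lambda>((a, r), b, c). (a, b, c)) ` Sigma (S2 xs) (\<lambda>(a, r). S2 r)"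
  by (force simp: S2_def S3_def image_iff)

lemma sum_S3: "(\<Sum>(a, b, c)\<in>S3 xs. f a b c) = sum3 f xs"
proof -
  have "inj_on (\<lambda>((a, r), b, c). (a, b, c)) (Sigma (S2 xs) (\<lambda>(a, r). S2 r))"
    by (auto simp: inj_on_def S2_def)
  then have "(\<Sum>(a, b, c)\<in>S3 xs. f a b c)
      = (\<Sum>((a, r), b, c)\<in>Sigma (S2 xs) (\<lambda>(a, r). S2 r). f a b c)"
    unfolding S3_Sigma by (subst sum.reindex) (auto intro!: sum.cong)
  also have "\<dots> = (\<Sum>ar\<in>S2 xs. \<Sum>bc\<in>(case ar of (a, r) \<Rightarrow> S2 r).
      case (ar, bc) of ((a, r), b, c) \<Rightarrow> f a b c)"
    by (subst sum.Sigma) (auto intro!: sum.cong)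
  also have "\<dots> = sum3 f xs"
    unfolding sum3_def sum2_def by (auto intro!: sum.cong)
  finally show ?thesis .
qed

lemma finite_S3 [simp]: "finite (S3 xs)"
  unfolding S3_Sigma by (auto intro!: finite_imageI finite_SigmaI)

lemma sum2_Nil [simp]: "sum2 f [] = f [] []"
  by (simp add: sum2_def S2_Nil)

lemma sum2_Cons: "sum2 f (a # xs) = f [] (a # xs) + sum2 (\<lambda>p q. f (a # p) q) xs"
proof -
  have i: "inj_on (\<lambda>(p, q). (a # p, q)) (S2 xs)" by (auto simp: inj_on_def)
  have "([], a # xs) \<notin> (\<lambda>(p, q). (a # p, q)) ` S2 xs" by auto
  then show ?thesis
    unfolding sum2_def S2_Cons
    by (subst sum.insert, simp, assumption) (simp only: sum.reindex[OF i], simp add: case_prod_unfold)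
qed

lemma sum2_cong:
  assumes "xs = ys" and "\<And>p q. p @ q = ys \<Longrightarrow> f p q = g p q"
  shows "sum2 f xs = sum2 g ys"
  unfolding sum2_def using assms by (auto intro!: sum.cong simp: S2_def)

lemma sum3_cong:
  assumes "xs = ys" and "\<And>p q r. p @ q @ r = ys \<Longrightarrow> f p q r = g p q r"
  shows "sum3 f xs = sum3 g ys"
  unfolding sum3_def using assms by (auto intro!: sum2_cong)

lemma sum4_cong:
  assumes "xs = ys" and "\<And>a b c d. a @ b @ c @ d = ys \<Longrightarrow> f a b c d = g a b c d"
  shows "sum4 f xs = sum4 g ys"
  unfolding sum4_def using assms by (auto intro!: sum2_cong sum3_cong)

lemma sum5_cong:
  assumes "xs = ys" and "\<And>a b c d e. a @ b @ c @ d @ e = ys \<Longrightarrow> f a b c d e = g a b c d e"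
  shows "sum5 f xs = sum5 g ys"
  unfolding sum5_def using assms by (auto intro!: sum3_cong)

lemma sum2_add: "sum2 (\<lambda>p q. f p q + g p q) xs = sum2 f xs + sum2 g xs"
  unfolding sum2_def by (simp add: case_prod_unfold sum.distrib)

lemma sum3_add: "sum3 (\<lambda>p q r. f p q r + g p q r) xs = sum3 f xs + sum3 g xs"
  by (simp add: sum3_def sum2_add)

lemma sum4_add: "sum4 (\<lambda>p q r s. f p q r s + g p q r s) xs = sum4 f xs + sum4 g xs"
  by (simp add: sum4_def sum2_add sum3_add)

lemma sum5_add: "sum5 (\<lambda>p q r s t. f p q r s t + g p q r s t) xs = sum5 f xs + sum5 g xs"
  by (simp add: sum5_def sum3_add)

lemma sum2_mult: "sum2 (\<lambda>p q. c * f p q) xs = c * sum2 f xs" for c :: "'a::semiring_0"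
  unfolding sum2_def by (simp add: case_prod_unfold sum_distrib_left)

lemma sum3_mult: "sum3 (\<lambda>p q r. c * f p q r) xs = c * sum3 f xs" for c :: "'a::semiring_0"
  by (simp add: sum3_def sum2_mult)

lemma sum2_0 [simp]: "sum2 (\<lambda>p q. 0) xs = 0"
  unfolding sum2_def by simp

lemma sum3_0 [simp]: "sum3 (\<lambda>p q r. 0) xs = 0"
  by (simp add: sum3_def)

section \<open>Recutting the pieces of a decomposition\<close>

lemma sum2_swap: "sum2 (\<lambda>p q. sum2 (f p q) ys) xs = sum2 (\<lambda>r s. sum2 (\<lambda>p q. f p q r s) xs) ys"
  unfolding sum2_def case_prod_unfold by (rule sum.swap)

lemma sum2_split:
  "sum2 f (x @ m # y) = sum2 (\<lambda>p q. f (x @ m # p) q) y + sum2 (\<lambda>p q. f p (q @ m # y)) x"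
proof (induction x arbitrary: f)
  case Nil
  show ?case by (simp add: sum2_Cons add.commute)
next
  case (Cons a x)
  show ?case by (simp add: sum2_Cons Cons.IH ac_simps)
qed

text \<open>The summands correspond to \<open>m\<close> lying in the first, the middle or the last
  piece. This isolates alpha_0, a unit or a varied entry among the other letters.\<close>

lemma sum3_split:
  "sum3 f (x @ m # y) = sum3 (\<lambda>p q r. f (x @ m # p) q r) y
     + sum2 (\<lambda>p q. sum2 (\<lambda>r s. f p (q @ m # r) s) y) x
     + sum3 (\<lambda>p q r. f p q (r @ m # y)) x"
  unfolding sum3_def by (simp add: sum2_split sum2_add ac_simps)

text \<open>Both sides choose two cut points in \<open>xs\<close>; the left side makes the
  right-hand cut first, the right side the left-hand cut.\<close>

lemma sum2_left: "sum2 (\<lambda>p q. sum2 (f p q) p) xs = sum2 (\<lambda>r t. sum2 (\<lambda>s q. f (r @ s) q r s) t) xs"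
proof (induction xs arbitrary: f)
  case (Cons a xs)
  show ?case
    by (simp add: sum2_Cons sum2_add Cons.IH[of "\<lambda>p q r s. f (a # p) q (a # r) s"] ac_simps)
qed simp

text \<open>This and the next lemmas flatten a decomposition whose pieces are cut again into a
  single row of pieces from left to right. Terms of a composite operator that come from different
  nestings can then be compared piece by piece.\<close>

lemma sum3_sum2_left:
  "sum3 (\<lambda>a b c. sum2 (f a b c) a) xs = sum4 (\<lambda>p q b c. f (p @ q) b c p q) xs"
proof -
  have "sum3 (\<lambda>a b c. sum2 (f a b c) a) xs = sum2 (\<lambda>a t. sum2 (\<lambda>p q. sum2 (\<lambda>b c. f a b c p q) t) a) xs"
    unfolding sum3_def by (intro sum2_cong refl sum2_swap)
  also have "\<dots> = sum4 (\<lambda>p q b c. f (p @ q) b c p q) xs"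
    unfolding sum4_def sum3_def by (rule sum2_left)
  finally show ?thesis .
qed

lemma sum3_sum2_mid:
  "sum3 (\<lambda>a b c. sum2 (f a b c) b) xs = sum4 (\<lambda>a p q c. f a (p @ q) c p q) xs"
  unfolding sum4_def sum3_def by (intro sum2_cong refl sum2_left)

lemma sum3_sum2_right:
  "sum3 (\<lambda>a b c. sum2 (f a b c) c) xs = sum4 (\<lambda>a b p q. f a b (p @ q) p q) xs"
  unfolding sum4_def sum3_def by (intro sum2_cong refl) auto

lemma sum2_sum3_left:
  "sum2 (\<lambda>a b. sum3 (f a b) a) xs = sum4 (\<lambda>p q r b. f (p @ q @ r) b p q r) xs"
  unfolding sum4_def sum3_def
  by (subst sum2_left) (intro sum2_cong refl sum2_left)

lemma sum2_sum3_right: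
  "sum2 (\<lambda>a b. sum3 (f a b) b) xs = sum4 (\<lambda>a p q r. f a (p @ q @ r) p q r) xs"
  unfolding sum4_def sum3_def by (intro sum2_cong refl) auto

lemma sum2_sum2_sum2:
  "sum2 (\<lambda>a b. sum2 (\<lambda>p q. sum2 (\<lambda>r s. f a b p q r s) a) b) xs
    = sum4 (\<lambda>r s p q. f (r @ s) (p @ q) p q r s) xs"
proof -
  have "sum2 (\<lambda>a b. sum2 (\<lambda>p q. sum2 (\<lambda>r s. f a b p q r s) a) b) xs
    = sum2 (\<lambda>a b. sum2 (\<lambda>r s. sum2 (\<lambda>p q. f a b p q r s) b) a) xs"
    by (intro sum2_cong refl sum2_swap)
  also have "\<dots> = sum4 (\<lambda>r s p q. f (r @ s) (p @ q) p q r s) xs"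
    unfolding sum4_def sum3_def by (subst sum2_left) (intro sum2_cong refl, auto)
  finally show ?thesis .
qed

lemma sum3_left: "sum3 (\<lambda>a b c. sum3 (f a b c) a) xs = sum5 (\<lambda>p q r b c. f (p @ q @ r) b c p q r) xs"
proof -
  have "sum3 (\<lambda>a b c. sum3 (f a b c) a) xs
      = sum2 (\<lambda>a t. sum2 (\<lambda>p s. sum2 (\<lambda>q r. sum2 (\<lambda>b c. f a b c p q r) t) s) a) xs"
    unfolding sum3_def
    by (rule sum2_cong[OF refl], rule trans[OF sum2_swap], rule sum2_cong[OF refl], rule sum2_swap)
  also have "\<dots> = sum5 (\<lambda>p q r b c. f (p @ q @ r) b c p q r) xs"
    unfolding sum5_def sum3_def by (subst sum2_left) (intro sum2_cong refl sum2_left)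
  finally show ?thesis .
qed

lemma sum3_mid: "sum3 (\<lambda>a b c. sum3 (f a b c) b) xs = sum5 (\<lambda>a p q r c. f a (p @ q @ r) c p q r) xs"
  unfolding sum5_def sum3_def
  by (rule sum2_cong[OF refl], rule trans[OF sum2_left], rule sum2_cong[OF refl], rule sum2_left)

lemma sum3_right: "sum3 (\<lambda>a b c. sum3 (f a b c) c) xs = sum5 (\<lambda>a b p q r. f a b (p @ q @ r) p q r) xs"
  unfolding sum5_def sum3_def by (intro sum2_cong refl) auto

lemma sum3_outer:
  "sum3 (\<lambda>a b c. sum2 (\<lambda>r s. sum2 (\<lambda>p q. f a b c p q r s) c) a) xs
    = sum5 (\<lambda>r s b p q. f (r @ s) b (p @ q) p q r s) xs"
proof -
  have "sum3 (\<lambda>a b c. sum2 (\<lambda>r s. sum2 (\<lambda>p q. f a b c p q r s) c) a) xs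
      = sum4 (\<lambda>r s b c. sum2 (\<lambda>p q. f (r @ s) b c p q r s) c) xs"
    by (rule sum3_sum2_left)
  also have "\<dots> = sum5 (\<lambda>r s b p q. f (r @ s) b (p @ q) p q r s) xs"
    unfolding sum5_def sum4_def sum3_def by (intro sum2_cong refl) auto
  finally show ?thesis .
qed

lemma sum3_outer_swap:
  "sum3 (\<lambda>a b c. sum2 (\<lambda>p q. sum2 (\<lambda>r s. f a b c p q r s) a) c) xs
    = sum5 (\<lambda>r s b p q. f (r @ s) b (p @ q) p q r s) xs"
proof -
  have "sum3 (\<lambda>a b c. sum2 (\<lambda>p q. sum2 (\<lambda>r s. f a b c p q r s) a) c) xs
      = sum3 (\<lambda>a b c. sum2 (\<lambda>r s. sum2 (\<lambda>p q. f a b c p q r s) c) a) xs"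
    by (intro sum3_cong refl sum2_swap)
  then show ?thesis by (simp add: sum3_outer)
qed

text \<open>Moving the letter after the cut to the other side pairs each \<open>f\<close>-term with
  a \<open>g\<close>-term; only \<open>g [] xs\<close> and \<open>f xs []\<close> have no partner.
  This later matches cyclic rotations of a word read from their first and from their last
  letter.\<close>

lemma sum2_shift:
  assumes "\<And>p y q. p @ y # q = xs \<Longrightarrow> f p (y # q) = g (p @ [y]) q"
  shows "sum2 f xs + g [] xs = sum2 g xs + f xs []"
  using assms
proof (induction xs arbitrary: f g)
  case (Cons a xs)
  have "sum2 (\<lambda>p q. f (a # p) q) xs + g [a] xs = sum2 (\<lambda>p q. g (a # p) q) xs + f (a # xs) []"
    by (rule Cons.IH) (use Cons.prems in force)
  moreover have "f [] (a # xs) = g [a] xs" using Cons.prems[of "[]" a xs] by simp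
  ultimately show ?case by (simp add: sum2_Cons ac_simps)
qed (simp add: add.commute)

lemma sum2_support:
  assumes "K \<subseteq> S2 xs" and "\<And>p q. p @ q = xs \<Longrightarrow> (p, q) \<notin> K \<Longrightarrow> f p q = 0"
  shows "sum2 f xs = (\<Sum>(p, q)\<in>K. f p q)"
  unfolding sum2_def by (rule sum.mono_neutral_right[OF finite_S2 assms(1)]) (use assms(2) in \<open>auto simp: S2_def\<close>)

lemma sum3_support:
  assumes "K \<subseteq> S3 xs" and "\<And>p q r. p @ q @ r = xs \<Longrightarrow> (p, q, r) \<notin> K \<Longrightarrow> f p q r = 0"
  shows "sum3 f xs = (\<Sum>(p, q, r)\<in>K. f p q r)"
  unfolding sum_S3[symmetric] by (rule sum.mono_neutral_right[OF finite_S3 assms(1)]) (use assms(2) in \<open>auto simp: S3_def\<close>)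

text \<open>Made for a strict unit standing between \<beta> and \<gamma>: an operation containing it
  survives only as a product with one neighbour, so one of \<open>q\<close> and \<open>r\<close> is
  a single letter and the other is empty.\<close>

lemma sum2_sum2_support_adjacent:
  assumes "\<And>p q r s. p @ q = \<beta> \<Longrightarrow> r @ s = \<gamma> \<Longrightarrow> length q + length r \<noteq> 1 \<Longrightarrow> f p q r s = 0"
  shows "sum2 (\<lambda>p q. sum2 (f p q) \<gamma>) \<beta> =
    (if \<beta> = [] then 0 else f (butlast \<beta>) [last \<beta>] [] \<gamma>) +
    (if \<gamma> = [] then 0 else f \<beta> [] [hd \<gamma>] (tl \<gamma>))"
proof -
  have in1: "sum2 (f p [y]) \<gamma> = f p [y] [] \<gamma>" if "p @ [y] = \<beta>" for p y
    using sum2_support[of "{([], \<gamma>)}" \<gamma> "f p [y]"] assms[OF that] by (force simp: S2_def)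
  have in0: "sum2 (f \<beta> []) \<gamma> = (if \<gamma> = [] then 0 else f \<beta> [] [hd \<gamma>] (tl \<gamma>))"
  proof (cases \<gamma>)
    case Nil
    then show ?thesis using assms[of \<beta> "[]" "[]" "[]"] by simp
  next
    case (Cons z zs)
    have "sum2 (f \<beta> []) \<gamma> = (\<Sum>(p, q)\<in>{([z], zs)}. f \<beta> [] p q)"
    proof (rule sum2_support)
      fix p q assume a: "p @ q = \<gamma>" "(p, q) \<notin> {([z], zs)}"
      then have "length p \<noteq> 1" using Cons by (cases p) auto
      then show "f \<beta> [] p q = 0" using assms[of \<beta> "[]" p q] a by simp
    qed (simp add: S2_def Cons)
    then show ?thesis using Cons by simp
  qed
  show ?thesis
  proof (cases \<beta> rule: rev_cases)
    case Nil
    then show ?thesis using in0 by simp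
  next
    case (snoc ys y)
    have "sum2 (\<lambda>p q. sum2 (f p q) \<gamma>) \<beta> = (\<Sum>(p, q)\<in>{(ys, [y]), (\<beta>, [])}. sum2 (f p q) \<gamma>)"
    proof (rule sum2_support)
      fix p q assume a: "p @ q = \<beta>" "(p, q) \<notin> {(ys, [y]), (\<beta>, [])}"
      have "length q \<noteq> 0" using a by auto
      moreover have "length q \<noteq> 1"
      proof
        assume "length q = 1"
        then obtain z where "q = [z]" by (metis length_0_conv length_Suc_conv One_nat_def)
        then show False using a snoc by auto
      qed
      ultimately have "f p q r s = 0" if "r @ s = \<gamma>" for r s
        using assms[OF a(1) that] by linarith
      then show "sum2 (f p q) \<gamma> = 0" by (simp cong: sum2_cong)
    qed (auto simp: S2_def snoc)
    also have "\<dots> = sum2 (f ys [y]) \<gamma> + sum2 (f \<beta> []) \<gamma>" by simp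
    finally show ?thesis using in1[of ys y] in0 snoc by simp
  qed
qed

section \<open>Multilinear functions on words\<close>

(* The literal 1 in app_mu would otherwise be rewritten to Suc 0. *)
declare One_nat_def [simp del]

text \<open>The target is a function of the start and the sequence, so it is left implicit;
  composability then splits along concatenations by rewriting alone.\<close>

definition pth :: "('o, 'm) ainf_cat \<Rightarrow> 'o \<Rightarrow> ('o, 'm) mor list \<Rightarrow> bool" where
  "pth C X as \<longleftrightarrow> is_path C X as (endpt X as)"

lemma endpt_append [simp]: "endpt X (as @ bs) = endpt (endpt X as) bs"
  by (induction as arbitrary: X) auto

lemma is_path_iff: "is_path C X as Y \<longleftrightarrow> pth C X as \<and> endpt X as = Y"
proof -
  have "is_path C X as Y \<Longrightarrow> endpt X as = Y" by (induction as arbitrary: X) auto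
  then show ?thesis by (auto simp: pth_def)
qed

lemma pth_Nil [simp]: "pth C X [] \<longleftrightarrow> X \<in> obj C"
  and pth_Cons [simp]: "pth C X (a # as) \<longleftrightarrow> is_mor C a \<and> src a = X \<and> pth C (tgt a) as"
  by (auto simp: pth_def)

lemma pth_obj: "pth C X as \<Longrightarrow> X \<in> obj C \<and> endpt X as \<in> obj C"
  by (induction as arbitrary: X) (auto simp: is_mor_def)

lemma pth_append [simp]: "pth C X (as @ bs) \<longleftrightarrow> pth C X as \<and> pth C (endpt X as) bs"
  by (induction as arbitrary: X) (auto dest: pth_obj simp: is_mor_def)

lemma words_iff: "(a0, as) \<in> words C \<longleftrightarrow> is_mor C a0 \<and> pth C (tgt a0) as \<and> endpt (tgt a0) as = src a0"
  by (auto simp: words_def is_path_iff)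

lemma eps_Nil [simp]: "eps [] = 0"
  and eps_Cons [simp]: "eps (a # as) = sd a + eps as"
  and eps_append [simp]: "eps (as @ bs) = eps as + eps bs"
  by (simp_all add: eps_def)

lemma app_cochain_simps [simp]:
  "src (app_cochain d \<phi> X as) = X" "tgt (app_cochain d \<phi> X as) = endpt X as"
  "vec (app_cochain d \<phi> X as) = \<phi> X as" "par (app_cochain d \<phi> X as) = (d + 1 + eps as) mod 2"
  by (simp_all add: app_cochain_def)

lemma even_sd_app_cochain [simp]: "even (sd (app_cochain d \<phi> X as)) \<longleftrightarrow> even (d + eps as)"
  by (simp add: sd_def)

lemma sd_Mor [simp]: "sd (Mor S T p x) = p + 1"
  by (simp add: sd_def)

lemma unit_mor_simps [simp]:
  "src (unit_mor C X) = X" "tgt (unit_mor C X) = X" "par (unit_mor C X) = 0" "sd (unit_mor C X) = 1"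
  by (simp_all add: unit_mor_def sd_def)

text \<open>The transpose of the Hochschild differential: \<open>G\<close> is paired with the image
  of a word under \<open>hoch_b\<close>. Working with functions of words avoids quotients, since
  signs become numbers and relations among chains become properties of \<open>G\<close>.\<close>

definition dual_b :: "('o, 'm) ainf_cat \<Rightarrow> (('o, 'm) word \<Rightarrow> complex) \<Rightarrow> ('o, 'm) word \<Rightarrow> complex" where
  "dual_b C G = (\<lambda>(a0, as).
     sum3 (\<lambda>a1 a2 a3. (-1) ^ (eps a3 * (eps a2 + eps a1 + sd a0)) *
        G (app_mu C (endpt (tgt a0) (a1 @ a2)) (a3 @ [a0] @ a1), a2)) as +
     sum3 (\<lambda>a1 a2 a3. (-1) ^ (eps a1 + sd a0) *
        G (a0, a1 @ [app_mu C (endpt (tgt a0) a1) a2] @ a3)) as)"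

definition dual_B :: "('o, 'm) ainf_cat \<Rightarrow> (('o, 'm) word \<Rightarrow> complex) \<Rightarrow> ('o, 'm) word \<Rightarrow> complex" where
  "dual_B C G = (\<lambda>(a0, as).
     sum2 (\<lambda>a1 a2. (-1) ^ (eps a2 * (sd a0 + eps a1)) *
        G (unit_mor C (endpt (tgt a0) a1), a2 @ [a0] @ a1)) as)"

definition coeff_fun :: "(('w \<Rightarrow>\<^sub>0 complex) \<Rightarrow> complex) \<Rightarrow> 'w \<Rightarrow> complex" where
  "coeff_fun F z = F (Poly_Mapping.single z 1)"

lemma functional_single': "functional F \<Longrightarrow> F (Poly_Mapping.single z c) = c * coeff_fun F z"
  unfolding coeff_fun_def by (rule functional_single)

lemma coeff_fun_hoch_b:
  fixes F :: "('o, 'm) chain \<Rightarrow> complex"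
  assumes F: "functional F"
  shows "coeff_fun (\<lambda>x. F (hoch_b C x)) = dual_b C (coeff_fun F)"
proof
  fix z :: "('o, 'm) word"
  obtain a0 as where z: "z = (a0, as)" by (cases z)
  have "coeff_fun (\<lambda>x. F (hoch_b C x)) z = F (hoch_b C (Poly_Mapping.single (a0, as) 1))"
    by (simp add: coeff_fun_def z)
  then show "coeff_fun (\<lambda>x. F (hoch_b C x)) z = dual_b C (coeff_fun F) z"
    by (simp add: z hoch_b_def dual_b_def functional_add[OF F] functional_sum[OF F]
        functional_single'[OF F] case_prod_unfold sum_S3[symmetric] sum2_def)
qed

lemma coeff_fun_connes_B:
  fixes F :: "('o, 'm) chain \<Rightarrow> complex"
  assumes F: "functional F"
  shows "coeff_fun (\<lambda>x. F (connes_B C x)) = dual_B C (coeff_fun F)"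
proof
  fix z :: "('o, 'm) word"
  obtain a0 as where z: "z = (a0, as)" by (cases z)
  have "coeff_fun (\<lambda>x. F (connes_B C x)) z = F (connes_B C (Poly_Mapping.single (a0, as) 1))"
    by (simp add: coeff_fun_def z)
  then show "coeff_fun (\<lambda>x. F (connes_B C x)) z = dual_B C (coeff_fun F) z"
    by (simp add: z connes_B_def dual_B_def functional_add[OF F] functional_sum[OF F]
        functional_single'[OF F] case_prod_unfold sum_S3[symmetric] sum2_def)
qed

section \<open>Multilinear functions that vanish on units\<close>

definition slot_ok where
  "slot_ok C f S T p \<longleftrightarrow> f \<in> word_slots \<and> S \<in> obj C \<and> T \<in> obj C \<and> p < 2 \<and>
     (\<forall>x\<in>mor_space C S T p. f (Mor S T p x) \<in> words C)"

definition lin_on :: "('o, 'm::ab_group_add) ainf_cat \<Rightarrow> 'o \<Rightarrow> 'o \<Rightarrow> nat \<Rightarrow> ('m \<Rightarrow> complex) \<Rightarrow> bool" where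
  "lin_on C S T p \<Phi> \<longleftrightarrow>
     (\<forall>x\<in>mor_space C S T p. \<forall>y\<in>mor_space C S T p. \<Phi> (x + y) = \<Phi> x + \<Phi> y) \<and>
     (\<forall>a. \<forall>x\<in>mor_space C S T p. \<Phi> (scl C a x) = a * \<Phi> x)"

text \<open>Together with \<open>unital\<close> this singles out the functions of words that induce
  functionals on reduced chains, as \<open>rel_functional_iff\<close> confirms.\<close>

definition multilin :: "('o, 'm::ab_group_add) ainf_cat \<Rightarrow> (('o, 'm) word \<Rightarrow> complex) \<Rightarrow> bool" where
  "multilin C G \<longleftrightarrow> (\<forall>f S T p. slot_ok C f S T p \<longrightarrow> lin_on C S T p (\<lambda>x. G (f (Mor S T p x))))"

definition unital :: "('o, 'm::ab_group_add) ainf_cat \<Rightarrow> (('o, 'm) word \<Rightarrow> complex) \<Rightarrow> bool" where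
  "unital C G \<longleftrightarrow> (\<forall>a0 \<beta> Z \<gamma>. (a0, \<beta> @ [unit_mor C Z] @ \<gamma>) \<in> words C \<longrightarrow>
     G (a0, \<beta> @ [unit_mor C Z] @ \<gamma>) = 0)"

lemma word_slots_intros [simp, intro]:
  "(\<lambda>a. (a, as)) \<in> word_slots" "(\<lambda>a. (a0, \<beta> @ a # \<gamma>)) \<in> word_slots" "(\<lambda>a. (a0, a # \<gamma>)) \<in> word_slots"
proof -
  show "(\<lambda>a. (a, as)) \<in> word_slots" "(\<lambda>a. (a0, \<beta> @ a # \<gamma>)) \<in> word_slots"
    unfolding word_slots_def by auto
  show "(\<lambda>a. (a0, a # \<gamma>)) \<in> word_slots"
    unfolding word_slots_def by (force intro: exI[of _ "[]"])
qed

lemma word_slots_cases: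
  assumes "f \<in> word_slots"
  obtains as where "f = (\<lambda>a. (a, as))" | a0 \<beta> \<gamma> where "f = (\<lambda>a. (a0, \<beta> @ [a] @ \<gamma>))"
  using assms unfolding word_slots_def by blast

text \<open>Admissibility of a word depends on an entry only through its source, target, parity and
  membership in the morphism space, so one admissible filling of a slot makes all fillings from that
  space admissible.\<close>

lemma slot_okI:
  assumes "f \<in> word_slots" "f (Mor S T p x) \<in> words C"
  shows "slot_ok C f S T p" and "x \<in> mor_space C S T p"
proof -
  have "x \<in> mor_space C S T p \<and> S \<in> obj C \<and> T \<in> obj C \<and> p < 2 \<and>
      (\<forall>x\<in>mor_space C S T p. f (Mor S T p x) \<in> words C)"
    using assms(1)
  proof (cases rule: word_slots_cases)
    case (1 as)
    show ?thesis using assms(2) unfolding 1 by (auto simp: words_iff is_mor_def)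
  next
    case (2 a0 \<beta> \<gamma>)
    show ?thesis using assms(2) unfolding 2 by (auto simp: words_iff is_mor_def)
  qed
  then show "slot_ok C f S T p" "x \<in> mor_space C S T p" using assms(1) by (auto simp: slot_ok_def)
qed

lemma lin_onI:
  assumes "\<And>x y. \<lbrakk>x \<in> mor_space C S T p; y \<in> mor_space C S T p\<rbrakk> \<Longrightarrow> \<Phi> (x + y) = \<Phi> x + \<Phi> y"
    and "\<And>a x. x \<in> mor_space C S T p \<Longrightarrow> \<Phi> (scl C a x) = a * \<Phi> x"
  shows "lin_on C S T p \<Phi>"
  using assms by (auto simp: lin_on_def)

lemma lin_on_mult: "lin_on C S T p \<Phi> \<Longrightarrow> lin_on C S T p (\<lambda>x. c * \<Phi> x)"
  by (auto simp: lin_on_def algebra_simps)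

lemma lin_on_add: "lin_on C S T p \<Phi> \<Longrightarrow> lin_on C S T p \<Psi> \<Longrightarrow> lin_on C S T p (\<lambda>x. \<Phi> x + \<Psi> x)"
  by (auto simp: lin_on_def algebra_simps)

lemma lin_on_sum: "(\<And>i. i \<in> A \<Longrightarrow> lin_on C S T p (\<Phi> i)) \<Longrightarrow> lin_on C S T p (\<lambda>x. \<Sum>i\<in>A. \<Phi> i x)"
  by (auto simp: lin_on_def sum.distrib sum_distrib_left)

lemma lin_on_sum2:
  "(\<And>a b. a @ b = xs \<Longrightarrow> lin_on C S T p (\<Phi> a b)) \<Longrightarrow> lin_on C S T p (\<lambda>x. sum2 (\<lambda>a b. \<Phi> a b x) xs)"
  unfolding sum2_def case_prod_unfold by (rule lin_on_sum) (auto simp: S2_def)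

lemma lin_on_sum3:
  "(\<And>a b c. a @ b @ c = xs \<Longrightarrow> lin_on C S T p (\<Phi> a b c)) \<Longrightarrow>
     lin_on C S T p (\<lambda>x. sum3 (\<lambda>a b c. \<Phi> a b c x) xs)"
  unfolding sum3_def by (intro lin_on_sum2) auto

context weakly_curved_ainf_cat
begin

sublocale V: vector_space "scl C" by (rule scl_vector_space)

lemma mor_add: "\<lbrakk>S \<in> obj C; T \<in> obj C; p < 2; x \<in> mor_space C S T p; y \<in> mor_space C S T p\<rbrakk>
    \<Longrightarrow> x + y \<in> mor_space C S T p"
  and mor_scl: "\<lbrakk>S \<in> obj C; T \<in> obj C; p < 2; x \<in> mor_space C S T p\<rbrakk> \<Longrightarrow> scl C a x \<in> mor_space C S T p"
  and mor_0: "\<lbrakk>S \<in> obj C; T \<in> obj C; p < 2\<rbrakk> \<Longrightarrow> 0 \<in> mor_space C S T p"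
  using hom_subspace[of S T p] by (auto simp: V.subspace_def)

lemma is_mor_app_mu [simp]: "pth C X as \<Longrightarrow> is_mor C (app_mu C X as)"
  using mu_closed[of X as "endpt X as"] pth_obj[of C X as] by (simp add: is_mor_def is_path_iff)

lemma is_mor_unit [simp]: "is_mor C (unit_mor C X) \<longleftrightarrow> X \<in> obj C"
  using unit_hom[of X] by (auto simp: is_mor_def unit_mor_def)

lemma is_mor_Mor: "is_mor C (Mor S T p x) \<longleftrightarrow> S \<in> obj C \<and> T \<in> obj C \<and> p < 2 \<and> x \<in> mor_space C S T p"
  by (auto simp: is_mor_def)

lemma word_b_first:
  assumes "(a0, a1 @ a2 @ a3) \<in> words C"
  shows "(app_mu C (endpt (tgt a0) (a1 @ a2)) (a3 @ [a0] @ a1), a2) \<in> words C"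
  using assms pth_obj[of C "endpt (tgt a0) a1" a2] by (auto simp: words_iff intro!: is_mor_app_mu)

lemma word_b_second:
  assumes "(a0, a1 @ a2 @ a3) \<in> words C"
  shows "(a0, a1 @ [app_mu C (endpt (tgt a0) a1) a2] @ a3) \<in> words C"
  using assms by (auto simp: words_iff)

lemma word_B:
  assumes "(a0, a1 @ a2) \<in> words C"
  shows "(unit_mor C (endpt (tgt a0) a1), a2 @ [a0] @ a1) \<in> words C"
  using assms pth_obj[of C "endpt (tgt a0) a1" a2] pth_obj[of C "tgt a0" a1] by (auto simp: words_iff)

lemma multilin_lin_on:
  "\<lbrakk>multilin C G; slot_ok C f S T p\<rbrakk> \<Longrightarrow> lin_on C S T p (\<lambda>x. G (f (Mor S T p x)))"
  by (simp add: multilin_def)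

text \<open>Source, target and parity of the output of \<open>mu\<close> do not depend on the vector
  \<open>x\<close>. The output therefore stays in one fixed slot of \<open>f\<close>, and linearity
  of \<open>mu\<close> in an entry composes with linearity of \<open>G\<close> in that slot.\<close>

lemma lin_on_app_mu:
  assumes G: "multilin C G" and f: "f \<in> word_slots"
    and mem: "S \<in> obj C" "T \<in> obj C" "p < 2"
    and p: "\<And>x. x \<in> mor_space C S T p \<Longrightarrow> pth C Z (\<beta> @ Mor S T p x # \<gamma>)"
    and w: "\<And>x. x \<in> mor_space C S T p \<Longrightarrow> f (app_mu C Z (\<beta> @ Mor S T p x # \<gamma>)) \<in> words C"
  shows "lin_on C S T p (\<lambda>x. G (f (app_mu C Z (\<beta> @ Mor S T p x # \<gamma>))))"
proof -
  \<comment> \<open>The leading 2 is d + 1 for the operation \<open>mu\<close>, whose shifted degree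
    d is 1; the varied entry contributes its shifted degree \<open>p + 1\<close>.\<close>
  define E q where "E = endpt T \<gamma>" and "q = (2 + eps \<beta> + (p + 1) + eps \<gamma>) mod 2"
  have app: "app_mu C Z (\<beta> @ Mor S T p x # \<gamma>) = Mor Z E q (mu C Z (\<beta> @ Mor S T p x # \<gamma>))" for x
    by (simp add: app_cochain_def E_def q_def add_ac)
  have path: "is_path C Z (\<beta> @ [Mor S T p x] @ \<gamma>) E" if "x \<in> mor_space C S T p" for x
    using p[OF that] by (auto simp: is_path_iff E_def)
  have ok: "slot_ok C f Z E q"
    and m: "\<And>x. x \<in> mor_space C S T p \<Longrightarrow> mu C Z (\<beta> @ Mor S T p x # \<gamma>) \<in> mor_space C Z E q"
    using slot_okI[OF f] w[unfolded app] mor_0[OF mem] by blast+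
  show ?thesis
  proof (rule lin_onI)
    fix x y assume x: "x \<in> mor_space C S T p" and y: "y \<in> mor_space C S T p"
    show "G (f (app_mu C Z (\<beta> @ Mor S T p (x + y) # \<gamma>))) =
        G (f (app_mu C Z (\<beta> @ Mor S T p x # \<gamma>))) + G (f (app_mu C Z (\<beta> @ Mor S T p y # \<gamma>)))"
      using mu_add[OF path[OF x] path[OF y]] multilin_lin_on[OF G ok] m[OF x] m[OF y]
      by (simp add: app lin_on_def)
  next
    fix a x assume x: "x \<in> mor_space C S T p"
    show "G (f (app_mu C Z (\<beta> @ Mor S T p (scl C a x) # \<gamma>))) =
        a * G (f (app_mu C Z (\<beta> @ Mor S T p x # \<gamma>)))"
      using mu_scale[OF path[OF x], of a] multilin_lin_on[OF G ok] m[OF x]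
      by (simp add: app lin_on_def)
  qed
qed

lemma multilin_0:
  assumes G: "multilin C G" and f: "f \<in> word_slots" and w: "f (Mor S T p 0) \<in> words C"
  shows "G (f (Mor S T p 0)) = 0"
proof -
  have "scl C 0 0 = 0" by simp
  then show ?thesis
    using multilin_lin_on[OF G slot_okI(1)[OF f w]] slot_okI(2)[OF f w] unfolding lin_on_def
    by (metis mult_zero_left)
qed

text \<open>In each term of b a given entry is either an argument of the operation, where
  multilinearity of \<open>mu\<close> applies, or it is left in place, where that of
  \<open>G\<close> applies.\<close>

lemma multilin_dual_b:
  assumes G: "multilin C G"
  shows "multilin C (dual_b C G)"
  unfolding multilin_def
proof (intro allI impI)
  fix f S T p assume ok: "slot_ok C f S T p"
  then have mem: "S \<in> obj C" "T \<in> obj C" "p < 2"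
    and fw: "\<And>x. x \<in> mor_space C S T p \<Longrightarrow> f (Mor S T p x) \<in> words C"
    by (auto simp: slot_ok_def)
  from ok have "f \<in> word_slots" by (simp add: slot_ok_def)
  then show "lin_on C S T p (\<lambda>x. dual_b C G (f (Mor S T p x)))"
  proof (cases rule: word_slots_cases)
    case (1 as)
    show ?thesis
      unfolding 1 dual_b_def prod.case
    proof (intro lin_on_add lin_on_sum3, goal_cases)
      case as: (1 u v t)
      have "lin_on C S T p (\<lambda>x. G (app_mu C (endpt T (u @ v)) (t @ Mor S T p x # u), v))"
        by (rule lin_on_app_mu[where f = "\<lambda>a. (a, v)"])
          (use G mem fw word_b_first[of "Mor S T p _" u v t] in \<open>auto simp: 1 words_iff as[symmetric]\<close>)
      from lin_on_mult[OF this] show ?case by simp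
    next
      case as: (2 u v t)
      have "lin_on C S T p (\<lambda>x. G (Mor S T p x, u @ app_mu C (endpt T u) v # t))"
        by (rule multilin_lin_on[OF G, where f = "\<lambda>a. (a, _)"])
          (use G mem fw word_b_second[of "Mor S T p _" u v t] in \<open>auto simp: 1 slot_ok_def as[symmetric]\<close>)
      from lin_on_mult[OF this] show ?case by simp
    qed
  next
    case (2 a0 \<beta> \<gamma>)
    have wd: "(a0, \<beta> @ Mor S T p x # \<gamma>) \<in> words C" if "x \<in> mor_space C S T p" for x
      using fw[OF that] 2 by simp
    \<comment> \<open>The six goals are the positions of the varied entry: the three pieces of the
      wrapping sum, then the three pieces of the inner sum. In goals 1, 3 and 5 it is an argument of
      the operation.\<close>
    show ?thesis
      unfolding 2 dual_b_def prod.case append_Cons append_Nil sum3_split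
    proof (intro lin_on_add lin_on_sum3 lin_on_sum2, goal_cases)
      case (1 u v t)
      have "lin_on C S T p (\<lambda>x. G (app_mu C (endpt T (u @ v)) ((t @ a0 # \<beta>) @ Mor S T p x # u), v))"
        by (rule lin_on_app_mu[where f = "\<lambda>a. (a, v)"])
          (use G mem wd word_b_first[of a0 "\<beta> @ Mor S T p _ # u" v t] in \<open>auto simp: words_iff 1[symmetric]\<close>)
      from lin_on_mult[OF this] show ?case by simp
    next
      case (2 u v t r)
      have "lin_on C S T p (\<lambda>x. G (app_mu C (endpt T t) (r @ a0 # u), v @ Mor S T p x # t))"
        by (rule multilin_lin_on[OF G, where f = "\<lambda>a. (_, v @ a # t)"])
          (use G mem wd word_b_first[of a0 u "v @ Mor S T p _ # t" r] in \<open>auto simp: slot_ok_def 2[symmetric]\<close>)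
      from lin_on_mult[OF this] show ?case by simp
    next
      case (3 u v t)
      have "lin_on C S T p (\<lambda>x. G (app_mu C (endpt (tgt a0) (u @ v)) (t @ Mor S T p x # \<gamma> @ a0 # u), v))"
        by (rule lin_on_app_mu[where f = "\<lambda>a. (a, v)"])
          (use G mem wd word_b_first[of a0 u v "t @ Mor S T p _ # \<gamma>"] in \<open>auto simp: words_iff 3[symmetric]\<close>)
      from lin_on_mult[OF this] show ?case by simp
    next
      case (4 u v t)
      have "lin_on C S T p (\<lambda>x. G (a0, \<beta> @ Mor S T p x # u @ app_mu C (endpt T u) v # t))"
        by (rule multilin_lin_on[OF G, where f = "\<lambda>a. (a0, \<beta> @ a # _)"])
          (use G mem wd word_b_second[of a0 "\<beta> @ Mor S T p _ # u" v t] in \<open>auto simp: slot_ok_def 4[symmetric]\<close>)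
      from lin_on_mult[OF this] show ?case by simp
    next
      case (5 u v t r)
      have "lin_on C S T p (\<lambda>x. G (a0, u @ app_mu C (endpt (tgt a0) u) (v @ Mor S T p x # t) # r))"
        by (rule lin_on_app_mu[where f = "\<lambda>a. (a0, u @ a # r)"])
          (use G mem wd word_b_second[of a0 u "v @ Mor S T p _ # t" r] in \<open>auto simp: words_iff 5[symmetric]\<close>)
      from lin_on_mult[OF this] show ?case by simp
    next
      case (6 u v t)
      have "lin_on C S T p (\<lambda>x. G (a0, (u @ app_mu C (endpt (tgt a0) u) v # t) @ Mor S T p x # \<gamma>))"
        by (rule multilin_lin_on[OF G, where f = "\<lambda>a. (a0, _ @ a # \<gamma>)"])
          (use G mem wd word_b_second[of a0 u v "t @ Mor S T p _ # \<gamma>"]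
            word_slots_intros(2)[of a0 "u @ app_mu C (endpt (tgt a0) u) v # t" \<gamma>] in \<open>auto simp: slot_ok_def 6[symmetric]\<close>)
      from lin_on_mult[OF this] show ?case by simp
    qed
  qed
qed

lemma multilin_dual_B:
  assumes G: "multilin C G"
  shows "multilin C (dual_B C G)"
  unfolding multilin_def
proof (intro allI impI)
  fix f S T p assume ok: "slot_ok C f S T p"
  then have mem: "S \<in> obj C" "T \<in> obj C" "p < 2"
    and fw: "\<And>x. x \<in> mor_space C S T p \<Longrightarrow> f (Mor S T p x) \<in> words C"
    by (auto simp: slot_ok_def)
  from ok have "f \<in> word_slots" by (simp add: slot_ok_def)
  then show "lin_on C S T p (\<lambda>x. dual_B C G (f (Mor S T p x)))"
  proof (cases rule: word_slots_cases)
    case (1 as)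
    show ?thesis
      unfolding 1 dual_B_def prod.case
    proof (intro lin_on_sum2, goal_cases)
      case as: (1 u v)
      have "lin_on C S T p (\<lambda>x. G (unit_mor C (endpt T u), v @ Mor S T p x # u))"
        by (rule multilin_lin_on[OF G, where f = "\<lambda>a. (_, v @ a # _)"])
          (use G mem fw word_B[of "Mor S T p _" u v] in \<open>auto simp: 1 slot_ok_def as[symmetric]\<close>)
      from lin_on_mult[OF this] show ?case by simp
    qed
  next
    case (2 a0 \<beta> \<gamma>)
    have wd: "(a0, \<beta> @ Mor S T p x # \<gamma>) \<in> words C" if "x \<in> mor_space C S T p" for x
      using fw[OF that] 2 by simp
    show ?thesis
      unfolding 2 dual_B_def prod.case append_Cons append_Nil sum2_split
    proof (intro lin_on_add lin_on_sum2, goal_cases)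
      case (1 u v)
      have "lin_on C S T p (\<lambda>x. G (unit_mor C (endpt T u), (v @ a0 # \<beta>) @ Mor S T p x # u))"
        by (rule multilin_lin_on[OF G, where f = "\<lambda>a. (_, (v @ a0 # \<beta>) @ a # _)"])
          (use G mem wd word_B[of a0 "\<beta> @ Mor S T p _ # u" v]
            word_slots_intros(2)[of "unit_mor C (endpt T u)" "v @ a0 # \<beta>" u] in \<open>auto simp: slot_ok_def 1[symmetric]\<close>)
      from lin_on_mult[OF this] show ?case by simp
    next
      case (2 u v)
      have "lin_on C S T p (\<lambda>x. G (unit_mor C (endpt (tgt a0) u), v @ Mor S T p x # \<gamma> @ a0 # u))"
        by (rule multilin_lin_on[OF G, where f = "\<lambda>a. (_, v @ a # _)"])
          (use G mem wd word_B[of a0 u "v @ Mor S T p _ # \<gamma>"] in \<open>auto simp: slot_ok_def 2[symmetric]\<close>)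
      from lin_on_mult[OF this] show ?case by simp
    qed
  qed
qed

text \<open>B rotates the word and puts a new unit in front, so a unit among the later entries
  remains among the later entries.\<close>

lemma unital_dual_B:
  assumes G: "unital C G"
  shows "unital C (dual_B C G)"
  unfolding unital_def
proof (intro allI impI)
  fix a0 \<beta> Z \<gamma> assume w: "(a0, \<beta> @ [unit_mor C Z] @ \<gamma>) \<in> words C"
  have 1: "G (unit_mor C (endpt Z u), v @ a0 # \<beta> @ unit_mor C Z # u) = 0" if "u @ v = \<gamma>" for u v
    using G[unfolded unital_def, rule_format, of "unit_mor C (endpt Z u)" "v @ a0 # \<beta>" Z u]
      word_B[of a0 "\<beta> @ unit_mor C Z # u" v] w that by auto
  have 2: "G (unit_mor C (endpt (tgt a0) u), v @ unit_mor C Z # \<gamma> @ a0 # u) = 0" if "u @ v = \<beta>" for u v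
    using G[unfolded unital_def, rule_format, of "unit_mor C (endpt (tgt a0) u)" v Z "\<gamma> @ a0 # u"]
      word_B[of a0 u "v @ unit_mor C Z # \<gamma>"] w that by auto
  show "dual_B C G (a0, \<beta> @ [unit_mor C Z] @ \<gamma>) = 0"
    unfolding dual_B_def prod.case append_Cons append_Nil sum2_split
    by (simp add: sum2_cong[OF refl, where g = "\<lambda>_ _. 0"] 1 2 cong: sum2_cong)
qed

text \<open>The second B pushes the unit created by the first one behind a new first entry, where
  \<open>G\<close> vanishes.\<close>

lemma dual_B_dual_B:
  assumes G: "unital C G" and w: "(a0, as) \<in> words C"
  shows "dual_B C (dual_B C G) (a0, as) = 0"
proof -
  have "dual_B C G (unit_mor C (endpt (tgt a0) a1), a2 @ [a0] @ a1) = 0" if as: "a1 @ a2 = as" for a1 a2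
  proof -
    let ?e = "unit_mor C (endpt (tgt a0) a1)"
    have we: "(?e, a2 @ [a0] @ a1) \<in> words C"
      using word_B w as by blast
    have "G (unit_mor C (endpt (tgt ?e) u), v @ [?e] @ u) = 0" if "u @ v = a2 @ [a0] @ a1" for u v
      using G[unfolded unital_def, rule_format, of "unit_mor C (endpt (tgt ?e) u)" v _ u]
        word_B[of ?e u v] we that by simp
    then show ?thesis unfolding dual_B_def prod.case
      by (simp cong: sum2_cong)
  qed
  then show ?thesis unfolding dual_B_def[of C "dual_B C G"] prod.case
    by (simp cong: sum2_cong)
qed

section \<open>Strict units and the transpose of b\<close>

lemma mu_unit_zero:
  assumes "pth C X (\<beta> @ unit_mor C Z # \<gamma>)" and "length \<beta> + length \<gamma> \<noteq> 1"
  shows "mu C X (\<beta> @ unit_mor C Z # \<gamma>) = 0"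
proof (cases "\<beta> = [] \<and> \<gamma> = []")
  case True
  then show ?thesis using assms(1) mu1_unit[of Z] by auto
next
  case False
  then have "length \<beta> + length \<gamma> \<noteq> 0" by simp
  then have "length \<beta> + length \<gamma> \<ge> 2" using assms(2) by linarith
  then show ?thesis
    using mu_unit_higher[of X \<beta> Z \<gamma> "endpt X (\<beta> @ [unit_mor C Z] @ \<gamma>)"] assms(1)
    by (auto simp: is_path_iff)
qed

lemma multilin_app_mu_unit_zero:
  assumes G: "multilin C G" and f: "f \<in> word_slots"
    and w: "f (app_mu C X (\<beta> @ unit_mor C Z # \<gamma>)) \<in> words C"
    and p: "pth C X (\<beta> @ unit_mor C Z # \<gamma>)" and l: "length \<beta> + length \<gamma> \<noteq> 1"
  shows "G (f (app_mu C X (\<beta> @ unit_mor C Z # \<gamma>))) = 0"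
  using multilin_0[OF G f] w unfolding app_cochain_def mu_unit_zero[OF p l] by blast

lemma app_mu_unit_left:
  assumes "is_mor C a"
  shows "app_mu C (src a) [unit_mor C (src a), a] = a"
  using mu2_unit_left[OF assms] assms
  by (cases a) (auto simp: app_cochain_def sd_def is_mor_def less_2_cases_iff)

text \<open>The right unit law carries its sign as a scalar inside the morphism, and multilinearity
  of \<open>G\<close> pulls it out; the left unit law is an equality of morphisms.\<close>

lemma multilin_app_mu_unit_right:
  assumes G: "multilin C G" and f: "f \<in> word_slots" and w: "f a \<in> words C" and a: "is_mor C a"
  shows "G (f (app_mu C (src a) [a, unit_mor C (tgt a)])) = (-1) ^ par a * G (f a)"
proof -
  obtain S T p x where ax: "a = Mor S T p x" by (cases a)
  have "app_mu C (src a) [a, unit_mor C (tgt a)] = Mor S T p (scl C ((-1) ^ p) x)"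
    using mu2_unit_right[OF a] a by (auto simp: ax app_cochain_def is_mor_def less_2_cases_iff)
  then show ?thesis
    using multilin_lin_on[OF G slot_okI(1)[OF f w[unfolded ax]]] slot_okI(2)[OF f w[unfolded ax]]
    by (simp add: ax lin_on_def)
qed

lemma unital_word: "\<lbrakk>unital C G; (a0, \<beta> @ unit_mor C Z # \<gamma>) \<in> words C\<rbrakk> \<Longrightarrow> G (a0, \<beta> @ unit_mor C Z # \<gamma>) = 0"
  by (simp add: unital_def)

text \<open>A unit that stays a later letter is killed by \<open>G\<close>, and one fed into an
  operation survives only in m_2, that is, against its left or right neighbour in the cyclic order.
  The two surviving terms give the same word with opposite signs.\<close>

lemma unital_dual_b:
  assumes G: "multilin C G" and U: "unital C G"
  shows "unital C (dual_b C G)"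
  unfolding unital_def
proof (intro allI impI)
  fix a0 \<beta> Z \<gamma> assume "(a0, \<beta> @ [unit_mor C Z] @ \<gamma>) \<in> words C"
  then have w: "(a0, \<beta> @ unit_mor C Z # \<gamma>) \<in> words C" by simp
  then have w0: "(a0, \<beta> @ \<gamma>) \<in> words C" by (auto simp: words_iff)
  have Z: "Z = endpt (tgt a0) \<beta>" using w by (auto simp: words_iff)
  let ?e = "unit_mor C Z"
  \<comment> \<open>The unit is wrapped together with \<open>a0\<close>. The only survivor is
    m_2(a0, e), where \<open>a0\<close> is the left neighbour because \<beta> is empty.\<close>
  have A1: "sum3 (\<lambda>p q r. (-1) ^ (eps r * (eps q + eps (\<beta> @ ?e # p) + sd a0)) *
        G (app_mu C (endpt (tgt a0) ((\<beta> @ ?e # p) @ q)) (r @ a0 # (\<beta> @ ?e # p)), q)) \<gamma>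
      = (if \<beta> = [] then (-1) ^ par a0 * G (a0, \<gamma>) else 0)" (is "sum3 ?f \<gamma> = _")
  proof -
    have z: "?f p q r = 0" if "p @ q @ r = \<gamma>" "length (r @ a0 # \<beta>) + length p \<noteq> 1" for p q r
      using multilin_app_mu_unit_zero[OF G, of "\<lambda>a. (a, q)" "endpt Z (p @ q)" "r @ a0 # \<beta>" Z p]
        that word_b_first[of a0 "\<beta> @ ?e # p" q r] w by (auto simp: words_iff)
    show ?thesis
    proof (cases "\<beta> = []")
      case False
      have "?f p q r = 0" if "p @ q @ r = \<gamma>" for p q r
        by (rule z[OF that]) (use False in simp)
      then show ?thesis using False by (simp cong: sum3_cong)
    next
      case True
      have "sum3 ?f \<gamma> = (\<Sum>(p, q, r)\<in>{([], \<gamma>, [])}. ?f p q r)"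
      proof (rule sum3_support)
        fix p q r assume a: "p @ q @ r = \<gamma>" "(p, q, r) \<notin> {([], \<gamma>, [])}"
        then have "length (r @ a0 # \<beta>) + length p \<noteq> 1" using True by auto
        then show "?f p q r = 0" by (rule z[OF a(1)])
      qed (simp add: S3_def)
      then show ?thesis
        using multilin_app_mu_unit_right[OF G, of "\<lambda>a. (a, \<gamma>)" a0] w w0 Z True
        by (auto simp: words_iff)
    qed
  qed
  \<comment> \<open>The unit stays behind as a letter of the remaining word.\<close>
  have A2: "sum2 (\<lambda>p q. sum2 (\<lambda>r s. (-1) ^ (eps s * (eps (q @ ?e # r) + eps p + sd a0)) *
        G (app_mu C (endpt (tgt a0) (p @ q @ ?e # r)) (s @ a0 # p), q @ ?e # r)) \<gamma>) \<beta> = 0"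
  proof -
    have "G (app_mu C (endpt (tgt a0) (p @ q @ ?e # r)) (s @ a0 # p), q @ ?e # r) = 0"
      if "p @ q = \<beta>" "r @ s = \<gamma>" for p q r s
      using unital_word[OF U, of _ q Z r] word_b_first[of a0 p "q @ ?e # r" s] w that by force
    then show ?thesis by (simp cong: sum2_cong)
  qed
  \<comment> \<open>Here \<open>a0\<close> is the right neighbour, because \<gamma> is empty, and
    the survivor is m_2(e, a0).\<close>
  have A3: "sum3 (\<lambda>p q r. (-1) ^ (eps (r @ ?e # \<gamma>) * (eps q + eps p + sd a0)) *
        G (app_mu C (endpt (tgt a0) (p @ q)) ((r @ ?e # \<gamma>) @ a0 # p), q)) \<beta>
      = (if \<gamma> = [] then (-1) ^ (eps \<beta> + sd a0) * G (a0, \<beta>) else 0)" (is "sum3 ?f \<beta> = _")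
  proof -
    have z: "?f p q r = 0" if "p @ q @ r = \<beta>" "length r + length (\<gamma> @ a0 # p) \<noteq> 1" for p q r
      using multilin_app_mu_unit_zero[OF G, of "\<lambda>a. (a, q)" "endpt (tgt a0) (p @ q)" r Z "\<gamma> @ a0 # p"]
        that word_b_first[of a0 p q "r @ ?e # \<gamma>"] w by (auto simp: words_iff)
    show ?thesis
    proof (cases "\<gamma> = []")
      case False
      have "?f p q r = 0" if "p @ q @ r = \<beta>" for p q r
        by (rule z[OF that]) (use False in simp)
      then show ?thesis using False by (simp cong: sum3_cong)
    next
      case True
      have "sum3 ?f \<beta> = (\<Sum>(p, q, r)\<in>{([], \<beta>, [])}. ?f p q r)"
      proof (rule sum3_support)
        fix p q r assume a: "p @ q @ r = \<beta>" "(p, q, r) \<notin> {([], \<beta>, [])}"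
        then have "length r + length (\<gamma> @ a0 # p) \<noteq> 1" using True by auto
        then show "?f p q r = 0" by (rule z[OF a(1)])
      qed (simp add: S3_def)
      then show ?thesis
        using app_mu_unit_left[of a0] w w0 Z True by (auto simp: words_iff)
    qed
  qed
  have B1: "sum3 (\<lambda>p q r. (-1) ^ (eps (\<beta> @ ?e # p) + sd a0) *
        G (a0, (\<beta> @ ?e # p) @ app_mu C (endpt (tgt a0) (\<beta> @ ?e # p)) q # r)) \<gamma> = 0"
  proof -
    have "G (a0, \<beta> @ ?e # p @ app_mu C (endpt Z p) q # r) = 0" if "p @ q @ r = \<gamma>" for p q r
      using unital_word[OF U, of a0 \<beta> Z "p @ app_mu C (endpt Z p) q # r"]
        word_b_second[of a0 "\<beta> @ ?e # p" q r] w that by simp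
    then show ?thesis by (simp cong: sum3_cong)
  qed
  have B3: "sum3 (\<lambda>p q r. (-1) ^ (eps p + sd a0) *
        G (a0, p @ app_mu C (endpt (tgt a0) p) q # r @ ?e # \<gamma>)) \<beta> = 0"
  proof -
    have "G (a0, p @ app_mu C (endpt (tgt a0) p) q # r @ ?e # \<gamma>) = 0" if "p @ q @ r = \<beta>" for p q r
      using unital_word[OF U, of a0 "p @ app_mu C (endpt (tgt a0) p) q # r" Z \<gamma>]
        word_b_second[of a0 p q "r @ ?e # \<gamma>"] w that by auto
    then show ?thesis by (simp cong: sum3_cong)
  qed
  \<comment> \<open>The neighbours are the last letter of \<beta> and the first letter of \<gamma>.
    When one side is empty, \<open>A1\<close> or \<open>A3\<close> supplies the corresponding
    product with \<open>a0\<close> instead.\<close>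
  have B2: "sum2 (\<lambda>p q. sum2 (\<lambda>r s. (-1) ^ (eps p + sd a0) *
        G (a0, p @ app_mu C (endpt (tgt a0) p) (q @ ?e # r) # s)) \<gamma>) \<beta>
      = (if \<beta> = [] then 0 else (-1) ^ (eps \<beta> + par a0) * G (a0, \<beta> @ \<gamma>)) +
        (if \<gamma> = [] then 0 else (-1) ^ (eps \<beta> + sd a0) * G (a0, \<beta> @ \<gamma>))"
    (is "sum2 (\<lambda>p q. sum2 (?f p q) \<gamma>) \<beta> = _")
  proof -
    have z: "?f p q r s = 0" if "p @ q = \<beta>" "r @ s = \<gamma>" "length q + length r \<noteq> 1" for p q r s
    proof -
      have w': "(a0, p @ (q @ ?e # r) @ s) \<in> words C" using w that(1,2) by auto
      then have "pth C (endpt (tgt a0) p) (q @ ?e # r)" by (auto simp: words_iff)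
      then show ?thesis
        using multilin_app_mu_unit_zero[OF G, of "\<lambda>a. (a0, p @ a # s)" "endpt (tgt a0) p" q Z r]
          that(3) word_b_second[OF w'] by auto
    qed
    have l: "?f (butlast \<beta>) [last \<beta>] [] \<gamma> = (-1) ^ (eps \<beta> + par a0) * G (a0, \<beta> @ \<gamma>)" if "\<beta> \<noteq> []"
    proof -
      obtain ys y where b: "\<beta> = ys @ [y]" using \<open>\<beta> \<noteq> []\<close> rev_exhaust by blast
      have y: "is_mor C y" "src y = endpt (tgt a0) ys" "tgt y = Z"
        using w unfolding b by (auto simp: words_iff)
      have "G (a0, ys @ app_mu C (endpt (tgt a0) ys) [y, ?e] # \<gamma>) = (-1) ^ par y * G (a0, \<beta> @ \<gamma>)"
        using multilin_app_mu_unit_right[OF G, of "\<lambda>a. (a0, ys @ a # \<gamma>)" y] w0 y unfolding b by simp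
      then show ?thesis by (simp add: b sd_def minus_one_power_iff)
    qed
    have r: "?f \<beta> [] [hd \<gamma>] (tl \<gamma>) = (-1) ^ (eps \<beta> + sd a0) * G (a0, \<beta> @ \<gamma>)" if "\<gamma> \<noteq> []"
    proof -
      obtain y ys where g: "\<gamma> = y # ys" using \<open>\<gamma> \<noteq> []\<close> by (cases \<gamma>) auto
      have y: "is_mor C y" "src y = Z" using w unfolding g by (auto simp: words_iff)
      then have "app_mu C Z [?e, y] = y" using app_mu_unit_left[of y] by simp
      then show ?thesis by (simp add: g Z[symmetric])
    qed
    have "sum2 (\<lambda>p q. sum2 (?f p q) \<gamma>) \<beta> =
        (if \<beta> = [] then 0 else ?f (butlast \<beta>) [last \<beta>] [] \<gamma>) +
        (if \<gamma> = [] then 0 else ?f \<beta> [] [hd \<gamma>] (tl \<gamma>))"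
      by (rule sum2_sum2_support_adjacent) (rule z)
    also have "\<dots> = (if \<beta> = [] then 0 else (-1) ^ (eps \<beta> + par a0) * G (a0, \<beta> @ \<gamma>)) +
        (if \<gamma> = [] then 0 else (-1) ^ (eps \<beta> + sd a0) * G (a0, \<beta> @ \<gamma>))"
      by (intro arg_cong2[where f = "(+)"] if_cong refl l r)
    finally show ?thesis .
  qed
  have "dual_b C G (a0, \<beta> @ [?e] @ \<gamma>) =
      ((if \<beta> = [] then (-1) ^ par a0 * G (a0, \<gamma>) else 0) + 0 +
       (if \<gamma> = [] then (-1) ^ (eps \<beta> + sd a0) * G (a0, \<beta>) else 0)) +
      (0 + ((if \<beta> = [] then 0 else (-1) ^ (eps \<beta> + par a0) * G (a0, \<beta> @ \<gamma>)) +
        (if \<gamma> = [] then 0 else (-1) ^ (eps \<beta> + sd a0) * G (a0, \<beta> @ \<gamma>))) + 0)"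
    unfolding dual_b_def prod.case append_Cons append_Nil sum3_split
    unfolding append_assoc[of _ "_ # _"] append_Cons append_Nil
    using A1 A2 A3 B1 B2 B3 by simp
  \<comment> \<open>In each of the four cases two terms remain, and their signs differ because
    \<open>sd a0 = par a0 + 1\<close>.\<close>
  also have "\<dots> = 0"
    by (cases "\<beta> = []"; cases "\<gamma> = []") (auto simp: sd_def minus_one_power_iff)
  finally show "dual_b C G (a0, \<beta> @ [?e] @ \<gamma>) = 0" .
qed

section \<open>The identity b^2 = 0 for functions of words\<close>

lemma lin_on_sum_scl:
  assumes L: "lin_on C S T p \<Phi>" and mem: "S \<in> obj C" "T \<in> obj C" "p < 2"
    and fin: "finite I" and v: "\<And>i. i \<in> I \<Longrightarrow> v i \<in> mor_space C S T p"
  shows "\<Phi> (\<Sum>i\<in>I. scl C (c i) (v i)) = (\<Sum>i\<in>I. c i * \<Phi> (v i))"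
proof -
  \<comment> \<open>Membership is carried through the induction because \<open>lin_on\<close> gives
    additivity only inside the morphism space.\<close>
  have "(\<Sum>i\<in>I. scl C (c i) (v i)) \<in> mor_space C S T p \<and>
      \<Phi> (\<Sum>i\<in>I. scl C (c i) (v i)) = (\<Sum>i\<in>I. c i * \<Phi> (v i))"
    using fin v
  proof (induction I)
    case empty
    have "\<Phi> (scl C 0 0) = 0 * \<Phi> 0" using L mor_0[OF mem] unfolding lin_on_def by blast
    then show ?case using mor_0[OF mem] by simp
  next
    case (insert i I)
    then have "scl C (c i) (v i) \<in> mor_space C S T p" "\<Phi> (scl C (c i) (v i)) = c i * \<Phi> (v i)"
      using mor_scl[OF mem] L by (auto simp: lin_on_def)
    then show ?case using insert L mor_add[OF mem] by (auto simp: lin_on_def)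
  qed
  then show ?thesis by simp
qed

text \<open>All composites of two operations on \<open>L\<close> share source, target and parity, so
  the whole A-infinity relation can be inserted into one slot of \<open>G\<close>.\<close>

lemma ainf_relation_slot:
  assumes G: "multilin C G" and ok: "slot_ok C f Z (endpt Z L) ((eps L + 1) mod 2)" and L: "pth C Z L"
  shows "sum3 (\<lambda>l1 l2 l3. (-1) ^ eps l1 *
     G (f (app_mu C Z (l1 @ [app_mu C (endpt Z l1) l2] @ l3)))) L = 0"
proof -
  let ?E = "endpt Z L" and ?q = "(eps L + 1) mod 2"
  define v where "v = (\<lambda>(l1, l2, l3). mu C Z (l1 @ [app_mu C (endpt Z l1) l2] @ l3))"
  have app: "app_mu C Z (l1 @ [app_mu C (endpt Z l1) l2] @ l3) = Mor Z ?E ?q (v (l1, l2, l3))"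
    and vm: "v (l1, l2, l3) \<in> mor_space C Z ?E ?q" if l: "l1 @ l2 @ l3 = L" for l1 l2 l3
  proof -
    \<comment> \<open>Two operations raise the shifted degree by 2 in all; undoing the shift leaves
      the parity of \<open>eps L + 1\<close>.\<close>
    have "(1 + 1 + (eps l1 + (sd (app_mu C (endpt Z l1) l2) + eps l3))) mod 2 = ?q"
      unfolding sd_def app_cochain_simps l[symmetric] eps_append by (simp add: mod2_eq_if)
    then show a: "app_mu C Z (l1 @ [app_mu C (endpt Z l1) l2] @ l3) = Mor Z ?E ?q (v (l1, l2, l3))"
      using l by (auto simp: app_cochain_def[of _ _ Z] v_def)
    have "is_mor C (app_mu C Z (l1 @ [app_mu C (endpt Z l1) l2] @ l3))"
      by (rule is_mor_app_mu) (use L l in auto)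
    then show "v (l1, l2, l3) \<in> mor_space C Z ?E ?q" unfolding a by (simp add: is_mor_def)
  qed
  have mem: "Z \<in> obj C" "?E \<in> obj C" "?q < 2" using ok by (auto simp: slot_ok_def)
  have "sum3 (\<lambda>l1 l2 l3. (-1) ^ eps l1 *
     G (f (app_mu C Z (l1 @ [app_mu C (endpt Z l1) l2] @ l3)))) L
     = (\<Sum>l\<in>S3 L. (-1) ^ eps (fst l) * G (f (Mor Z ?E ?q (v l))))"
    unfolding sum_S3[symmetric] by (rule sum.cong) (auto simp: S3_def app simp del: append_Cons append_Nil)
  also have "\<dots> = G (f (Mor Z ?E ?q (\<Sum>l\<in>S3 L. scl C ((-1) ^ eps (fst l)) (v l))))"
    by (subst lin_on_sum_scl[OF multilin_lin_on[OF G ok] mem finite_S3, symmetric])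
      (use vm in \<open>auto simp: S3_def\<close>)
  also have "(\<Sum>l\<in>S3 L. scl C ((-1) ^ eps (fst l)) (v l)) = 0"
    using ainf_relation[of Z L ?E] L by (simp add: is_path_iff case_prod_unfold v_def)
  also have "G (f (Mor Z ?E ?q 0)) = 0"
    by (rule multilin_0[OF G]) (use ok mor_0[OF mem] in \<open>auto simp: slot_ok_def\<close>)
  finally show ?thesis .
qed

lemma slot_ok_first: "\<lbrakk>(a0, q @ c @ p) \<in> words C; k < 2\<rbrakk> \<Longrightarrow>
    slot_ok C (\<lambda>m. (m, c)) (endpt (tgt a0) (q @ c)) (endpt (tgt a0) q) k"
  using pth_obj[of C "endpt (tgt a0) q" c] pth_obj[of C "tgt a0" q] by (auto simp: slot_ok_def words_iff is_mor_Mor)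

lemma slot_ok_inner: "\<lbrakk>(a0, p @ c @ s) \<in> words C; k < 2\<rbrakk> \<Longrightarrow>
    slot_ok C (\<lambda>m. (a0, p @ m # s)) (endpt (tgt a0) p) (endpt (tgt a0) (p @ c)) k"
  using pth_obj[of C "endpt (tgt a0) p" c] pth_obj[of C "tgt a0" p] by (auto simp: slot_ok_def words_iff is_mor_Mor)

text \<open>Composites whose two operations act on disjoint pieces cancel in pairs. The nested ones
  form A-infinity relations, either for the sequence wrapped around \<open>a0\<close> or for an
  inner piece.\<close>

lemma dual_b_dual_b:
  assumes G: "multilin C G" and w: "(a0, as) \<in> words C"
  shows "dual_b C (dual_b C G) (a0, as) = 0"
proof -
  let ?m = "app_mu C" and ?X = "tgt a0"
  have 1: "sum3 (\<lambda>q c p. (-1) ^ (eps p * (eps c + eps q + sd a0)) *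
      sum3 (\<lambda>l1 l2 l3. (-1) ^ eps l1 *
        G (?m (endpt ?X (q @ c)) (l1 @ [?m (endpt (endpt ?X (q @ c)) l1) l2] @ l3), c)) (p @ a0 # q)) as = 0"
  proof -
    have "sum3 (\<lambda>l1 l2 l3. (-1) ^ eps l1 *
        G (?m (endpt ?X (q @ c)) (l1 @ [?m (endpt (endpt ?X (q @ c)) l1) l2] @ l3), c)) (p @ a0 # q) = 0"
      if "q @ c @ p = as" for q c p
    proof (rule ainf_relation_slot[OF G, where f = "\<lambda>m. (m, c)"])
      have w': "(a0, q @ c @ p) \<in> words C" using w that by simp
      show "slot_ok C (\<lambda>m. (m, c)) (endpt ?X (q @ c)) (endpt (endpt ?X (q @ c)) (p @ a0 # q))
          ((eps (p @ a0 # q) + 1) mod 2)"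
        using slot_ok_first[OF w'] by simp
      show "pth C (endpt ?X (q @ c)) (p @ a0 # q)" using w' by (auto simp: words_iff)
    qed
    then show ?thesis by (simp cong: sum3_cong)
  qed
  have 2: "sum3 (\<lambda>p M s. sum3 (\<lambda>q b r. (-1) ^ eps q *
        G (a0, p @ [?m (endpt ?X p) (q @ [?m (endpt (endpt ?X p) q) b] @ r)] @ s)) M) as = 0"
  proof -
    have "sum3 (\<lambda>q b r. (-1) ^ eps q *
        G (a0, p @ [?m (endpt ?X p) (q @ [?m (endpt (endpt ?X p) q) b] @ r)] @ s)) M = 0"
      if "p @ M @ s = as" for p M s
    proof (rule ainf_relation_slot[OF G, where f = "\<lambda>m. (a0, p @ [m] @ s)"])
      have w': "(a0, p @ M @ s) \<in> words C" using w that by simp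
      show "slot_ok C (\<lambda>m. (a0, p @ [m] @ s)) (endpt ?X p) (endpt (endpt ?X p) M) ((eps M + 1) mod 2)"
        using slot_ok_inner[OF w'] by simp
      show "pth C (endpt ?X p) M" using w' by (auto simp: words_iff)
    qed
    then show ?thesis by (simp cong: sum3_cong)
  qed
  have "dual_b C (dual_b C G) (a0, as) =
     sum3 (\<lambda>q c p. (-1) ^ (eps p * (eps c + eps q + sd a0)) *
      sum3 (\<lambda>l1 l2 l3. (-1) ^ eps l1 *
        G (?m (endpt ?X (q @ c)) (l1 @ [?m (endpt (endpt ?X (q @ c)) l1) l2] @ l3), c)) (p @ a0 # q)) as +
     sum3 (\<lambda>p M s. sum3 (\<lambda>q b r. (-1) ^ eps q *
        G (a0, p @ [?m (endpt ?X p) (q @ [?m (endpt (endpt ?X p) q) b] @ r)] @ s)) M) as"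
  \<comment> \<open>After flattening, every term is indexed by the same five pieces. The identity
    then holds for each decomposition separately, and the signs depend only on the parities of the
    shifted degrees of the pieces and of \<open>a0\<close>.\<close>
  proof (simp only: dual_b_def prod.case append_Cons append_Nil sum3_split distrib_left
      sum3_mult[symmetric] sum2_mult[symmetric] sum3_add sum2_add sum3_mid sum3_left sum3_right
      sum3_outer sum3_outer_swap sum5_add[symmetric], rule sum5_cong[OF refl], goal_cases)
    case (1 p q r s t)
    show ?case
      by (simp only: append_assoc append_Cons append_Nil eps_append eps_Cons endpt_append endpt.simps
          app_cochain_simps mult.assoc[symmetric] power_add[symmetric],
        cases "even (eps p)"; cases "even (eps q)"; cases "even (eps r)"; cases "even (eps s)";
        cases "even (eps t)"; cases "even (sd a0)"; simp add: minus_one_power_iff del: app_cochain_simps)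
  qed
  then show ?thesis using 1 2 by simp
qed

section \<open>The identity bB + Bb = 0 for functions of words\<close>

lemma dual_b_unit_first:
  assumes G: "multilin C G" and w: "(unit_mor C Z, L) \<in> words C" and L: "L \<noteq> []"
  shows "dual_b C G (unit_mor C Z, L) =
    G (hd L, tl L) + - ((-1) ^ (sd (last L) * eps (butlast L)) * G (last L, butlast L)) +
    - sum3 (\<lambda>l1 l2 l3. (-1) ^ eps l1 * G (unit_mor C Z, l1 @ [app_mu C (endpt Z l1) l2] @ l3)) L"
proof -
  let ?e = "unit_mor C Z"
  let ?f = "\<lambda>a1 a2 a3. (-1) ^ (eps a3 * (eps a2 + eps a1 + sd ?e)) *
        G (app_mu C (endpt (tgt ?e) (a1 @ a2)) (a3 @ [?e] @ a1), a2)"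
  obtain y ys where y: "L = y # ys" using L by (cases L) auto
  obtain zs z where z: "L = zs @ [z]" using L rev_exhaust by blast
  have Z: "Z \<in> obj C" "endpt Z L = Z" "pth C Z L" using w by (auto simp: words_iff)
  have zero: "?f p q r = 0" if "p @ q @ r = L" "length r + length p \<noteq> 1" for p q r
  proof -
    have w': "(?e, p @ q @ r) \<in> words C" using w that by simp
    then have "pth C (endpt Z (p @ q)) (r @ ?e # p)" by (auto simp: words_iff)
    then show ?thesis
      using multilin_app_mu_unit_zero[OF G, of "\<lambda>a. (a, q)" "endpt Z (p @ q)" r Z p]
        that(2) word_b_first[OF w'] by auto
  qed
  \<comment> \<open>The unit in front has to meet exactly one other entry: the first letter of
    \<open>L\<close> on its right or the last letter on its left.\<close>
  have "sum3 ?f L = (\<Sum>(p, q, r)\<in>{([y], ys, []), ([], zs, [z])}. ?f p q r)"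
  proof (rule sum3_support)
    fix p q r assume a: "p @ q @ r = L" "(p, q, r) \<notin> {([y], ys, []), ([], zs, [z])}"
    have "length r + length p \<noteq> 1"
    proof
      assume "length r + length p = 1"
      then consider "r = []" "length p = 1" | "p = []" "length r = 1" by (cases r) auto
      then show False
      proof cases
        case 1
        then show ?thesis using a y by (cases p) auto
      next
        case 2
        then show ?thesis using a z by (cases r) auto
      qed
    qed
    then show "?f p q r = 0" by (rule zero[OF a(1)])
  next
    show "{([y], ys, []), ([], zs, [z])} \<subseteq> S3 L"
      unfolding S3_def using y[symmetric] z[symmetric] by simp
  qed
  also have "\<dots> = ?f [y] ys [] + ?f [] zs [z]" by simp
  also have "?f [y] ys [] = G (hd L, tl L)"
  proof -
    have "is_mor C y" "src y = Z" using Z(3) by (auto simp: y)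
    moreover have "endpt (tgt y) ys = Z" using Z(2) by (simp add: y)
    ultimately show ?thesis using app_mu_unit_left[of y] by (simp add: y)
  qed
  also have "?f [] zs [z] = - ((-1) ^ (sd (last L) * eps (butlast L)) * G (last L, butlast L))"
  proof -
    have m: "is_mor C z" "tgt z = Z" "endpt Z zs = src z" using Z(2,3) by (auto simp: z)
    moreover have "(z, zs) \<in> words C" using w m by (auto simp: z words_iff)
    ultimately show ?thesis using multilin_app_mu_unit_right[OF G, of "\<lambda>a. (a, zs)" z]
      by (simp add: z minus_one_power_iff sd_def)
  qed
  finally have 1: "sum3 ?f L = G (hd L, tl L) +
      - ((-1) ^ (sd (last L) * eps (butlast L)) * G (last L, butlast L))" .
  \<comment> \<open>The inner sum acquires a minus sign because the shifted degree of the unit is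
    1.\<close>
  show ?thesis
    unfolding dual_b_def prod.case 1
    using sum3_mult[of "-1" "\<lambda>l1 l2 l3. (-1) ^ eps l1 *
      G (unit_mor C Z, l1 @ [app_mu C (endpt Z l1) l2] @ l3)" L]
    by (simp add: power_add)
qed

text \<open>By \<open>dual_b_unit_first\<close>, b after B yields two families of words in which the
  new unit has been absorbed and one in which it survives. The first two cancel as families of
  cyclic rotations; the third is the negative of B after b.\<close>

lemma dual_B_dual_b:
  assumes G: "multilin C G" and w: "(a0, as) \<in> words C"
  shows "dual_B C (dual_b C G) (a0, as) + dual_b C (dual_B C G) (a0, as) = 0"
proof -
  let ?R = "\<lambda>a1 a2. (-1) ^ (eps a2 * (sd a0 + eps a1)) :: complex"
  let ?f = "\<lambda>a1 a2. ?R a1 a2 * G (hd (a2 @ a0 # a1), tl (a2 @ a0 # a1))"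
  let ?g = "\<lambda>a1 a2. ?R a1 a2 * ((-1) ^ (sd (last (a2 @ a0 # a1)) * eps (butlast (a2 @ a0 # a1))) *
    G (last (a2 @ a0 # a1), butlast (a2 @ a0 # a1)))"
  let ?h = "\<lambda>a1 a2. ?R a1 a2 * sum3 (\<lambda>l1 l2 l3. (-1) ^ eps l1 *
    G (unit_mor C (endpt (tgt a0) a1), l1 @ [app_mu C (endpt (endpt (tgt a0) a1) l1) l2] @ l3)) (a2 @ a0 # a1)"
  \<comment> \<open>A rotation read from its first letter agrees with the rotation one step further
    read from its last letter.\<close>
  have a: "sum2 ?f as + ?g [] as = sum2 ?g as + ?f as []"
  proof (rule sum2_shift)
    fix p y q assume "p @ y # q = as"
    show "?f p (y # q) = ?g (p @ [y]) q"
      by (simp add: butlast_append minus_one_power_iff)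
  qed
  \<comment> \<open>Both unpaired ends are the original word, with coefficient 1.\<close>
  have b: "?g [] as = ?f as []"
    by (simp add: butlast_append minus_one_power_iff)
  have fg: "sum2 ?f as = sum2 ?g as" by (rule add_right_imp_eq[OF a[unfolded b]])
  have "dual_B C (dual_b C G) (a0, as) = sum2 (\<lambda>a1 a2. ?f a1 a2 + - 1 * ?g a1 a2 + - 1 * ?h a1 a2) as"
    unfolding dual_B_def prod.case
  proof (rule sum2_cong[OF refl])
    fix a1 a2 assume as: "a1 @ a2 = as"
    have "(unit_mor C (endpt (tgt a0) a1), a2 @ a0 # a1) \<in> words C"
      using word_B[of a0 a1 a2] w as by simp
    from dual_b_unit_first[OF G this]
    have e: "dual_b C G (unit_mor C (endpt (tgt a0) a1), a2 @ a0 # a1) =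
      G (hd (a2 @ a0 # a1), tl (a2 @ a0 # a1)) +
      - ((-1) ^ (sd (last (a2 @ a0 # a1)) * eps (butlast (a2 @ a0 # a1))) *
        G (last (a2 @ a0 # a1), butlast (a2 @ a0 # a1))) +
      - sum3 (\<lambda>l1 l2 l3. (-1) ^ eps l1 * G (unit_mor C (endpt (tgt a0) a1),
          l1 @ [app_mu C (endpt (endpt (tgt a0) a1) l1) l2] @ l3)) (a2 @ a0 # a1)"
      by blast
    show "?R a1 a2 * dual_b C G (unit_mor C (endpt (tgt a0) a1), a2 @ [a0] @ a1) =
        ?f a1 a2 + - 1 * ?g a1 a2 + - 1 * ?h a1 a2"
      by (simp only: append_Cons append_Nil e) (simp only: distrib_left mult_minus_right mult_minus1)
  qed
  also have "\<dots> = - sum2 ?h as"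
    unfolding sum2_add sum2_mult fg by simp
  finally have 1: "dual_B C (dual_b C G) (a0, as) = - sum2 ?h as" .
  \<comment> \<open>Every operation in b, wrapping or inner, becomes an inner one once B has moved
    the word behind the unit; four pieces index all the terms.\<close>
  have "dual_b C (dual_B C G) (a0, as) = sum2 ?h as"
  proof (simp only: dual_b_def dual_B_def prod.case append_Cons append_Nil sum3_split sum2_split
      distrib_left sum3_mult[symmetric] sum2_mult[symmetric] sum3_add sum2_add sum3_sum2_left
      sum3_sum2_mid sum3_sum2_right sum2_sum3_left sum2_sum3_right sum2_sum2_sum2 sum4_add[symmetric],
      rule sum4_cong[OF refl], goal_cases)
    case (1 p q r s)
    show ?case
      by (cases "even (eps p)"; cases "even (eps q)"; cases "even (eps r)"; cases "even (eps s)";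
          cases "even (sd a0)"; simp add: minus_one_power_iff del: app_cochain_simps(4))
  qed
  then show ?thesis using 1 by simp
qed

end

section \<open>The reduced complex\<close>

lemma functional_coeff:
  assumes "functional H"
  shows "H x = (\<Sum>z\<in>Poly_Mapping.keys x. Poly_Mapping.lookup x z * coeff_fun H z)"
  by (subst poly_mapping_sum_single) (simp add: functional_sum[OF assms] functional_single'[OF assms] del: cscale_single,
    simp add: functional_cscale[OF assms] coeff_fun_def del: cscale_single)

lemma functional_hoch_b: "functional F \<Longrightarrow> functional (\<lambda>x. F (hoch_b C x))"
  and functional_connes_B: "functional F \<Longrightarrow> functional (\<lambda>x. F (connes_B C x))"
  unfolding hoch_b_def connes_B_def by (rule functional_comp_extend, assumption)+

text \<open>The functionals on the reduced complex, described through their values on words.\<close>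

definition rel_functional :: "('o, 'm::ab_group_add) ainf_cat \<Rightarrow> (('o, 'm) chain \<Rightarrow> complex) \<Rightarrow> bool" where
  "rel_functional C F \<longleftrightarrow> functional F \<and> multilin C (coeff_fun F) \<and> unital C (coeff_fun F)"

lemma subspace_chains: "cs.subspace (chains C)"
proof -
  have "Poly_Mapping.keys (x + y) \<subseteq> words C"
    if "Poly_Mapping.keys x \<subseteq> words C" "Poly_Mapping.keys y \<subseteq> words C" for x y :: "('a, 'b) chain"
    using that Poly_Mapping.keys_add[of x y] by blast
  moreover have "Poly_Mapping.keys (cscale c x) \<subseteq> words C"
    if "Poly_Mapping.keys x \<subseteq> words C" for c and x :: "('a, 'b) chain"
    using that by (auto simp: in_keys_iff)
  ultimately show ?thesis by (simp add: cs.subspace_def chains_def)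
qed

lemma single_in_chains: "z \<in> words C \<Longrightarrow> Poly_Mapping.single z c \<in> chains C"
  by (auto simp: chains_def split: if_splits)

lemma extend_chains:
  assumes "\<And>z. z \<in> words C \<Longrightarrow> f z \<in> chains C" and "x \<in> chains C"
  shows "extend f x \<in> chains C"
  unfolding extend_def
  by (intro cs.subspace_sum subspace_chains cs.subspace_scale assms(1)) (use assms(2) in \<open>auto simp: chains_def\<close>)

lemma subspace_chain_relations: "cs.subspace (chain_relations C)"
  by (simp add: chain_relations_def)

context weakly_curved_ainf_cat
begin

lemma rel_functional_iff:
  "rel_functional C F \<longleftrightarrow> functional F \<and> (\<forall>r\<in>tensor_relations C \<union> unit_relations C. F r = 0)"
proof (cases "functional F")
  case F: True
  have "multilin C (coeff_fun F) \<longleftrightarrow> (\<forall>r\<in>tensor_relations C. F r = 0)"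
  proof
    assume G: "multilin C (coeff_fun F)"
    show "\<forall>r\<in>tensor_relations C. F r = 0"
    proof
      fix r assume "r \<in> tensor_relations C"
      then consider (add) f S T p x y where
          "r = Poly_Mapping.single (f (Mor S T p (x + y))) 1
            - Poly_Mapping.single (f (Mor S T p x)) 1 - Poly_Mapping.single (f (Mor S T p y)) 1"
          "f \<in> word_slots" "f (Mor S T p x) \<in> words C" "f (Mor S T p y) \<in> words C"
        | (scale) f S T p x a where
          "r = Poly_Mapping.single (f (Mor S T p (scl C a x))) 1 - Poly_Mapping.single (f (Mor S T p x)) a"
          "f \<in> word_slots" "f (Mor S T p x) \<in> words C"
        unfolding tensor_relations_def by blast
      then show "F r = 0"
      proof cases
        case add
        then show ?thesis
          using multilin_lin_on[OF G slot_okI(1)[OF add(2,3)]] slot_okI(2)[OF add(2,3)] slot_okI(2)[OF add(2,4)]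
          by (simp add: functional_diff[OF F] functional_single'[OF F] lin_on_def)
      next
        case scale
        then show ?thesis
          using multilin_lin_on[OF G slot_okI(1)[OF scale(2,3)]] slot_okI(2)[OF scale(2,3)]
          by (simp add: functional_diff[OF F] functional_single'[OF F] lin_on_def)
      qed
    qed
  next
    assume R: "\<forall>r\<in>tensor_relations C. F r = 0"
    show "multilin C (coeff_fun F)"
      unfolding multilin_def
    proof (intro allI impI lin_onI)
      fix f S T p x y assume ok: "slot_ok C f S T p" and xy: "x \<in> mor_space C S T p" "y \<in> mor_space C S T p"
      then have "Poly_Mapping.single (f (Mor S T p (x + y))) 1
            - Poly_Mapping.single (f (Mor S T p x)) 1 - Poly_Mapping.single (f (Mor S T p y)) 1
          \<in> tensor_relations C"
        unfolding tensor_relations_def slot_ok_def by blast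
      with R have "F (Poly_Mapping.single (f (Mor S T p (x + y))) 1
            - Poly_Mapping.single (f (Mor S T p x)) 1 - Poly_Mapping.single (f (Mor S T p y)) 1) = 0" by blast
      then show "coeff_fun F (f (Mor S T p (x + y))) = coeff_fun F (f (Mor S T p x)) + coeff_fun F (f (Mor S T p y))"
        by (simp add: functional_diff[OF F] functional_single'[OF F] diff_eq_eq add.commute)
    next
      fix f S T p x a assume ok: "slot_ok C f S T p" and xy: "x \<in> mor_space C S T p"
      then have "Poly_Mapping.single (f (Mor S T p (scl C a x))) 1 - Poly_Mapping.single (f (Mor S T p x)) a
          \<in> tensor_relations C"
        unfolding tensor_relations_def slot_ok_def by blast
      with R have "F (Poly_Mapping.single (f (Mor S T p (scl C a x))) 1 - Poly_Mapping.single (f (Mor S T p x)) a) = 0"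
        by blast
      then show "coeff_fun F (f (Mor S T p (scl C a x))) = a * coeff_fun F (f (Mor S T p x))"
        by (simp add: functional_diff[OF F] functional_single'[OF F])
    qed
  qed
  moreover have "unital C (coeff_fun F) \<longleftrightarrow> (\<forall>r\<in>unit_relations C. F r = 0)"
    unfolding unital_def unit_relations_def coeff_fun_def by blast
  ultimately show ?thesis using F by (auto simp: rel_functional_def)
qed (simp add: rel_functional_def)

lemma rel_functional_zero: "\<lbrakk>rel_functional C F; x \<in> chain_relations C\<rbrakk> \<Longrightarrow> F x = 0"
  unfolding rel_functional_iff chain_relations_def by (blast intro: functional_span_0)

lemma in_chain_relationsI: "(\<And>F. rel_functional C F \<Longrightarrow> F x = 0) \<Longrightarrow> x \<in> chain_relations C"
  unfolding rel_functional_iff chain_relations_def by (rule in_span_if_functionals_vanish) blast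

section \<open>The operators b and B on reduced chains\<close>

lemma rel_functional_b: "rel_functional C F \<Longrightarrow> rel_functional C (\<lambda>x. F (hoch_b C x))"
  using coeff_fun_hoch_b[of F C] functional_hoch_b[of F C] multilin_dual_b[of "coeff_fun F"] unital_dual_b[of "coeff_fun F"]
  unfolding rel_functional_def by simp

lemma rel_functional_B: "rel_functional C F \<Longrightarrow> rel_functional C (\<lambda>x. F (connes_B C x))"
  using coeff_fun_connes_B[of F C] functional_connes_B[of F C] multilin_dual_B[of "coeff_fun F"] unital_dual_B[of "coeff_fun F"]
  unfolding rel_functional_def by simp

text \<open>Composition with b preserves the functionals that vanish on relations, so b maps
  relations into the common kernel of these functionals, which is the span of the relations.\<close>

lemma hoch_b_relations: "r \<in> chain_relations C \<Longrightarrow> hoch_b C r \<in> chain_relations C"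
  by (rule in_chain_relationsI) (rule rel_functional_zero[OF rel_functional_b])

lemma connes_B_relations: "r \<in> chain_relations C \<Longrightarrow> connes_B C r \<in> chain_relations C"
  by (rule in_chain_relationsI) (rule rel_functional_zero[OF rel_functional_B])

lemma hoch_b_chains: "x \<in> chains C \<Longrightarrow> hoch_b C x \<in> chains C"
  unfolding hoch_b_def
proof (rule extend_chains)
  fix z assume "z \<in> words C"
  then obtain a0 as where z: "z = (a0, as)" and w: "(a0, as) \<in> words C" by (cases z) auto
  show "(case z of (a0, as) \<Rightarrow>
      (\<Sum>(a1, a2, a3) \<in> S3 as. Poly_Mapping.single
          (app_mu C (endpt (tgt a0) (a1 @ a2)) (a3 @ [a0] @ a1), a2)
          ((-1) ^ (eps a3 * (eps a2 + eps a1 + sd a0)))) +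
      (\<Sum>(a1, a2, a3) \<in> S3 as. Poly_Mapping.single
          (a0, a1 @ [app_mu C (endpt (tgt a0) a1) a2] @ a3)
          ((-1) ^ (eps a1 + sd a0)))) \<in> chains C"
    unfolding z prod.case case_prod_unfold
    by (intro cs.subspace_add cs.subspace_sum subspace_chains single_in_chains word_b_first word_b_second)
      (use w in \<open>auto simp: S3_def\<close>)
qed

lemma connes_B_chains: "x \<in> chains C \<Longrightarrow> connes_B C x \<in> chains C"
  unfolding connes_B_def
proof (rule extend_chains)
  fix z assume "z \<in> words C"
  then obtain a0 as where z: "z = (a0, as)" and w: "(a0, as) \<in> words C" by (cases z) auto
  show "(case z of (a0, as) \<Rightarrow> (\<Sum>(a1, a2) \<in> S2 as. Poly_Mapping.single
          (unit_mor C (endpt (tgt a0) a1), a2 @ [a0] @ a1)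
          ((-1) ^ (eps a2 * (sd a0 + eps a1))))) \<in> chains C"
    unfolding z prod.case case_prod_unfold
    by (intro cs.subspace_sum subspace_chains single_in_chains word_B) (use w in \<open>auto simp: S2_def\<close>)
qed

lemma chain_functional_zero:
  assumes "functional H" and "\<And>a0 as. (a0, as) \<in> words C \<Longrightarrow> coeff_fun H (a0, as) = 0" and "x \<in> chains C"
  shows "H x = 0"
  by (subst functional_coeff[OF assms(1)], rule sum.neutral) (use assms(2,3) in \<open>auto simp: chains_def\<close>)

lemma hoch_b_hoch_b: "x \<in> chains C \<Longrightarrow> hoch_b C (hoch_b C x) \<in> chain_relations C"
proof (rule in_chain_relationsI)
  fix F assume x: "x \<in> chains C" and R: "rel_functional C F"
  then have F: "functional F" "multilin C (coeff_fun F)" by (auto simp: rel_functional_def)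
  show "F (hoch_b C (hoch_b C x)) = 0"
    by (rule chain_functional_zero[OF functional_hoch_b[OF functional_hoch_b[OF F(1)]] _ x])
      (simp add: coeff_fun_hoch_b[OF functional_hoch_b[OF F(1)]] coeff_fun_hoch_b[OF F(1)] F(2) dual_b_dual_b)
qed

lemma connes_B_connes_B: "x \<in> chains C \<Longrightarrow> connes_B C (connes_B C x) \<in> chain_relations C"
proof (rule in_chain_relationsI)
  fix F assume x: "x \<in> chains C" and R: "rel_functional C F"
  then have F: "functional F" "unital C (coeff_fun F)" by (auto simp: rel_functional_def)
  show "F (connes_B C (connes_B C x)) = 0"
    by (rule chain_functional_zero[OF functional_connes_B[OF functional_connes_B[OF F(1)]] _ x])
      (simp add: coeff_fun_connes_B[OF functional_connes_B[OF F(1)]] coeff_fun_connes_B[OF F(1)] F(2) dual_B_dual_B)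
qed

lemma hoch_b_connes_B:
  "x \<in> chains C \<Longrightarrow> hoch_b C (connes_B C x) + connes_B C (hoch_b C x) \<in> chain_relations C"
proof (rule in_chain_relationsI)
  fix F assume x: "x \<in> chains C" and R: "rel_functional C F"
  then have F: "functional F" "multilin C (coeff_fun F)" by (auto simp: rel_functional_def)
  let ?H = "\<lambda>x. F (hoch_b C (connes_B C x)) + F (connes_B C (hoch_b C x))"
  have 1: "functional (\<lambda>x. F (hoch_b C (connes_B C x)))" "functional (\<lambda>x. F (connes_B C (hoch_b C x)))"
    by (rule functional_connes_B[OF functional_hoch_b[OF F(1)]] functional_hoch_b[OF functional_connes_B[OF F(1)]])+
  then have H: "functional ?H" by (simp add: functional_def algebra_simps)
  have "coeff_fun ?H z = dual_B C (dual_b C (coeff_fun F)) z + dual_b C (dual_B C (coeff_fun F)) z" for z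
  proof -
    have "coeff_fun ?H z = coeff_fun (\<lambda>x. F (hoch_b C (connes_B C x))) z + coeff_fun (\<lambda>x. F (connes_B C (hoch_b C x))) z"
      by (simp add: coeff_fun_def)
    then show ?thesis
      using coeff_fun_connes_B[OF functional_hoch_b[OF F(1)]] coeff_fun_hoch_b[OF functional_connes_B[OF F(1)]]
      by (simp add: coeff_fun_hoch_b[OF F(1)] coeff_fun_connes_B[OF F(1)])
  qed
  then have "?H x = 0"
    by (intro chain_functional_zero[OF H _ x]) (simp add: dual_B_dual_b F(2))
  then show "F (hoch_b C (connes_B C x) + connes_B C (hoch_b C x)) = 0"
    by (simp add: functional_add[OF F(1)])
qed

lemma chain_relations_subset: "chain_relations C \<subseteq> chains C"
  unfolding chain_relations_def
proof (rule cs.span_minimal[OF _ subspace_chains])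
  have mem: "f (Mor S T p (x + y)) \<in> words C" "f (Mor S T p (scl C a x)) \<in> words C"
    if "f \<in> word_slots" "f (Mor S T p x) \<in> words C" "f (Mor S T p y) \<in> words C" for f S T p x y a
    using slot_okI[OF that(1,2)] slot_okI(2)[OF that(1,3)] mor_add[of S T p x y] mor_scl[of S T p x a]
    unfolding slot_ok_def by blast+
  note diff = cs.subspace_diff[OF subspace_chains]
  have "tensor_relations C \<subseteq> chains C"
  proof
    fix r assume "r \<in> tensor_relations C"
    then consider (add) f S T p x y where
        "r = Poly_Mapping.single (f (Mor S T p (x + y))) 1
          - Poly_Mapping.single (f (Mor S T p x)) 1 - Poly_Mapping.single (f (Mor S T p y)) 1"
        "f \<in> word_slots" "f (Mor S T p x) \<in> words C" "f (Mor S T p y) \<in> words C"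
      | (scale) f S T p x a where
        "r = Poly_Mapping.single (f (Mor S T p (scl C a x))) 1 - Poly_Mapping.single (f (Mor S T p x)) a"
        "f \<in> word_slots" "f (Mor S T p x) \<in> words C"
      unfolding tensor_relations_def by blast
    then show "r \<in> chains C"
    proof cases
      case add
      show ?thesis unfolding add(1)
        by (intro diff single_in_chains mem(1)[OF add(2-4)] add(3,4))
    next
      case scale
      show ?thesis unfolding scale(1)
        by (intro diff single_in_chains mem(2)[OF scale(2,3,3)] scale(3))
    qed
  qed
  moreover have "unit_relations C \<subseteq> chains C"
    unfolding unit_relations_def by (auto intro!: single_in_chains)
  ultimately show "tensor_relations C \<union> unit_relations C \<subseteq> chains C" by blast
qed

section \<open>The differential b + uB, its cycles and its boundaries\<close>

lemma fps_nth_cyc_d: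
  "fps_nth (cyc_d C x) n = hoch_b C (fps_nth x n) + (if n = 0 then 0 else connes_B C (fps_nth x (n - 1)))"
  by (simp add: cyc_d_def fps_nth_u_times)

lemma hoch_b_add: "hoch_b C (x + y) = hoch_b C x + hoch_b C y"
  and connes_B_add: "connes_B C (x + y) = connes_B C x + connes_B C y"
  and hoch_b_cscale: "hoch_b C (cscale c x) = cscale c (hoch_b C x)"
  and connes_B_cscale: "connes_B C (cscale c x) = cscale c (connes_B C x)"
  by (simp_all add: hoch_b_def connes_B_def extend_add extend_cscale)

lemma hoch_b_0 [simp]: "hoch_b C 0 = 0" and connes_B_0 [simp]: "connes_B C 0 = 0"
  using hoch_b_cscale[of 0 0] connes_B_cscale[of 0 0] by simp_all

lemma cyc_d_add: "cyc_d C (x + y) = cyc_d C x + cyc_d C y"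
  by (rule fps_ext) (simp add: fps_nth_cyc_d hoch_b_add connes_B_add)

lemma cyc_d_scale: "cyc_d C (fps_map (cscale c) x) = fps_map (cscale c) (cyc_d C x)"
  by (rule fps_ext) (simp add: fps_nth_cyc_d hoch_b_cscale connes_B_cscale cs.scale_right_distrib)

lemma cyc_d_u_times: "cyc_d C (u_times x) = u_times (cyc_d C x)"
  by (rule fps_ext) (auto simp: fps_nth_cyc_d fps_nth_u_times)

lemmas chain_rules = cs.subspace_add[OF subspace_chains] cs.subspace_scale[OF subspace_chains]
  cs.subspace_0[OF subspace_chains]
lemmas relation_rules = cs.subspace_add[OF subspace_chain_relations]
  cs.subspace_scale[OF subspace_chain_relations] cs.subspace_0[OF subspace_chain_relations]

lemma all_fps_nth_u_times:
  assumes "0 \<in> A"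
  shows "(\<forall>n. fps_nth (u_times x) n \<in> A) \<longleftrightarrow> (\<forall>n. fps_nth x n \<in> A)"
proof
  assume a: "\<forall>n. fps_nth (u_times x) n \<in> A"
  show "\<forall>n. fps_nth x n \<in> A"
  proof
    fix n show "fps_nth x n \<in> A" using a[rule_format, of "Suc n"] by simp
  qed
qed (use assms in \<open>auto simp: fps_nth_u_times\<close>)

lemma relations_u_add: "\<lbrakk>x \<in> relations_u C; y \<in> relations_u C\<rbrakk> \<Longrightarrow> x + y \<in> relations_u C"
  and relations_u_scale: "x \<in> relations_u C \<Longrightarrow> fps_map (cscale c) x \<in> relations_u C"
  and relations_u_u_times: "u_times x \<in> relations_u C \<longleftrightarrow> x \<in> relations_u C"
  and relations_u_0: "0 \<in> relations_u C"
proof -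
  show "u_times x \<in> relations_u C \<longleftrightarrow> x \<in> relations_u C"
    unfolding relations_u_def mem_Collect_eq by (rule all_fps_nth_u_times) (rule relation_rules(3))
qed (simp_all add: relations_u_def relation_rules)

lemma chains_u_add: "\<lbrakk>x \<in> chains_u C; y \<in> chains_u C\<rbrakk> \<Longrightarrow> x + y \<in> chains_u C"
  and chains_u_scale: "x \<in> chains_u C \<Longrightarrow> fps_map (cscale c) x \<in> chains_u C"
  and chains_u_u_times: "u_times x \<in> chains_u C \<longleftrightarrow> x \<in> chains_u C"
  and chains_u_0: "0 \<in> chains_u C"
proof -
  show "u_times x \<in> chains_u C \<longleftrightarrow> x \<in> chains_u C"
    unfolding chains_u_def mem_Collect_eq by (rule all_fps_nth_u_times) (rule chain_rules(3))
qed (simp_all add: chains_u_def chain_rules)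

lemma relations_u_subset: "relations_u C \<subseteq> chains_u C"
  using chain_relations_subset by (auto simp: relations_u_def chains_u_def)

lemma cyc_d_chains: "x \<in> chains_u C \<Longrightarrow> cyc_d C x \<in> chains_u C"
  by (auto simp: chains_u_def fps_nth_cyc_d intro!: chain_rules hoch_b_chains connes_B_chains)

lemma cyc_d_relations: "x \<in> relations_u C \<Longrightarrow> cyc_d C x \<in> relations_u C"
  by (auto simp: relations_u_def fps_nth_cyc_d intro!: relation_rules hoch_b_relations connes_B_relations)

lemma cyc_d_cyc_d:
  assumes x: "x \<in> chains_u C"
  shows "cyc_d C (cyc_d C x) \<in> relations_u C"
  unfolding relations_u_def mem_Collect_eq
proof
  fix n
  have c: "fps_nth x k \<in> chains C" for k using x by (simp add: chains_u_def)
  show "fps_nth (cyc_d C (cyc_d C x)) n \<in> chain_relations C"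
  proof (cases n)
    case 0
    then show ?thesis using hoch_b_hoch_b[OF c] by (simp add: fps_nth_cyc_d)
  next
    case (Suc m)
    \<comment> \<open>The coefficient of u^n collects b^2 at index n, bB + Bb at n - 1 and B^2 at n
      - 2. For n = 1 there is no index n - 2, and 0 takes its place.\<close>
    have "fps_nth (cyc_d C (cyc_d C x)) n = hoch_b C (hoch_b C (fps_nth x n)) +
        (hoch_b C (connes_B C (fps_nth x m)) + connes_B C (hoch_b C (fps_nth x m))) +
        connes_B C (connes_B C (if m = 0 then 0 else fps_nth x (m - 1)))"
      by (simp add: fps_nth_cyc_d Suc hoch_b_add connes_B_add)
    also have "\<dots> \<in> chain_relations C"
      by (intro relation_rules(1) hoch_b_hoch_b hoch_b_connes_B connes_B_connes_B) (auto intro: c chain_rules)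
    finally show ?thesis .
  qed
qed

lemma cyc_boundaries_add: "\<lbrakk>x \<in> cyc_boundaries C; y \<in> cyc_boundaries C\<rbrakk> \<Longrightarrow> x + y \<in> cyc_boundaries C"
proof -
  assume "x \<in> cyc_boundaries C" "y \<in> cyc_boundaries C"
  then obtain v r v' r' where "x = cyc_d C v + r" "y = cyc_d C v' + r'"
    "v \<in> chains_u C" "v' \<in> chains_u C" "r \<in> relations_u C" "r' \<in> relations_u C"
    unfolding cyc_boundaries_def by blast
  then have "x + y = cyc_d C (v + v') + (r + r')" "v + v' \<in> chains_u C" "r + r' \<in> relations_u C"
    by (auto simp: cyc_d_add ac_simps chains_u_add relations_u_add)
  then show ?thesis unfolding cyc_boundaries_def by blast
qed

lemma cyc_boundaries_scale: "x \<in> cyc_boundaries C \<Longrightarrow> fps_map (cscale c) x \<in> cyc_boundaries C"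
proof -
  assume "x \<in> cyc_boundaries C"
  then obtain v r where "x = cyc_d C v + r" "v \<in> chains_u C" "r \<in> relations_u C"
    unfolding cyc_boundaries_def by blast
  moreover have "fps_map (cscale c) (y + z) = fps_map (cscale c) y + fps_map (cscale c) z" for y z :: "('o, 'm) chain fps"
    by (rule fps_ext) (simp add: cs.scale_right_distrib)
  ultimately have "fps_map (cscale c) x = cyc_d C (fps_map (cscale c) v) + fps_map (cscale c) r"
    "fps_map (cscale c) v \<in> chains_u C" "fps_map (cscale c) r \<in> relations_u C"
    by (auto simp: cyc_d_scale chains_u_scale relations_u_scale)
  then show ?thesis unfolding cyc_boundaries_def by blast
qed

lemma cyc_boundaries_u_times: "x \<in> cyc_boundaries C \<Longrightarrow> u_times x \<in> cyc_boundaries C"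
proof -
  assume "x \<in> cyc_boundaries C"
  then obtain v r where "x = cyc_d C v + r" "v \<in> chains_u C" "r \<in> relations_u C"
    unfolding cyc_boundaries_def by blast
  then have "u_times x = cyc_d C (u_times v) + u_times r" "u_times v \<in> chains_u C" "u_times r \<in> relations_u C"
    by (auto simp: cyc_d_u_times u_times_add chains_u_u_times relations_u_u_times)
  then show ?thesis unfolding cyc_boundaries_def by blast
qed

lemma cyc_boundaries_0: "0 \<in> cyc_boundaries C"
proof -
  have "cyc_d C 0 = 0" by (rule fps_ext) (simp add: fps_nth_cyc_d)
  then show ?thesis using chains_u_0 relations_u_0 unfolding cyc_boundaries_def by force
qed

lemma cyc_boundaries_uminus: "x \<in> cyc_boundaries C \<Longrightarrow> - x \<in> cyc_boundaries C"
proof -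
  have "- x = fps_map (cscale (-1)) x" by (rule fps_ext) simp
  then show "x \<in> cyc_boundaries C \<Longrightarrow> - x \<in> cyc_boundaries C" by (simp add: cyc_boundaries_scale)
qed

lemma cyc_cycles_add: "\<lbrakk>x \<in> cyc_cycles C; y \<in> cyc_cycles C\<rbrakk> \<Longrightarrow> x + y \<in> cyc_cycles C"
  and cyc_cycles_scale: "x \<in> cyc_cycles C \<Longrightarrow> fps_map (cscale c) x \<in> cyc_cycles C"
  and cyc_cycles_u_times: "u_times x \<in> cyc_cycles C \<longleftrightarrow> x \<in> cyc_cycles C"
  by (auto simp: cyc_cycles_def cyc_d_add cyc_d_scale cyc_d_u_times chains_u_add chains_u_scale
      chains_u_u_times relations_u_add relations_u_scale relations_u_u_times)

text \<open>This rests on (b + uB)^2 = 0 modulo relations; consequently a coset of the boundaries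
  that contains one cycle consists of cycles.\<close>

lemma cyc_boundaries_subset: "cyc_boundaries C \<subseteq> cyc_cycles C"
proof
  fix x assume "x \<in> cyc_boundaries C"
  then obtain v r where x: "x = cyc_d C v + r" and v: "v \<in> chains_u C" and r: "r \<in> relations_u C"
    unfolding cyc_boundaries_def by blast
  have "x \<in> chains_u C"
    unfolding x using v r relations_u_subset by (blast intro: chains_u_add cyc_d_chains)
  moreover have "cyc_d C x \<in> relations_u C"
    unfolding x cyc_d_add by (intro relations_u_add cyc_d_cyc_d[OF v] cyc_d_relations[OF r])
  ultimately show "x \<in> cyc_cycles C" by (simp add: cyc_cycles_def)
qed

end

section \<open>The connection modulo \<open>u\<close>\<close>

lemma finite_S5 [simp]: "finite (S5 xs)"
proof (rule finite_subset)
  show "S5 xs \<subseteq> (\<lambda>((a, b, r), c, d, e). (a, b, c, d, e)) ` Sigma (S3 xs) (\<lambda>(a, b, r). S3 r)"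
    by (force simp: S3_def S5_def image_iff)
qed (auto intro!: finite_SigmaI)

lemma fps_smult_const:
  assumes "vector_space sc"
  shows "fps_smult sc (fps_const c) x = fps_map (sc c) x"
proof (rule fps_ext)
  interpret vector_space sc by fact
  fix n
  have "fps_nth (fps_smult sc (fps_const c) x) n = (\<Sum>i\<le>n. if i = 0 then sc c (fps_nth x n) else 0)"
    unfolding fps_smult_def fps_nth_Abs_fps by (rule sum.cong) auto
  then show "fps_nth (fps_smult sc (fps_const c) x) n = fps_nth (fps_map (sc c) x) n" by simp
qed

lemma fps_smult_X:
  assumes "vector_space sc"
  shows "fps_smult sc fps_X x = u_times x"
proof (rule fps_ext)
  interpret vector_space sc by fact
  fix n
  have "fps_nth (fps_smult sc fps_X x) n = (\<Sum>i\<le>n. if i = 1 then fps_nth x (n - 1) else 0)"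
    unfolding fps_smult_def fps_nth_Abs_fps by (rule sum.cong) auto
  also have "\<dots> = fps_nth (u_times x) n" by (cases n) (auto simp: One_nat_def)
  finally show "fps_nth (fps_smult sc fps_X x) n = fps_nth (u_times x) n" .
qed

lemma b11_add: "b11 C d \<phi> (x + y) = b11 C d \<phi> x + b11 C d \<phi> y"
  and b11_cscale: "b11 C d \<phi> (cscale c x) = cscale c (b11 C d \<phi> x)"
  and B11_add: "B11 C d \<phi> (x + y) = B11 C d \<phi> x + B11 C d \<phi> y"
  and Gamma_op_add: "Gamma_op (x + y) = Gamma_op x + Gamma_op y"
  by (simp_all add: b11_def B11_def Gamma_op_def extend_add extend_cscale)

lemma u2nabla_chain_add: "u2nabla_chain C (x + y) = u2nabla_chain C x + u2nabla_chain C y"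
proof -
  have map_add: "fps_map f (x + y) = fps_map f x + fps_map f y"
    if "\<And>a b. f (a + b) = f a + f b" for f :: "('a, 'b) chain \<Rightarrow> ('a, 'b) chain" and x y
    by (rule fps_ext) (simp add: that)
  have d: "d_du cscale (x + y) = d_du cscale x + d_du cscale y"
    by (rule fps_ext) (simp add: cs.scale_right_distrib)
  show ?thesis
    by (simp add: u2nabla_chain_def map_add b11_add B11_add Gamma_op_add d u_times_add
        cs.scale_right_distrib add_ac)
qed

lemma fps_nth_u2nabla_chain_0:
  "fps_nth (u2nabla_chain C x) 0 = cscale (1 / 2) (b11 C 1 (mu' C) (fps_nth x 0))"
  by (simp add: u2nabla_chain_def)

text \<open>The map induced on \<open>HC\<^sup>-/u\<close> by \<open>u\<^sup>2\<nabla>\<close>, shifted by the curvature.\<close>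

definition residue_shift :: "('o, 'm) ainf_cat \<Rightarrow> complex \<Rightarrow> ('o, 'm) chain \<Rightarrow> ('o, 'm) chain" where
  "residue_shift C w x = cscale (1 / 2) (b11 C 1 (mu' C) x) - cscale w x"

lemma residue_shift_add: "residue_shift C w (x + y) = residue_shift C w x + residue_shift C w y"
  by (simp add: residue_shift_def b11_add cs.scale_right_distrib)

lemma residue_shift_cscale: "residue_shift C w (cscale c x) = cscale c (residue_shift C w x)"
  by (simp add: residue_shift_def b11_cscale cs.scale_right_diff_distrib mult.commute)

context weakly_curved_ainf_cat
begin

lemma is_mor_app_mu' [simp]: "pth C X as \<Longrightarrow> is_mor C (app_cochain 1 (mu' C) X as)"
  using mu_closed[of X as "endpt X as"] pth_obj[of C X as]
  by (simp add: is_mor_def is_path_iff mu'_def mor_scl)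

lemma word_b11:
  assumes "(a0, a1 @ a2 @ a3 @ a4 @ a5) \<in> words C"
  shows "(app_mu C (endpt (tgt a0) (a1 @ a2))
      (a3 @ [app_cochain 1 (mu' C) (endpt (tgt a0) (a1 @ a2 @ a3)) a4] @ a5 @ [a0] @ a1), a2) \<in> words C"
  using assms pth_obj[of C "endpt (tgt a0) a1" a2] by (auto simp: words_iff intro!: is_mor_app_mu)

lemma pth_b11:
  assumes "(a0, a1 @ a2 @ a3 @ a4 @ a5) \<in> words C"
  shows "pth C (endpt (tgt a0) (a1 @ a2))
      (a3 @ [app_cochain 1 (mu' C) (endpt (tgt a0) (a1 @ a2 @ a3)) a4] @ a5 @ [a0] @ a1)"
  using assms by (auto simp: words_iff)

text \<open>The factor 2 - k in m' equals 2 at k = 0; the factor 1/2 in the connection will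
  compensate it.\<close>

lemma app_mu'_Nil: "X \<in> obj C \<Longrightarrow> app_cochain 1 (mu' C) X [] = Mor X X 0 (scl C (2 * w) (unt C X))"
  by (simp add: app_cochain_def mu'_def curvature)

text \<open>Inserting the curvature gives multiplication by \<open>2w\<close>; every other term shortens the word.\<close>

lemma b11_word:
  assumes word: "(a0, as) \<in> words C"
  shows "\<exists>r\<in>chain_relations C. \<exists>s\<in>chains C. (\<forall>z\<in>Poly_Mapping.keys s. length (snd z) < length as) \<and>
    b11 C 1 (mu' C) (Poly_Mapping.single (a0, as) 1) = cscale (2 * w) (Poly_Mapping.single (a0, as) 1) + r + s"
proof -
  define sg where "sg = (\<lambda>(a1 :: ('o, 'm) mor list, a2 :: ('o, 'm) mor list, a3 :: ('o, 'm) mor list,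
      a4 :: ('o, 'm) mor list, a5 :: ('o, 'm) mor list).
    (-1) ^ ((eps a3 + eps a4 + eps a5) * (sd a0 + eps a1 + eps a2) + 1 * eps a3) :: complex)"
  define wd where "wd = (\<lambda>(a1, a2, a3, a4, a5). (app_mu C (endpt (tgt a0) (a1 @ a2))
      (a3 @ [app_cochain 1 (mu' C) (endpt (tgt a0) (a1 @ a2 @ a3)) a4] @ a5 @ [a0] @ a1), a2))"
  let ?t = "\<lambda>d. Poly_Mapping.single (wd d) (sg d)"
  \<comment> \<open>The letters left outside the operation are \<open>a2\<close>, so a nonempty
    argument of the cochain makes the new word shorter.\<close>
  let ?short = "{d \<in> S5 as. fst (snd (snd (snd d))) \<noteq> []}"
  \<comment> \<open>All letters stay, and the curvature term of m' is multiplied onto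
    \<open>a0\<close> from the left by m_2.\<close>
  let ?d0 = "([], as, [], [], [])"
  let ?z = "Poly_Mapping.single (a0, as) 1"
  define s where "s = (\<Sum>d\<in>?short. ?t d)"
  \<comment> \<open>The remainder is tested only against functionals on reduced chains, which pull
    scalars out of morphisms and vanish on words with a zero entry.\<close>
  define r where "r = b11 C 1 (mu' C) ?z - cscale (2 * w) ?z - s"
  have b: "b11 C 1 (mu' C) ?z = (\<Sum>d\<in>S5 as. ?t d)"
    by (simp add: b11_def sg_def wd_def case_prod_unfold)
  have wdw: "wd d \<in> words C" if "d \<in> S5 as" for d
    using that word_b11[of a0] word by (auto simp: wd_def S5_def)
  have sc: "s \<in> chains C"
    unfolding s_def by (intro cs.subspace_sum subspace_chains single_in_chains wdw) auto
  have sl: "length (snd z) < length as" if "z \<in> Poly_Mapping.keys s" for z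
  proof -
    have "Poly_Mapping.keys s \<subseteq> (\<Union>d\<in>?short. Poly_Mapping.keys (?t d))"
      unfolding s_def by (rule keys_sum)
    then obtain d where "d \<in> ?short" "z \<in> Poly_Mapping.keys (?t d)" using \<open>z \<in> Poly_Mapping.keys s\<close> by blast
    then show ?thesis by (auto simp: S5_def wd_def split: if_splits)
  qed
  have "r \<in> chain_relations C"
  proof (rule in_chain_relationsI)
    fix F assume "rel_functional C F"
    then have F: "functional F" and G: "multilin C (coeff_fun F)" by (auto simp: rel_functional_def)
    \<comment> \<open>The operation has a multiple of the unit among at least three arguments: the
      unit, \<open>a0\<close> and a further letter from \<open>a3\<close>, \<open>a5\<close> or
      \<open>a1\<close>.\<close>
    have zero: "F (?t d) = 0" if d: "d \<in> S5 as - ?short" "d \<noteq> ?d0" for d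
    proof -
      obtain a1 a2 a3 a5 where da: "d = (a1, a2, a3, [], a5)" and as: "a1 @ a2 @ a3 @ a5 = as"
        using d(1) by (auto simp: S5_def)
      have ne: "a3 \<noteq> [] \<or> a5 @ a1 \<noteq> []" using d(2) da as by auto
      let ?Y = "endpt (tgt a0) (a1 @ a2 @ a3)" and ?Z = "endpt (tgt a0) (a1 @ a2)"
      have Y: "?Y \<in> obj C" using word as pth_obj[of C "tgt a0" "a1 @ a2 @ a3"] by (auto simp: words_iff)
      have wY: "(a0, a1 @ a2 @ a3 @ [] @ a5) \<in> words C" using word as by simp
      let ?\<Phi> = "\<lambda>x. coeff_fun F (app_mu C ?Z (a3 @ Mor ?Y ?Y 0 x # a5 @ [a0] @ a1), a2)"
      have p: "pth C ?Z (a3 @ Mor ?Y ?Y 0 x # a5 @ [a0] @ a1)" if "x \<in> mor_space C ?Y ?Y 0" for x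
        using pth_b11[OF wY] that Y by (auto simp: is_mor_Mor)
      have wdx: "(app_mu C ?Z (a3 @ Mor ?Y ?Y 0 x # a5 @ [a0] @ a1), a2) \<in> words C"
        if "x \<in> mor_space C ?Y ?Y 0" for x
        using is_mor_app_mu[OF p[OF that]] word as by (auto simp: words_iff)
      have l: "lin_on C ?Y ?Y 0 ?\<Phi>"
        by (rule lin_on_app_mu[OF G, where f = "\<lambda>a. (a, a2)"]) (use Y p wdx in auto)
      have um: "unt C ?Y \<in> mor_space C ?Y ?Y 0" using unit_hom[OF Y] .
      have "?\<Phi> (unt C ?Y) = 0"
        using multilin_app_mu_unit_zero[OF G, of "\<lambda>a. (a, a2)" ?Z a3 ?Y "a5 @ [a0] @ a1"] ne p[OF um]
          wdx[OF um] unfolding unit_mor_def by auto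
      then have "?\<Phi> (scl C (2 * w) (unt C ?Y)) = 0" using l um by (simp add: lin_on_def)
      then show ?thesis
        using app_mu'_Nil[OF Y] by (simp add: functional_single'[OF F] da wd_def)
    qed
    have d0: "F (?t ?d0) = 2 * w * coeff_fun F (a0, as)"
    proof -
      obtain S T p x where a0: "a0 = Mor S T p x" by (cases a0)
      have S: "S \<in> obj C" "endpt T as = S" "x \<in> mor_space C S T p" "p < 2"
        using word by (auto simp: a0 words_iff is_mor_def)
      have "is_path C S ([] @ [Mor S S 0 (unt C S)] @ [a0]) T"
        using word S unit_hom[of S] by (auto simp: a0 words_iff is_mor_Mor)
      from mu_scale[OF this, of "2 * w"]
      have "mu C S [Mor S S 0 (scl C (2 * w) (unt C S)), a0] = scl C (2 * w) (mu C S [unit_mor C S, a0])"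
        by (simp add: unit_mor_def)
      also have "mu C S [unit_mor C S, a0] = x"
        using mu2_unit_left[of a0] word by (simp add: a0 words_iff)
      finally have "app_mu C S [Mor S S 0 (scl C (2 * w) (unt C S)), a0] = Mor S T p (scl C (2 * w) x)"
        using S by (auto simp: app_cochain_def a0 less_2_cases_iff)
      then have "wd ?d0 = (Mor S T p (scl C (2 * w) x), as)"
        using app_mu'_Nil[OF S(1)] S(2) by (simp add: wd_def a0)
      moreover have "lin_on C S T p (\<lambda>x. coeff_fun F (Mor S T p x, as))"
        using multilin_lin_on[OF G slot_okI(1)[of "\<lambda>a. (a, as)"]] word by (auto simp: a0)
      ultimately show ?thesis using S(3) by (simp add: functional_single'[OF F] sg_def a0 lin_on_def)
    qed
    have "(\<Sum>d\<in>S5 as - ?short. F (?t d)) = F (?t ?d0)"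
      by (subst sum.remove[of _ ?d0]) (auto simp: S5_def[of as] intro!: sum.neutral zero[unfolded S5_def[of as]] simp: finite_S5[unfolded S5_def])
    moreover have "(\<Sum>d\<in>S5 as. F (?t d)) = (\<Sum>d\<in>S5 as - ?short. F (?t d)) + (\<Sum>d\<in>?short. F (?t d))"
      by (rule sum.subset_diff) auto
    ultimately show "F r = 0"
      by (simp add: r_def b s_def functional_diff[OF F] functional_sum[OF F] functional_cscale[OF F] d0 coeff_fun_def
          del: cscale_single)
  qed
  moreover have "b11 C 1 (mu' C) ?z = cscale (2 * w) ?z + r + s" by (simp add: r_def)
  ultimately show ?thesis using sc sl by blast
qed

lemma subspace_HH_boundaries: "cs.subspace (HH_boundaries C)"
proof (unfold cs.subspace_def, intro conjI ballI allI)
  show "0 \<in> HH_boundaries C"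
    unfolding HH_boundaries_def using chain_rules(3) relation_rules(3) by force
next
  fix x y assume "x \<in> HH_boundaries C" "y \<in> HH_boundaries C"
  then obtain v r v' r' where "x = hoch_b C v + r" "y = hoch_b C v' + r'" "v \<in> chains C" "v' \<in> chains C"
    "r \<in> chain_relations C" "r' \<in> chain_relations C"
    unfolding HH_boundaries_def by blast
  then have "x + y = hoch_b C (v + v') + (r + r')" "v + v' \<in> chains C" "r + r' \<in> chain_relations C"
    by (auto simp: hoch_b_add add_ac chain_rules relation_rules)
  then show "x + y \<in> HH_boundaries C" unfolding HH_boundaries_def by blast
next
  fix c x assume "x \<in> HH_boundaries C"
  then obtain v r where "x = hoch_b C v + r" "v \<in> chains C" "r \<in> chain_relations C"
    unfolding HH_boundaries_def by blast
  then have "cscale c x = hoch_b C (cscale c v) + cscale c r" "cscale c v \<in> chains C"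
    "cscale c r \<in> chain_relations C"
    by (auto simp: hoch_b_cscale cs.scale_right_distrib chain_rules relation_rules)
  then show "cscale c x \<in> HH_boundaries C" unfolding HH_boundaries_def by blast
qed

text \<open>By \<open>b11_word\<close> the shifted residue lowers word length modulo relations.
  Invariance of the boundaries allows the exponents for finitely many words to be raised to a common
  one.\<close>

lemma residue_shift_locally_nilpotent:
  assumes inv: "\<And>y. y \<in> HH_boundaries C \<Longrightarrow> residue_shift C w y \<in> HH_boundaries C"
    and x: "x \<in> chains C"
  shows "\<exists>N. (residue_shift C w ^^ N) x \<in> HH_boundaries C"
proof -
  let ?Q = "residue_shift C w"
  \<comment> \<open>Once this set is known to be a subspace containing the relations, it suffices to
    treat single words by induction on length.\<close>
  define K where "K = {x. \<exists>N. (?Q ^^ N) x \<in> HH_boundaries C}"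
  have inv_pow: "(?Q ^^ k) y \<in> HH_boundaries C" if "y \<in> HH_boundaries C" for k y
    using that by (induction k) (auto intro: inv)
  have more: "(?Q ^^ (k + N)) y \<in> HH_boundaries C" if "(?Q ^^ N) y \<in> HH_boundaries C" for k N y
    using inv_pow[OF that, of k] by (simp add: funpow_add)
  have padd: "(?Q ^^ N) (x + y) = (?Q ^^ N) x + (?Q ^^ N) y"
    and pscale: "(?Q ^^ N) (cscale c x) = cscale c ((?Q ^^ N) x)" for N c x y
    by (induction N) (simp_all add: residue_shift_add residue_shift_cscale)
  have BK: "HH_boundaries C \<subseteq> K" unfolding K_def by (auto intro: exI[of _ 0])
  have K: "cs.subspace K"
  proof (unfold cs.subspace_def, intro conjI ballI allI)
    show "0 \<in> K" using BK cs.subspace_0[OF subspace_HH_boundaries] by blast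
  next
    fix x y assume "x \<in> K" "y \<in> K"
    then obtain M N where "(?Q ^^ M) x \<in> HH_boundaries C" "(?Q ^^ N) y \<in> HH_boundaries C"
      unfolding K_def by blast
    then have "(?Q ^^ (N + M)) (x + y) \<in> HH_boundaries C"
      using more[of M x N] more[of N y M] cs.subspace_add[OF subspace_HH_boundaries]
      by (simp add: padd add.commute)
    then show "x + y \<in> K" unfolding K_def by blast
  next
    fix c x assume "x \<in> K"
    then show "cscale c x \<in> K"
      unfolding K_def using cs.subspace_scale[OF subspace_HH_boundaries] by (auto simp: pscale)
  qed
  have RK: "chain_relations C \<subseteq> K"
  proof -
    have "chain_relations C \<subseteq> HH_boundaries C"
      unfolding HH_boundaries_def using chain_rules(3) by force
    then show ?thesis using BK by blast
  qed
  have single: "Poly_Mapping.single z 1 \<in> K" if "z \<in> words C" for z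
    using that
  proof (induction "length (snd z)" arbitrary: z rule: less_induct)
    case less
    obtain a0 as where z: "z = (a0, as)" by (cases z)
    from less.prems have "(a0, as) \<in> words C" by (simp add: z)
    from b11_word[OF this] obtain r s where rs: "r \<in> chain_relations C" "s \<in> chains C"
      "\<forall>z\<in>Poly_Mapping.keys s. length (snd z) < length as"
      "b11 C 1 (mu' C) (Poly_Mapping.single (a0, as) 1)
        = cscale (2 * w) (Poly_Mapping.single (a0, as) 1) + r + s"
      by blast
    have "s \<in> K"
      by (subst poly_mapping_sum_single, intro cs.subspace_sum K cs.subspace_scale less.hyps)
        (use rs(2,3) in \<open>auto simp: chains_def z\<close>)
    then have "cscale (1 / 2) (r + s) \<in> K"
      using rs(1) RK by (intro cs.subspace_scale cs.subspace_add K) auto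
    \<comment> \<open>Half of the term with 2w cancels against the shift by w.\<close>
    moreover have "?Q (Poly_Mapping.single z 1) = cscale (1 / 2) (r + s)"
      using rs(4) by (simp add: z residue_shift_def cs.scale_right_distrib del: cscale_single)
    ultimately obtain N where "(?Q ^^ N) (?Q (Poly_Mapping.single z 1)) \<in> HH_boundaries C"
      unfolding K_def by auto
    then have "(?Q ^^ Suc N) (Poly_Mapping.single z 1) \<in> HH_boundaries C" by (simp add: funpow_swap1)
    then show ?case unfolding K_def by blast
  qed
  have "x \<in> K"
    by (subst poly_mapping_sum_single, intro cs.subspace_sum K cs.subspace_scale single)
      (use x in \<open>auto simp: chains_def\<close>)
  then show ?thesis by (simp add: K_def)
qed

section \<open>Cosets in negative cyclic homology\<close>

lemma cyc_class_iff: "z \<in> cyc_class C x \<longleftrightarrow> z - x \<in> cyc_boundaries C"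
  unfolding cyc_class_def by (auto intro: exI[of _ "z - x"])

lemma cyc_class_eqI:
  assumes "x - y \<in> cyc_boundaries C"
  shows "cyc_class C x = cyc_class C y"
proof -
  have "z - x \<in> cyc_boundaries C \<longleftrightarrow> z - y \<in> cyc_boundaries C" for z
    using cyc_boundaries_add[of "z - x" "x - y"] cyc_boundaries_add[of "z - y" "- (x - y)"]
      cyc_boundaries_uminus[of "x - y"] assms by auto
  then show ?thesis by (auto simp: cyc_class_iff)
qed

lemma HC_minus_add: "cyc_class C x \<oplus>\<^bsub>HC_minus C\<^esub> cyc_class C y = cyc_class C (x + y)"
proof -
  have "\<exists>a b. z = a + b \<and> a \<in> cyc_class C x \<and> b \<in> cyc_class C y" if "z - (x + y) \<in> cyc_boundaries C" for z
    using that cyc_boundaries_0 by (intro exI[of _ "z - y"] exI[of _ y]) (simp add: cyc_class_iff algebra_simps)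
  moreover have "a + b - (x + y) \<in> cyc_boundaries C" if "a \<in> cyc_class C x" "b \<in> cyc_class C y" for a b
    using that cyc_boundaries_add[of "a - x" "b - y"] by (simp add: cyc_class_iff algebra_simps)
  ultimately show ?thesis by (auto simp: HC_minus_def cyc_class_iff)
qed

text \<open>Multiplication by \<open>f\<close> passes to cosets once it is additive and preserves
  boundaries; the cases applied below are constants and u.\<close>

lemma HC_minus_smult:
  fixes x :: "('o, 'm) chain fps"
  assumes add: "\<And>x y :: ('o, 'm) chain fps. fps_smult cscale f (x + y) = fps_smult cscale f x + fps_smult cscale f y"
    and bd: "\<And>b. b \<in> cyc_boundaries C \<Longrightarrow> fps_smult cscale f b \<in> cyc_boundaries C"
  shows "f \<odot>\<^bsub>HC_minus C\<^esub> cyc_class C x = cyc_class C (fps_smult cscale f x)"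
proof -
  have "fps_smult cscale f a + b - fps_smult cscale f x \<in> cyc_boundaries C"
    if "a - x \<in> cyc_boundaries C" "b \<in> cyc_boundaries C" for a b
    using cyc_boundaries_add[OF bd[OF that(1)] that(2)] add[of "a - x" x] by (simp add: algebra_simps)
  moreover have "\<exists>a b. z = fps_smult cscale f a + b \<and> a - x \<in> cyc_boundaries C \<and> b \<in> cyc_boundaries C"
    if "z - fps_smult cscale f x \<in> cyc_boundaries C" for z
    using that cyc_boundaries_0 by (intro exI[of _ x] exI[of _ "z - fps_smult cscale f x"]) simp
  ultimately show ?thesis by (auto simp: HC_minus_def cyc_class_iff)
qed

lemma HC_minus_scale: "fps_const c \<odot>\<^bsub>HC_minus C\<^esub> cyc_class C x = cyc_class C (fps_map (cscale c) x)"
proof -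
  have e: "fps_smult cscale (fps_const c) = fps_map (cscale c)"
    by (rule ext) (rule fps_smult_const[OF cs.vector_space_axioms])
  show ?thesis
    by (subst HC_minus_smult) (auto simp: e cs.scale_right_distrib cyc_boundaries_scale intro!: fps_ext)
qed

lemma HC_minus_X: "fps_X \<odot>\<^bsub>HC_minus C\<^esub> cyc_class C x = cyc_class C (u_times x)"
proof -
  have e: "fps_smult cscale fps_X = u_times"
    by (rule ext) (rule fps_smult_X[OF cs.vector_space_axioms])
  show ?thesis
    by (subst HC_minus_smult) (auto simp: e u_times_add cyc_boundaries_u_times)
qed

lemma HC_minus_carrier: "carrier (HC_minus C) = cyc_class C ` cyc_cycles C"
  by (simp add: HC_minus_def)

lemma cyc_cycles_0: "0 \<in> cyc_cycles C"
  using cyc_boundaries_0 cyc_boundaries_subset by blast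

section \<open>The operator \<open>u2nabla\<close> on cosets and its action modulo u\<close>

context
  assumes E: "E_structure (HC_minus C)"
begin

lemma u2nabla_class_in_carrier:
  assumes "x \<in> cyc_cycles C"
  obtains z where "z \<in> cyc_cycles C" "u2nabla (HC_minus C) (cyc_class C x) = cyc_class C z"
proof -
  have "u2nabla (HC_minus C) (cyc_class C x) \<in> carrier (HC_minus C)"
    using E assms unfolding E_structure_def HC_minus_carrier by blast
  then show ?thesis using that by (auto simp: HC_minus_carrier)
qed

text \<open>An E-structure sends the zero coset to a single coset. That coset contains the images of
  0 and of \<open>y\<close>, which therefore differ by a boundary. Stability of boundaries is thus
  read off from the hypothesis rather than computed from a commutator on chains.\<close>

lemma u2nabla_chain_boundaries:
  assumes y: "y \<in> cyc_boundaries C"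
  shows "u2nabla_chain C y \<in> cyc_boundaries C"
proof -
  have u: "u2nabla_chain C a + b \<in> u2nabla (HC_minus C) (cyc_class C 0)"
    if "a \<in> cyc_boundaries C" "b \<in> cyc_boundaries C" for a b
    using that by (auto simp: HC_minus_def cyc_class_iff)
  obtain z where z: "u2nabla (HC_minus C) (cyc_class C 0) = cyc_class C z"
    using u2nabla_class_in_carrier[OF cyc_cycles_0] by blast
  have "u2nabla_chain C 0 = 0" using u2nabla_chain_add[of C 0 0] by simp
  then have "0 - z \<in> cyc_boundaries C"
    using u[OF cyc_boundaries_0 cyc_boundaries_0] by (simp add: z cyc_class_iff)
  moreover have "u2nabla_chain C y - z \<in> cyc_boundaries C"
    using u[OF y cyc_boundaries_0] by (simp add: z cyc_class_iff)
  ultimately show ?thesis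
    using cyc_boundaries_add[OF _ cyc_boundaries_uminus, of "u2nabla_chain C y - z" "0 - z"] by simp
qed

lemma HC_minus_u2nabla:
  "u2nabla (HC_minus C) (cyc_class C x) = cyc_class C (u2nabla_chain C x)"
proof -
  have "u2nabla_chain C a + b - u2nabla_chain C x \<in> cyc_boundaries C"
    if "a - x \<in> cyc_boundaries C" "b \<in> cyc_boundaries C" for a b
    using cyc_boundaries_add[OF u2nabla_chain_boundaries[OF that(1)] that(2)]
      u2nabla_chain_add[of C "a - x" x] by (simp add: algebra_simps)
  moreover have "\<exists>a b. z = u2nabla_chain C a + b \<and> a - x \<in> cyc_boundaries C \<and> b \<in> cyc_boundaries C"
    if "z - u2nabla_chain C x \<in> cyc_boundaries C" for z
    using that cyc_boundaries_0 by (intro exI[of _ x] exI[of _ "z - u2nabla_chain C x"]) simp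
  ultimately show ?thesis by (auto simp: HC_minus_def cyc_class_iff)
qed

text \<open>The image coset is that of some cycle, and the chain differs from this cycle by a
  boundary, which is itself a cycle.\<close>

lemma u2nabla_chain_cycles:
  assumes "x \<in> cyc_cycles C"
  shows "u2nabla_chain C x \<in> cyc_cycles C"
proof -
  obtain z where z: "z \<in> cyc_cycles C" "u2nabla (HC_minus C) (cyc_class C x) = cyc_class C z"
    using u2nabla_class_in_carrier[OF assms] by blast
  have "u2nabla_chain C x \<in> cyc_class C (u2nabla_chain C x)" by (simp add: cyc_class_iff cyc_boundaries_0)
  then have "u2nabla_chain C x \<in> cyc_class C z" using z(2) by (simp add: HC_minus_u2nabla)
  then have "u2nabla_chain C x - z \<in> cyc_boundaries C" by (simp add: cyc_class_iff)
  then show ?thesis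
    using cyc_cycles_add[OF z(1), of "u2nabla_chain C x - z"] cyc_boundaries_subset by auto
qed

text \<open>A Hochschild boundary is lifted to a cyclic boundary with that leading coefficient.
  Cyclic boundaries are preserved by \<open>u2nabla_chain\<close>, and leading coefficients of
  cyclic boundaries are Hochschild boundaries.\<close>

lemma HH_boundaries_invariant:
  assumes y: "y \<in> HH_boundaries C"
  shows "residue_shift C w y \<in> HH_boundaries C"
proof -
  obtain v r where y: "y = hoch_b C v + r" and v: "v \<in> chains C" and r: "r \<in> chain_relations C"
    using y unfolding HH_boundaries_def by blast
  define Y where "Y = cyc_d C (fps_const v) + fps_const r"
  have "Y \<in> cyc_boundaries C"
    unfolding Y_def cyc_boundaries_def
    using v r chain_rules(3) relation_rules(3) by (force simp: chains_u_def relations_u_def)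
  then have "u2nabla_chain C Y \<in> cyc_boundaries C" by (rule u2nabla_chain_boundaries)
  then obtain v' r' where "u2nabla_chain C Y = cyc_d C v' + r'" "v' \<in> chains_u C" "r' \<in> relations_u C"
    unfolding cyc_boundaries_def by blast
  then have "fps_nth (u2nabla_chain C Y) 0 = hoch_b C (fps_nth v' 0) + fps_nth r' 0"
    "fps_nth v' 0 \<in> chains C" "fps_nth r' 0 \<in> chain_relations C"
    by (simp_all add: fps_nth_cyc_d chains_u_def relations_u_def)
  then have "fps_nth (u2nabla_chain C Y) 0 \<in> HH_boundaries C"
    unfolding HH_boundaries_def by blast
  moreover have "fps_nth Y 0 = y" by (simp add: Y_def y fps_nth_cyc_d)
  ultimately have "cscale (1 / 2) (b11 C 1 (mu' C) y) \<in> HH_boundaries C"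
    by (simp add: fps_nth_u2nabla_chain_0)
  then show ?thesis
    unfolding residue_shift_def
    by (rule cs.subspace_diff[OF subspace_HH_boundaries _ cs.subspace_scale[OF subspace_HH_boundaries assms]])
qed

text \<open>\<open>u\<^sup>2\<nabla> - w\<close> is locally nilpotent on \<open>HC\<^sup>-/u\<close>.\<close>

lemma shift_pow_divisible:
  assumes x: "x \<in> cyc_cycles C"
  defines "\<Delta> \<equiv> \<lambda>x. u2nabla_chain C x + fps_map (cscale (- w)) x"
  obtains N q where "q \<in> cyc_cycles C" "(\<Delta> ^^ N) x - u_times q \<in> cyc_boundaries C"
proof -
  have nth: "fps_nth ((\<Delta> ^^ N) x) 0 = (residue_shift C w ^^ N) (fps_nth x 0)" for N
    by (induction N) (simp_all add: \<Delta>_def residue_shift_def fps_nth_u2nabla_chain_0)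
  have cyc: "(\<Delta> ^^ N) x \<in> cyc_cycles C" for N
    by (induction N) (auto simp: \<Delta>_def x intro!: cyc_cycles_add u2nabla_chain_cycles cyc_cycles_scale)
  have "fps_nth x 0 \<in> chains C" using x by (simp add: cyc_cycles_def chains_u_def)
  from residue_shift_locally_nilpotent[OF HH_boundaries_invariant this]
  obtain N where "fps_nth ((\<Delta> ^^ N) x) 0 \<in> HH_boundaries C" by (auto simp: nth)
  then obtain v r where vr: "fps_nth ((\<Delta> ^^ N) x) 0 = hoch_b C v + r" "v \<in> chains C" "r \<in> chain_relations C"
    unfolding HH_boundaries_def by blast
  \<comment> \<open>A cyclic boundary with the same leading coefficient as the power, so that the
    difference can be divided by u.\<close>
  define Y where "Y = cyc_d C (fps_const v) + fps_const r"
  have Y: "Y \<in> cyc_boundaries C"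
    unfolding Y_def cyc_boundaries_def
    using vr(2,3) chain_rules(3) relation_rules(3) by (force simp: chains_u_def relations_u_def)
  define q where "q = Abs_fps (\<lambda>n. fps_nth ((\<Delta> ^^ N) x - Y) (Suc n))"
  have "fps_nth Y 0 = hoch_b C v + r" by (simp add: Y_def fps_nth_cyc_d)
  then have uq: "u_times q = (\<Delta> ^^ N) x - Y"
    by (intro fps_ext) (auto simp: q_def fps_nth_u_times vr(1))
  \<comment> \<open>As \<open>Y\<close> is a cycle by (b + uB)^2 = 0, the difference is one; its
    quotient by u is again a cycle because a series is a relation as soon as u times it is.\<close>
  have "(\<Delta> ^^ N) x + - Y \<in> cyc_cycles C"
    using cyc_cycles_add[OF cyc] cyc_boundaries_uminus[OF Y] cyc_boundaries_subset by blast
  then have "u_times q \<in> cyc_cycles C" by (simp add: uq)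
  then have "q \<in> cyc_cycles C" by (simp add: cyc_cycles_u_times)
  moreover have "(\<Delta> ^^ N) x - u_times q \<in> cyc_boundaries C" by (simp add: uq Y)
  ultimately show ?thesis using that by blast
qed

end

end

section \<open>Internal direct sums\<close>

definition component :: "'i set \<Rightarrow> ('i \<Rightarrow> 'v::ab_group_add set) \<Rightarrow> 'v \<Rightarrow> 'i \<Rightarrow> 'v" where
  "component I V x = (THE c. (\<forall>i\<in>I. c i \<in> V i) \<and> (\<forall>i. i \<notin> I \<longrightarrow> c i = 0) \<and> x = (\<Sum>i\<in>I. c i))"

lemma component_props:
  assumes "internal_direct_sum I V"
  shows "i \<in> I \<Longrightarrow> component I V x i \<in> V i" "i \<notin> I \<Longrightarrow> component I V x i = 0"
    "(\<Sum>i\<in>I. component I V x i) = x"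
proof -
  have "(\<forall>i\<in>I. component I V x i \<in> V i) \<and> (\<forall>i. i \<notin> I \<longrightarrow> component I V x i = 0) \<and>
      x = (\<Sum>i\<in>I. component I V x i)"
    unfolding component_def by (rule theI'[OF assms[unfolded internal_direct_sum_def, rule_format]])
  then show "i \<in> I \<Longrightarrow> component I V x i \<in> V i" "i \<notin> I \<Longrightarrow> component I V x i = 0"
    "(\<Sum>i\<in>I. component I V x i) = x" by auto
qed

lemma component_eqI:
  assumes "internal_direct_sum I V" "\<And>i. i \<in> I \<Longrightarrow> c i \<in> V i" "\<And>i. i \<notin> I \<Longrightarrow> c i = 0" "x = (\<Sum>i\<in>I. c i)"
  shows "component I V x = c"
  unfolding component_def
  by (rule the1_equality) (use assms in \<open>auto simp: internal_direct_sum_def\<close>)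

lemma component_add:
  assumes "internal_direct_sum I V" "\<And>i a b. i \<in> I \<Longrightarrow> a \<in> V i \<Longrightarrow> b \<in> V i \<Longrightarrow> a + b \<in> V i"
  shows "component I V (x + y) i = component I V x i + component I V y i"
proof -
  have "component I V (x + y) = (\<lambda>i. component I V x i + component I V y i)"
    by (rule component_eqI[OF assms(1)]) (auto simp: assms component_props sum.distrib)
  then show ?thesis by simp
qed

text \<open>Applying \<open>T\<close> to the components of \<open>x\<close> gives a decomposition of
  \<open>T x\<close>, and decompositions are unique.\<close>

lemma component_map:
  assumes "internal_direct_sum I V" and T: "\<And>x y. T (x + y) = T x + T y"
    and inv: "\<And>i a. i \<in> I \<Longrightarrow> a \<in> V i \<Longrightarrow> T a \<in> V i"
  shows "component I V (T x) i = T (component I V x i)"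
proof -
  have T0: "T 0 = 0" using T[of 0 0] by simp
  have "component I V (T x) = (\<lambda>i. T (component I V x i))"
    by (rule component_eqI[OF assms(1)])
      (use sum_comp_morphism[of T "component I V x" I, OF T0 T] in
        \<open>auto simp: assms(1) inv component_props T0 o_def\<close>)
  then show ?thesis by simp
qed

text \<open>Induction on \<open>N\<close>: since the two shifts of \<open>A\<close> commute,
  \<open>A x - sc w x\<close> satisfies the hypotheses with a smaller exponent and is zero. The
  other shift then acts on \<open>x\<close> as the nonzero scalar \<open>w - v\<close>, whose powers
  kill only 0.\<close>

lemma generalized_eigenspaces_disjoint:
  assumes "vector_space sc" and A: "\<And>x y. A (x + y) = A x + A y" "\<And>c x. A (sc c x) = sc c (A x)"
    and ne: "v \<noteq> w"
    and w: "((\<lambda>y. A y - sc w y) ^^ N) x = 0" and v: "((\<lambda>y. A y - sc v y) ^^ k) x = 0"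
  shows "x = 0"
  using w v
proof (induction N arbitrary: x)
  case (Suc N)
  interpret vector_space sc by fact
  let ?S = "\<lambda>y. A y - sc w y" and ?T = "\<lambda>y. A y - sc v y"
  have Ad: "A (x - y) = A x - A y" for x y using A(1)[of "x - y" y] by simp
  have com: "?T (?S y) = ?S (?T y)" for y
    by (simp add: Ad A(2) scale_right_diff_distrib mult.commute)
  have pcom: "(?T ^^ j) (?S y) = ?S ((?T ^^ j) y)" for j y
    by (induction j) (simp_all add: com del: scale_right_diff_distrib)
  have A0: "A 0 = 0" using A(1)[of 0 0] by simp
  have "?S x = 0"
  proof (rule Suc.IH)
    show "(?S ^^ N) (?S x) = 0" using Suc.prems(1) by (simp only: funpow_Suc_right o_apply)
    show "(?T ^^ k) (?S x) = 0" unfolding pcom Suc.prems(2) by (simp add: A0)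
  qed
  then have Tx: "?T x = sc (w - v) x" by (simp add: scale_left_diff_distrib)
  have "(?T ^^ j) x = sc ((w - v) ^ j) x" for j
  proof (induction j)
    case (Suc j)
    have "(?T ^^ Suc j) x = sc ((w - v) ^ j) (?T x)"
      using Suc by (simp add: A(2) scale_right_diff_distrib mult.commute)
    then show ?case by (simp add: Tx mult.commute)
  qed simp
  then show ?case using Suc.prems(2) ne by simp
qed simp

section \<open>Quantum cohomology\<close>

context monotone_symplectic
begin

sublocale H: vector_space "scH X" by (rule H_vector_space)

text \<open>Nondegeneracy of the Poincare pairing; it transfers additivity and homogeneity from the
  Gromov-Witten invariants to the quantum product.\<close>

lemma cup_cancel: "(\<And>z. top_integral X (cup X a z) = top_integral X (cup X b z)) \<Longrightarrow> a = b"
proof -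
  assume e: "\<And>z. top_integral X (cup X a z) = top_integral X (cup X b z)"
  have "top_integral X (cup X (a - b) z) = 0" for z
    using e[of z] cup_add_left[of "a - b" b z] integral_add[of "cup X (a - b) z" "cup X b z"] by simp
  then have "a - b = 0" by (rule Poincare_duality)
  then show "a = b" by simp
qed

lemma qprod_add_right: "qprod X x (y + z) = qprod X x y + qprod X x z"
  by (rule cup_cancel) (simp add: cup_add_left integral_add qprod_gw gw_add2 sum.distrib)

lemma qprod_scale_right: "qprod X x (scH X a y) = scH X a (qprod X x y)"
  by (rule cup_cancel) (simp add: cup_scale_left integral_scale qprod_gw gw_scale2 sum_distrib_left)

lemma degree_component_eq: "degree_component X p x = component {..2 * half_dim X} (coh X) x p"
  by (simp add: degree_component_def component_def)

lemma grading_op_add: "grading_op X (x + y) = grading_op X x + grading_op X y"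
proof -
  have "degree_component X p (x + y) = degree_component X p x + degree_component X p y" for p
    unfolding degree_component_eq
    by (rule component_add[OF coh_direct_sum]) (use coh_subspace in \<open>auto simp: H.subspace_def\<close>)
  then show ?thesis by (simp add: grading_op_def H.scale_right_distrib sum.distrib)
qed

lemma grading_op_0: "grading_op X 0 = 0"
  using grading_op_add[of 0 0] by simp

lemma qprod_0_right: "qprod X x 0 = 0"
  using qprod_add_right[of x 0 0] by simp

section \<open>Leading coefficients under the quantum connection\<close>

abbreviation D where "D \<equiv> u2nabla (QH_u X)"

lemma D_eq: "D x = u_times (u_times (d_du (scH X) x)) + u_times (fps_map (grading_op X) x) +
    fps_map (qprod X (c1 X)) x"
  by (simp add: QH_u_def)

lemma D_add: "D (x + y) = D x + D y"
proof (rule fps_ext)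
  fix n show "fps_nth (D (x + y)) n = fps_nth (D x + D y) n"
    by (simp add: D_eq fps_nth_u_times grading_op_add qprod_add_right H.scale_right_distrib algebra_simps)
qed

text \<open>The derivative term and the grading term of \<open>D\<close> raise the order in u by at
  least one, so only quantum multiplication by c_1 acts on the leading coefficient.\<close>

lemma D_low_order:
  assumes "\<And>k. k < n \<Longrightarrow> fps_nth x k = 0"
  shows "k < n \<Longrightarrow> fps_nth (D x) k = 0" "fps_nth (D x) n = qprod X (c1 X) (fps_nth x n)"
  using assms by (auto simp: D_eq fps_nth_u_times grading_op_0 qprod_0_right)

lemma D_shift_pow_low_order:
  fixes w :: complex
  assumes z: "\<And>k. k < n \<Longrightarrow> fps_nth x k = 0"
  defines "S \<equiv> \<lambda>x. D x + fps_map (scH X (- w)) x"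
  shows "fps_nth ((S ^^ N) x) n = ((\<lambda>y. qprod X (c1 X) y - scH X w y) ^^ N) (fps_nth x n)"
proof -
  have "(\<forall>k<n. fps_nth ((S ^^ N) x) k = 0) \<and>
    fps_nth ((S ^^ N) x) n = ((\<lambda>y. qprod X (c1 X) y - scH X w y) ^^ N) (fps_nth x n)"
  proof (induction N)
    case (Suc N)
    then show ?case using D_low_order[of n "(S ^^ N) x"] by (simp add: S_def)
  qed (simp add: z)
  then show ?thesis by simp
qed

lemma QH_u_simps [simp]: "add (QH_u X) = (+)" "carrier (QH_u X) = UNIV"
  "fps_const c \<odot>\<^bsub>QH_u X\<^esub> x = fps_map (scH X c) x" "fps_X \<odot>\<^bsub>QH_u X\<^esub> x = u_times x"
  by (simp_all add: QH_u_def fps_smult_const[OF H_vector_space] fps_smult_X[OF H_vector_space])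

lemma submodule_QH_u:
  assumes "submodule U CU (QH_u X)"
  shows "\<lbrakk>x \<in> U; y \<in> U\<rbrakk> \<Longrightarrow> x + y \<in> U" "x \<in> U \<Longrightarrow> fps_map (scH X c) x \<in> U" "x \<in> U \<Longrightarrow> u_times x \<in> U"
    "0 \<in> U"
proof -
  interpret submodule U CU "QH_u X" by fact
  show "\<lbrakk>x \<in> U; y \<in> U\<rbrakk> \<Longrightarrow> x + y \<in> U" using m_closed[of x y] by simp
  show "x \<in> U \<Longrightarrow> fps_map (scH X c) x \<in> U" using smult_closed[of "fps_const c" x] by (simp add: CU_def)
  show "x \<in> U \<Longrightarrow> u_times x \<in> U" using smult_closed[of fps_X x] by (simp add: CU_def)
  show "0 \<in> U" using one_closed by (simp add: QH_u_def)
qed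

end

section \<open>Projections to the summands of the Hukuhara-Levelt-Turrittin decomposition\<close>

context
  fixes X :: "('h::ab_group_add, 'g::ab_group_add, 'o, 'm::ab_group_add) symp_data"
    and V :: "complex \<Rightarrow> 'h fps set"
  assumes X: "monotone_symplectic X" and HLT: "HLT_decomposition X V"
begin

interpretation monotone_symplectic X by (rule X)

abbreviation proj where "proj \<equiv> component (c1_eigenvalues X) V"

lemma V_sub: "submodule (V v) CU (QH_u X)"
  and V_D: "x \<in> V v \<Longrightarrow> D x \<in> V v"
  and V_eigen: "v \<in> c1_eigenvalues X \<Longrightarrow> x \<in> V v \<Longrightarrow> fps_nth x 0 \<in> QH_eigenspace X v"
  and V_sum: "internal_direct_sum (c1_eigenvalues X) V"
  and V_trivial: "v \<notin> c1_eigenvalues X \<Longrightarrow> V v = {0}"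
  using HLT unfolding HLT_decomposition_def by blast+

lemma proj_add: "proj (x + y) v = proj x v + proj y v"
  by (rule component_add[OF V_sum]) (rule submodule_QH_u[OF V_sub])

lemma proj_D: "proj (D x) v = D (proj x v)"
  by (rule component_map[OF V_sum D_add]) (rule V_D)

lemma proj_scale: "proj (fps_map (scH X c) x) v = fps_map (scH X c) (proj x v)"
  by (rule component_map[OF V_sum])
    (auto intro!: submodule_QH_u[OF V_sub] fps_ext simp: H.scale_right_distrib)

lemma proj_u_times: "proj (u_times x) v = u_times (proj x v)"
  by (rule component_map[OF V_sum u_times_add]) (rule submodule_QH_u[OF V_sub])

lemma proj_mem: "proj x v \<in> V v"
  using component_props(1,2)[OF V_sum] submodule_QH_u(4)[OF V_sub] by (cases "v \<in> c1_eigenvalues X") auto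

lemma proj_of_mem:
  assumes "x \<in> V v" "v \<in> c1_eigenvalues X"
  shows "proj x i = (if i = v then x else 0)"
proof (cases "finite (c1_eigenvalues X)")
  case True
  have "proj x = (\<lambda>i. if i = v then x else 0)"
    by (rule component_eqI[OF V_sum]) (use assms True submodule_QH_u(4)[OF V_sub] in auto)
  then show ?thesis by simp
next
  case False
  \<comment> \<open>A sum over an infinite index set is 0 by convention, so the decomposition would
    force every element to be zero.\<close>
  have "y = 0" for y :: "'h fps" using component_props(3)[OF V_sum, of y] False by simp
  then show ?thesis by metis
qed

lemma mem_of_proj_vanishes:
  assumes "\<And>v. v \<noteq> w \<Longrightarrow> proj x v = 0"
  shows "x \<in> V w"
proof -
  have "x = (\<Sum>i\<in>c1_eigenvalues X. proj x i)" by (simp add: component_props(3)[OF V_sum])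
  also have "\<dots> = (\<Sum>i\<in>c1_eigenvalues X. if i = w then proj x w else 0)"
    by (intro sum.cong) (auto simp: assms)
  also have "\<dots> \<in> V w"
    using proj_mem[of x w] submodule_QH_u(4)[OF V_sub]
    by (cases "finite (c1_eigenvalues X)") auto
  finally show ?thesis .
qed

text \<open>Since the sum is direct, \<open>V v \<inter> u\<^sup>n QH[[u]] = u\<^sup>n V v\<close>.\<close>

lemma leading_coeff_eigen:
  assumes h: "h \<in> V v" and v: "v \<in> c1_eigenvalues X" and low: "\<And>k. k < n \<Longrightarrow> fps_nth h k = 0"
  shows "fps_nth h n \<in> QH_eigenspace X v"
  using h low
proof (induction n arbitrary: h)
  case 0
  then show ?case using V_eigen[OF v] by blast
next
  case (Suc n)
  \<comment> \<open>Division by u stays in the summand: u times a projection of \<open>z\<close> is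
    the corresponding projection of \<open>h\<close>, which is zero away from \<open>v\<close>, and
    multiplication by u is injective.\<close>
  define z where "z = Abs_fps (\<lambda>k. fps_nth h (Suc k))"
  have uz: "u_times z = h"
    using Suc.prems(2)[of 0] by (intro fps_ext) (auto simp: z_def fps_nth_u_times)
  have inj: "u_times a = 0 \<Longrightarrow> a = 0" for a :: "'h fps"
    by (metis fps_ext fps_nth_u_times_Suc fps_zero_nth)
  have "u_times (proj z i) = (if i = v then h else 0)" for i
    using proj_u_times[of z i] proj_of_mem[OF Suc.prems(1) v, of i] by (simp add: uz)
  then have "i \<noteq> v \<Longrightarrow> proj z i = 0" for i using inj by metis
  then have "z \<in> V v" by (rule mem_of_proj_vanishes)
  moreover have "fps_nth z k = 0" if "k < n" for k using Suc.prems(2)[of "Suc k"] that by (simp add: z_def)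
  ultimately have "fps_nth z n \<in> QH_eigenspace X v" by (rule Suc.IH)
  then show ?case by (simp add: z_def)
qed

text \<open>\<open>Z\<close> and \<phi> stand for the cycles and their images under the open-closed
  map. Divisibility of the projections by u^n is proved for all of \<open>Z\<close> at once, because
  the hypothesis trades \<open>x\<close> for another element \<open>q\<close>.\<close>

lemma proj_vanishes:
  fixes \<phi> :: "'c \<Rightarrow> 'h fps" and w :: complex
  defines "S \<equiv> \<lambda>x. D x + fps_map (scH X (- w)) x"
  assumes step: "\<And>x. x \<in> Z \<Longrightarrow> \<exists>N. \<exists>q\<in>Z. (S ^^ N) (\<phi> x) = u_times (\<phi> q)"
    and x: "x \<in> Z" and ne: "v \<noteq> w"
  shows "proj (\<phi> x) v = 0"
proof (cases "v \<in> c1_eigenvalues X")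
  case False
  then show ?thesis using proj_mem[of "\<phi> x" v] V_trivial by auto
next
  case v: True
  have projS: "proj ((S ^^ N) y) v = (S ^^ N) (proj y v)" for N y
    by (induction N) (simp_all add: S_def proj_add proj_D proj_scale)
  have "\<forall>x\<in>Z. \<forall>k<n. fps_nth (proj (\<phi> x) v) k = 0" for n
  proof (induction n)
    case (Suc n)
    show ?case
    proof (intro ballI allI impI)
      fix x k assume x: "x \<in> Z" and k: "k < Suc n"
      let ?h = "proj (\<phi> x) v"
      have low: "\<And>k. k < n \<Longrightarrow> fps_nth ?h k = 0" using Suc x by blast
      obtain N q where q: "q \<in> Z" "(S ^^ N) (\<phi> x) = u_times (\<phi> q)" using step[OF x] by blast
      have "((\<lambda>y. qprod X (c1 X) y - scH X w y) ^^ N) (fps_nth ?h n) = fps_nth ((S ^^ N) ?h) n"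
        using D_shift_pow_low_order[of n ?h N w] low by (simp add: S_def)
      also have "\<dots> = fps_nth (u_times (proj (\<phi> q) v)) n"
        by (simp add: projS[symmetric] q(2) proj_u_times)
      \<comment> \<open>For n > 0 this is the coefficient of index n - 1 for \<open>q\<close>, which
        the induction hypothesis covers; for n = 0 it is 0 because of the factor u.\<close>
      also have "\<dots> = 0" using Suc q(1) by (auto simp: fps_nth_u_times)
      finally have 1: "((\<lambda>y. qprod X (c1 X) y - scH X w y) ^^ N) (fps_nth ?h n) = 0" .
      have "fps_nth ?h n \<in> QH_eigenspace X v"
        by (rule leading_coeff_eigen[OF proj_mem v low])
      then obtain j where 2: "((\<lambda>y. qprod X (c1 X) y - scH X v y) ^^ j) (fps_nth ?h n) = 0"
        unfolding QH_eigenspace_def by blast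
      have "fps_nth ?h n = 0"
        by (rule generalized_eigenspaces_disjoint[OF H_vector_space qprod_add_right qprod_scale_right ne 1 2])
      then show "fps_nth ?h k = 0" using low k by (cases "k = n") auto
    qed
  qed simp
  then show ?thesis using x by (intro fps_ext) (metis fps_zero_nth lessI)
qed

end

section \<open>The image of the cyclic open-closed map\<close>

theorem corollary1p12:
  fixes X :: "('h::ab_group_add, 'g::ab_group_add, 'o, 'm::ab_group_add) symp_data"
    and w :: complex
    and QH_summand :: "complex \<Rightarrow> 'h fps set"
    and OC :: "('o, 'm) chain fps set \<Rightarrow> 'h fps"
  assumes "monotone_symplectic X"
    and "HLT_decomposition X QH_summand"
    and "Hodge_de_Rham_degenerates (Fuk X w)"
    and "E_structure (HC_minus (Fuk X w))"
    and "HH_finite_dimensional (Fuk X w)"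
    and "TE_morphism (HC_minus (Fuk X w)) (QH_u X) OC"
  shows "OC ` carrier (HC_minus (Fuk X w)) \<subseteq> QH_summand w"
proof -
  interpret X: monotone_symplectic X by fact
  let ?C = "Fuk X w"
  interpret C: weakly_curved_ainf_cat ?C w by (rule X.Fuk_ainf)
  note E = assms(4) and TE = assms(6)
  let ?Z = "cyc_cycles ?C"
  \<comment> \<open>Passing to representatives lets powers of the shifted connection be computed on
    chains.\<close>
  define \<phi> where "\<phi> x = OC (cyc_class ?C x)" for x
  have car: "cyc_class ?C x \<in> carrier (HC_minus ?C)" if "x \<in> ?Z" for x
    using that by (simp add: C.HC_minus_carrier)
  have \<phi>_add: "\<phi> (x + y) = \<phi> x + \<phi> y" if "x \<in> ?Z" "y \<in> ?Z" for x y
    using TE car[OF that(1)] car[OF that(2)] unfolding TE_morphism_def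
    by (simp add: \<phi>_def C.HC_minus_add[symmetric])
  have \<phi>_scale: "\<phi> (fps_map (cscale c) x) = fps_map (scH X c) (\<phi> x)"
    and \<phi>_u: "\<phi> (u_times x) = u_times (\<phi> x)"
    and \<phi>_D: "\<phi> (u2nabla_chain ?C x) = u2nabla (QH_u X) (\<phi> x)" if "x \<in> ?Z" for x c
    using TE car[OF that] unfolding TE_morphism_def
    by (simp_all add: \<phi>_def C.HC_minus_scale[symmetric] C.HC_minus_X[symmetric] C.HC_minus_u2nabla[OF E, symmetric])
  have step: "\<exists>N. \<exists>q\<in>?Z. ((\<lambda>x. u2nabla (QH_u X) x + fps_map (scH X (- w)) x) ^^ N) (\<phi> x) = u_times (\<phi> q)"
    if x: "x \<in> ?Z" for x
  proof -
    let ?\<Delta> = "\<lambda>x. u2nabla_chain ?C x + fps_map (cscale (- w)) x"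
    obtain N q where q: "q \<in> ?Z" "(?\<Delta> ^^ N) x - u_times q \<in> cyc_boundaries ?C"
      using C.shift_pow_divisible[OF E x] by blast
    \<comment> \<open>Being a cycle is carried along, since \<phi> is known to respect the
      operations on cycles only.\<close>
    have "(?\<Delta> ^^ j) x \<in> ?Z \<and>
        \<phi> ((?\<Delta> ^^ j) x) = ((\<lambda>x. u2nabla (QH_u X) x + fps_map (scH X (- w)) x) ^^ j) (\<phi> x)" for j
    proof (induction j)
      case (Suc j)
      then have z: "(?\<Delta> ^^ j) x \<in> ?Z" by blast
      note m = C.u2nabla_chain_cycles[OF E z] C.cyc_cycles_scale[OF z, of "- w"]
      show ?case
        using Suc C.cyc_cycles_add[OF m] \<phi>_add[OF m] \<phi>_D[OF z] \<phi>_scale[OF z, of "- w"]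
        by (simp del: cs.scale_minus_left X.H.scale_minus_left)
    qed (simp add: x)
    then have "((\<lambda>x. u2nabla (QH_u X) x + fps_map (scH X (- w)) x) ^^ N) (\<phi> x) = \<phi> ((?\<Delta> ^^ N) x)"
      by simp
    also have "\<dots> = \<phi> (u_times q)" unfolding \<phi>_def by (simp add: C.cyc_class_eqI[OF q(2)])
    also have "\<dots> = u_times (\<phi> q)" by (rule \<phi>_u[OF q(1)])
    finally show ?thesis using q(1) by blast
  qed
  have "\<phi> x \<in> QH_summand w" if "x \<in> ?Z" for x
    by (rule mem_of_proj_vanishes[OF assms(1,2)], rule proj_vanishes[OF assms(1,2) step that])
  then show ?thesis by (auto simp: C.HC_minus_carrier \<phi>_def)
qed

end
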